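(* Let $n\ge2$, $\pi\in\mathbb{S}_{2n}$ of type $(2^n)$ (product of $n$ disjoint transpositions), $\mathcal{O}_\pi$ its conjugacy class, and $\rho$ an irreducible representation of $\mathbb{S}_{2n}^\pi$. (a) If $n$ is even, then $\dim\mathfrak{B}(\mathcal{O}_\pi,\rho)=\infty$. (b) If $n$ is odd and $\rho\notin\{\chi_{(n)}\otimes\epsilon,\ \chi_{(n)}\otimes\mathrm{sgn}\}$, then $\dim\mathfrak{B}(\mathcal{O}_\pi,\rho)=\infty$.
   Context: Permutations are composed right to left. For a finite group $G$, a conjugacy class $\mathcal{C}$, a fixed $s\in\mathcal{C}$ with centralizer $G^s$ and an irreducible representation $(\rho,V)$ of $G^s$, $M(\mathcal{C},\rho)$ is the irreducible Yetter–Drinfeld module over $\mathbb{C}G$: enumerate $\mathcal{C}=\{t_1=s,\dots,t_M\}$, choose $g_i\in G$ with $g_isg_i^{-1}=t_i$; $M(\mathcal{C},\rho)=\bigoplus_i g_i\otimes V$ with grading $\deg(g_i\otimes v)=t_i$, action $g\cdot(g_i\otimes v)=g_j\otimes\rho(\gamma)v$ where $gg_i=g_j\gamma$, $\gamma\in G^s$, and braiding $c((g_i\otimes v)\otimes(g_j\otimes w))=(g_h\otimes\rho(\gamma)w)\otimes(g_i\otimes v)$ where $t_ig_j=g_h\gamma$. $\mathfrak{B}(\mathcal{C},\rho)$ is the Nichols algebra of this braided vector space. Take $\pi=A_1\cdots A_n$ with $A_i=(2i-1\ \ 2i)$; then $\mathbb{S}_{2n}^\pi=\langle A_1,\dots,A_n\rangle\rtimes\langle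 B_1,\dots,B_{n-1}\rangle\cong\mathbb{Z}_2^n\rtimes\mathbb{S}_n$, with $B_j=(2j-1\ \ 2j+1)(2j\ \ 2j+2)$ corresponding to $(j\ j+1)$. $\chi_{(n)}\otimes\epsilon$ (resp. $\chi_{(n)}\otimes\mathrm{sgn}$) is the character with $A_i\mapsto-1$ for all $i$ and $B_j\mapsto1$ (resp. $B_j\mapsto-1$) for all $j$. *)

theory Defs
  imports "HOL-Combinatorics.Transposition" "HOL-Combinatorics.Permutations"
    "Jordan_Normal_Form.DL_Rank" "HOL-Library.Extended_Nat"
begin

definition Atr :: "nat \<Rightarrow> nat \<Rightarrow> nat" where
  "Atr i = transpose (2*i - 1) (2*i)"

definition Btr :: "nat \<Rightarrow> nat \<Rightarrow> nat" where
  "Btr j = transpose (2*j - 1) (2*j + 1) \<circ> transpose (2*j) (2*j + 2)"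

definition pi_std :: "nat \<Rightarrow> nat \<Rightarrow> nat" where
  "pi_std n = foldr (\<circ>) (map Atr [1..<n+1]) id"

definition conj_class :: "nat \<Rightarrow> (nat \<Rightarrow> nat) \<Rightarrow> (nat \<Rightarrow> nat) set" where
  "conj_class n s = {g \<circ> s \<circ> inv_into UNIV g | g. g permutes {1..2*n}}"

definition centralizer :: "nat \<Rightarrow> (nat \<Rightarrow> nat) \<Rightarrow> (nat \<Rightarrow> nat) set" where
  "centralizer n s = {g. g permutes {1..2*n} \<and> g \<circ> s = s \<circ> g}"

definition is_rep :: "(nat \<Rightarrow> nat) set \<Rightarrow> nat \<Rightarrow> ((nat \<Rightarrow> nat) \<Rightarrow> complex mat) \<Rightarrow> bool" where
  "is_rep H d \<rho> \<longleftrightarrow> (\<forall>g\<in>H. \<rho> g \<in> carrier_mat d d)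
      \<and> (\<forall>g\<in>H. \<forall>h\<in>H. \<rho> (g \<circ> h) = \<rho> g * \<rho> h) \<and> \<rho> id = 1\<^sub>m d"

definition invariant_subspace ::
  "(nat \<Rightarrow> nat) set \<Rightarrow> nat \<Rightarrow> ((nat \<Rightarrow> nat) \<Rightarrow> complex mat) \<Rightarrow> complex vec set \<Rightarrow> bool" where
  "invariant_subspace H d \<rho> W \<longleftrightarrow> W \<subseteq> carrier_vec d \<and> 0\<^sub>v d \<in> W
      \<and> (\<forall>v\<in>W. \<forall>w\<in>W. v + w \<in> W) \<and> (\<forall>a. \<forall>v\<in>W. a \<cdot>\<^sub>v v \<in> W)
      \<and> (\<forall>g\<in>H. \<forall>v\<in>W. \<rho> g *\<^sub>v v \<in> W)"

definition irred_rep :: "(nat \<Rightarrow> nat) set \<Rightarrow> nat \<Rightarrow> ((nat \<Rightarrow> nat) \<Rightarrow> complex mat) \<Rightarrow> bool" where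
  "irred_rep H d \<rho> \<longleftrightarrow> is_rep H d \<rho> \<and> d > 0
      \<and> (\<forall>W. invariant_subspace H d \<rho> W \<longrightarrow> W = {0\<^sub>v d} \<or> W = carrier_vec d)"

definition yd_enum :: "nat \<Rightarrow> (nat \<Rightarrow> nat) \<Rightarrow> nat \<Rightarrow> (nat \<Rightarrow> nat \<Rightarrow> nat) \<Rightarrow> (nat \<Rightarrow> nat \<Rightarrow> nat) \<Rightarrow> bool" where
  "yd_enum n s M t g \<longleftrightarrow> bij_betw t {..<M} (conj_class n s) \<and> t 0 = s
      \<and> (\<forall>i<M. g i permutes {1..2*n} \<and> g i \<circ> s \<circ> inv_into UNIV (g i) = t i)"

text \<open>For t_i g_j = g_h gamma with gamma in the centralizer: the index h and the element gamma.\<close>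

definition yd_h :: "nat \<Rightarrow> (nat \<Rightarrow> nat) \<Rightarrow> nat \<Rightarrow> (nat \<Rightarrow> nat \<Rightarrow> nat) \<Rightarrow> (nat \<Rightarrow> nat \<Rightarrow> nat) \<Rightarrow> nat \<Rightarrow> nat \<Rightarrow> nat" where
  "yd_h n s M t g i j = (THE h. h < M \<and> inv_into UNIV (g h) \<circ> t i \<circ> g j \<in> centralizer n s)"

definition yd_gamma :: "nat \<Rightarrow> (nat \<Rightarrow> nat) \<Rightarrow> nat \<Rightarrow> (nat \<Rightarrow> nat \<Rightarrow> nat) \<Rightarrow> (nat \<Rightarrow> nat \<Rightarrow> nat) \<Rightarrow> nat \<Rightarrow> nat \<Rightarrow> nat \<Rightarrow> nat" where
  "yd_gamma n s M t g i j = inv_into UNIV (g (yd_h n s M t g i j)) \<circ> t i \<circ> g j"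

text \<open>Basis of M(C,rho): e_x = g_i (x) e_a with x = i*d + a, i < M, a < d (e_a standard basis of C^d).
  Braiding coefficients: c(e_x (x) e_y) = sum over u v of  yd_coeff u v x y  e_u (x) e_v.
  Here c((g_i (x) e_a) (x) (g_j (x) e_b)) = (g_h (x) rho(gamma) e_b) (x) (g_i (x) e_a).\<close>

definition yd_coeff :: "nat \<Rightarrow> (nat \<Rightarrow> nat) \<Rightarrow> nat \<Rightarrow> (nat \<Rightarrow> nat \<Rightarrow> nat) \<Rightarrow> (nat \<Rightarrow> nat \<Rightarrow> nat)
    \<Rightarrow> nat \<Rightarrow> ((nat \<Rightarrow> nat) \<Rightarrow> complex mat) \<Rightarrow> nat \<Rightarrow> nat \<Rightarrow> nat \<Rightarrow> nat \<Rightarrow> complex" where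
  "yd_coeff n s M t g d \<rho> u v x y =
     (if v = x \<and> u div d = yd_h n s M t g (x div d) (y div d)
      then \<rho> (yd_gamma n s M t g (x div d) (y div d)) $$ (u mod d, y mod d) else 0)"

text \<open>A basis vector of V^(tensor m) is a word of length m in {0..<D}, encoded as the number
  whose base-D digit p is the letter at position p (positions 0..m-1).\<close>

definition dig :: "nat \<Rightarrow> nat \<Rightarrow> nat \<Rightarrow> nat" where
  "dig D r p = r div D ^ p mod D"

text \<open>c_k: the braiding acting on tensor positions k, k+1 of V^(tensor m).\<close>

definition bmat :: "nat \<Rightarrow> (nat \<Rightarrow> nat \<Rightarrow> nat \<Rightarrow> nat \<Rightarrow> complex) \<Rightarrow> nat \<Rightarrow> nat \<Rightarrow> complex mat" where
  "bmat D cf m k = mat (D ^ m) (D ^ m) (\<lambda>(r, q).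
     if (\<forall>p<m. p \<noteq> k \<and> p \<noteq> Suc k \<longrightarrow> dig D r p = dig D q p)
     then cf (dig D r k) (dig D r (Suc k)) (dig D q k) (dig D q (Suc k)) else 0)"

text \<open>T_m = id + c_(m-1) + c_(m-1) c_(m-2) + ... + c_(m-1)...c_1 (1-based positions).\<close>

definition shuffle_op :: "nat \<Rightarrow> (nat \<Rightarrow> nat \<Rightarrow> nat \<Rightarrow> nat \<Rightarrow> complex) \<Rightarrow> nat \<Rightarrow> complex mat" where
  "shuffle_op D cf m = foldr (+)
     (map (\<lambda>j. foldr (*) (map (\<lambda>l. bmat D cf m (m - 2 - l)) [0..<j]) (1\<^sub>m (D ^ m))) [0..<m])
     (0\<^sub>m (D ^ m) (D ^ m))"

text \<open>X (tensor) id : V^(tensor (m-1)) (tensor) V, X acting on the first m-1 positions.\<close>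

definition ext_op :: "nat \<Rightarrow> complex mat \<Rightarrow> nat \<Rightarrow> complex mat" where
  "ext_op D X m = mat (D ^ m) (D ^ m) (\<lambda>(r, q).
     if r div D ^ (m - 1) = q div D ^ (m - 1) then X $$ (r mod D ^ (m - 1), q mod D ^ (m - 1)) else 0)"

text \<open>Quantum symmetrizer, via the standard factorization S_m = (S_(m-1) (tensor) id) T_m,
  i.e. S_m = sum over sigma in S_m of the Matsumoto lifts of sigma.\<close>

fun qsym :: "nat \<Rightarrow> (nat \<Rightarrow> nat \<Rightarrow> nat \<Rightarrow> nat \<Rightarrow> complex) \<Rightarrow> nat \<Rightarrow> complex mat" where
  "qsym D cf 0 = 1\<^sub>m 1"
| "qsym D cf (Suc m) = ext_op D (qsym D cf m) (Suc m) * shuffle_op D cf (Suc m)"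

text \<open>B(V) = direct sum of V^(tensor m) / ker S_m, so dim B^m(V) = rank S_m.\<close>

definition nichols_dim :: "nat \<Rightarrow> (nat \<Rightarrow> nat \<Rightarrow> nat \<Rightarrow> nat \<Rightarrow> complex) \<Rightarrow> enat" where
  "nichols_dim D cf = (SUP N. \<Sum>m<N. enat (vec_space.rank (D ^ m) (qsym D cf m)))"

end

(*
  If rho(pi) = 1, a vector x of degree pi satisfies c(x (x) x) = x (x) x and all its powers survive.
  Otherwise rho(pi) = -1. Three commuting conjugates of pi, permuted cyclically by an element of
  order 3 that moves two neighbouring blocks only, carry a braided subspace of diagonal type with
  q_ii = -1 whose generalized Dynkin diagram (edges where q_ij q_ji = -1) is a triangle if some
  product A_j A_(j+1) acts nontrivially, and a hexagon if all of them act trivially but some B_j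
  is not a scalar. In the remaining case rho is one of the two exceptional characters.

  The triangle and the hexagon are the affine diagrams A_2^(1) and A_5^(1) at q = -1. To see that
  no quantum symmetrizer S_m vanishes there, regard its rows as functions on words. Inserting a
  letter i anywhere, weighted by the braiding with what it passes on the left or on the right,
  maps rows of S_m to rows of S_(m+1). The half sum and the half difference of the two operators
  insert i only into the gaps of one parity, a gap being delimited by the neighbours of i in the
  diagram. On the indicator function of the paths of one particle around the triangle, or of two
  particles around the hexagon, the insertions in the interior cancel in pairs because q_ii = -1,
  and only the ends of the path contribute. At an end where both the start and the finish accept i
  the result is a sum of two path functions; they are separated by means of paths in which one
  letter near the finish is left out, since filling that hole is again such an insertion.
*)

theory Submission
  imports Defs "HOL-Library.Multiset" "Jordan_Normal_Form.DL_Rank_Submatrix"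
begin

text \<open>The parity of n enters through pi alone: if all A_j A_(j+1) act trivially, every A_i
  acts by one sign \<alpha> and pi by \<alpha>^n; as pi acts by -1, \<alpha> = -1 and n is odd. The
  diagrams come from eigenvalues. Each conjugate (a "place") carries copies of vectors of V, and
  q_ij is the eigenvalue on the j-th vector of the conjugate indexed by the difference of the two
  places. If A_j A_(j+1) = -1 and B_j = \<epsilon> on a vector, the three eigenvalues are -1,
  \<epsilon>, -\<epsilon>, so q_ij q_ji = -1 for any two places. If A_j A_(j+1) = 1 they are -1,
  -\<epsilon>, -\<epsilon>, and one vector gives no edge at all. Both eigenvectors of B_j are then
  used, and edges join different eigenvectors in different places: K_(3,3) minus a perfect matching,
  a hexagon. The kernel of S_m is never computed. One nonzero function in the span of the rows, in
  arbitrarily high degree, suffices. All q_ij are signs, so q_ij and q_ji agree up to sign; this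
  makes insertion from the left and from the right comparable.\<close>

section \<open>Letter insertion on functions of words\<close>

text \<open>Deleting an \<open>i\<close> from the argument is dual to inserting \<open>i\<close>
  into the function: the indicator of \<open>v\<close> becomes the weighted sum of the indicators of
  all words obtained by inserting \<open>i\<close> into \<open>v\<close>, with a factor
  \<open>a j\<close> for every letter to the left of the insertion.\<close>

fun del_op :: "('a \<Rightarrow> complex) \<Rightarrow> 'a \<Rightarrow> ('a list \<Rightarrow> complex) \<Rightarrow> 'a list \<Rightarrow> complex" where
  "del_op a i \<Phi> [] = 0"
| "del_op a i \<Phi> (j # w) = (if j = i then \<Phi> w else 0) + a j * del_op a i (\<lambda>v. \<Phi> (j # v)) w"

lemma del_op_linear:
  "del_op a i (\<lambda>v. c * \<Phi> v + d * \<Psi> v) w = c * del_op a i \<Phi> w + d * del_op a i \<Psi> w"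
proof (induction w arbitrary: \<Phi> \<Psi>)
  case (Cons j w)
  show ?case by (simp add: Cons algebra_simps)
qed simp

lemma del_op_zero: "del_op a i (\<lambda>v. 0) w = 0"
  by (induction w) auto

lemma del_op_scale: "del_op a i (\<lambda>v. c * \<Phi> v) w = c * del_op a i \<Phi> w"
  using del_op_linear[of a i c \<Phi> 0 "\<lambda>_. 0" w] by simp

lemma del_op_add: "del_op a i (\<lambda>v. \<Phi> v + \<Psi> v) w = del_op a i \<Phi> w + del_op a i \<Psi> w"
  using del_op_linear[of a i 1 \<Phi> 1 \<Psi> w] by simp

lemma del_op_if: "del_op a i (\<lambda>v. if P then \<Phi> v else 0) w = (if P then del_op a i \<Phi> w else 0)"
  by (simp add: del_op_zero)

text \<open>The operators interact only through the relative position of the two letters. If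
  \<open>i\<close> stands before \<open>k\<close>, the left side picks up \<open>a i = c\<close>; if
  \<open>k\<close> stands before \<open>i\<close>, the right side picks up \<open>b k = c\<close>,
  which the prefactor \<open>c\<close> cancels.\<close>

lemma del_op_commute:
  assumes "a i = c" "b k = c" "c * c = 1"
  shows "del_op a k (del_op b i \<Phi>) w = c * del_op b i (del_op a k \<Phi>) w"
proof (induction w arbitrary: \<Phi>)
  case (Cons j w)
  have 1: "del_op a k (del_op b i \<Phi>) (j # w) = (if j = k then del_op b i \<Phi> w else 0)
      + a j * (if j = i then del_op a k \<Phi> w else 0)
      + a j * b j * del_op a k (del_op b i (\<lambda>v. \<Phi> (j # v))) w"
    by (simp add: del_op_add del_op_scale del_op_if algebra_simps)
  have 2: "del_op b i (del_op a k \<Phi>) (j # w) = (if j = i then del_op a k \<Phi> w else 0)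
      + b j * (if j = k then del_op b i \<Phi> w else 0)
      + a j * b j * del_op b i (del_op a k (\<lambda>v. \<Phi> (j # v))) w"
    by (simp add: del_op_add del_op_scale del_op_if algebra_simps)
  show ?case unfolding 1 2 Cons using assms by (auto simp: algebra_simps)
qed simp

lemma del_op_explicit:
  "del_op a i \<Phi> w = (\<Sum>p<length w. if w ! p = i
      then prod_list (map a (take p w)) * \<Phi> (take p w @ drop (Suc p) w) else 0)"
proof (induction w arbitrary: \<Phi>)
  case (Cons j w)
  show ?case
    by (simp add: Cons sum.lessThan_Suc_shift sum_distrib_left if_distrib mult.assoc
        del: sum.lessThan_Suc cong: if_cong)
qed simp

lemma del_op_mset:
  assumes "\<And>v. \<Phi> v \<noteq> 0 \<Longrightarrow> mset v = M" "del_op a i \<Phi> w \<noteq> 0"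
  shows "mset w = add_mset i M"
proof -
  obtain p where p: "p < length w" "w ! p = i" "\<Phi> (take p w @ drop (Suc p) w) \<noteq> 0"
    using assms(2) unfolding del_op_explicit by (auto elim!: sum.not_neutral_contains_not_neutral split: if_splits)
  have "mset w = mset (take p w @ w ! p # drop (Suc p) w)"
    using id_take_nth_drop[OF p(1)] by simp
  then show ?thesis using assms(1)[OF p(3)] p(2) by simp
qed

section \<open>The braided symmetrizer form of a diagonal braiding\<close>

text \<open>The matrix of the quantum symmetrizer for the diagonal braiding with matrix
  \<open>q\<close>, between a word \<open>u\<close> of dual functionals and a word \<open>w\<close>
  of basis vectors (see \<open>qsym_pair\<close>). A letter \<open>i\<close> of \<open>w\<close> is
  braided to the front; passing \<open>j\<close> costs \<open>q j i\<close>.\<close>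

fun wform :: "('a \<Rightarrow> 'a \<Rightarrow> complex) \<Rightarrow> 'a list \<Rightarrow> 'a list \<Rightarrow> complex" where
  "wform q [] w = (if w = [] then 1 else 0)"
| "wform q (i # u) w = del_op (\<lambda>j. q j i) i (wform q u) w"

lemma wform_mset: "wform q u w \<noteq> 0 \<Longrightarrow> mset w = mset u"
proof (induction u arbitrary: w)
  case Nil then show ?case by (auto split: if_splits)
next
  case (Cons i u)
  have "mset w = add_mset i (mset u)"
    by (rule del_op_mset[of "wform q u"]) (use Cons in auto)
  then show ?case by simp
qed

text \<open>The form peels letters off the left of \<open>u\<close>, the symmetrizer off the right.
  By \<open>del_op_commute\<close> left and right insertions commute up to a sign
  \<open>q i k\<close>, so the last letter can be pulled out through all of \<open>u\<close>; the
  collected signs are the prefactor.\<close>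

lemma wform_snoc:
  assumes q: "\<And>i j. q i j * q i j = 1"
  shows "wform q (u @ [i]) w = prod_list (map (q i) u) * del_op (q i) i (wform q u) w"
proof (induction u arbitrary: w)
  case Nil
  have "del_op a i (\<lambda>w. if w = [] then 1 else 0) w = (if w = [i] then 1 else 0)" for a
  proof (cases w)
    case (Cons j v)
    have "del_op a i (\<lambda>_. 0) v = 0" by (rule del_op_zero)
    then show ?thesis using Cons by auto
  qed simp
  moreover have "wform q [] = (\<lambda>w. if w = [] then 1 else 0)" by auto
  ultimately show ?case by simp
next
  case (Cons k u)
  have "wform q (u @ [i]) = (\<lambda>w. prod_list (map (q i) u) * del_op (q i) i (wform q u) w)"
    using Cons by auto
  then have "wform q ((k # u) @ [i]) w
      = prod_list (map (q i) u) * del_op (\<lambda>j. q j k) k (del_op (q i) i (wform q u)) w"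
    by (simp add: del_op_scale)
  also have "del_op (\<lambda>j. q j k) k (del_op (q i) i (wform q u)) w
      = q i k * del_op (q i) i (del_op (\<lambda>j. q j k) k (wform q u)) w"
    by (rule del_op_commute) (use q in auto)
  finally show ?case by (simp add: mult.assoc mult.left_commute)
qed

text \<open>Moves the weights from the prefix to the suffix, where \<open>shuffle_op\<close>
  produces them. If the inner form is nonzero, \<open>u\<close> and the rest of \<open>w\<close>
  have the same letters, so the prefix occurs squared and drops out.\<close>

lemma wform_snoc_explicit:
  assumes q: "\<And>i j. q i j * q i j = 1"
  shows "wform q (u @ [i]) w = (\<Sum>p<length w. if w ! p = i
      then prod_list (map (q i) (drop (Suc p) w)) * wform q u (take p w @ drop (Suc p) w) else 0)"
proof -
  have sq: "prod_list (map (q i) v) * prod_list (map (q i) v) = 1" for v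
  proof (induction v)
    case (Cons x v)
    have "prod_list (map (q i) (x # v)) * prod_list (map (q i) (x # v))
        = (q i x * q i x) * (prod_list (map (q i) v) * prod_list (map (q i) v))"
      by (simp add: algebra_simps)
    then show ?case using Cons q by simp
  qed simp
  have "prod_list (map (q i) u) * (prod_list (map (q i) (take p w)) * wform q u (take p w @ drop (Suc p) w))
      = prod_list (map (q i) (drop (Suc p) w)) * wform q u (take p w @ drop (Suc p) w)" for p
  proof (cases "wform q u (take p w @ drop (Suc p) w) = 0")
    case False
    then have "mset u = mset (take p w @ drop (Suc p) w)" using wform_mset by metis
    then have "prod_list (map (q i) u) = prod_list (map (q i) (take p w @ drop (Suc p) w))"
      by (metis mset_map prod_mset_prod_list)
    then show ?thesis using sq[of "take p w"] by (simp add: algebra_simps)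
  qed simp
  then show ?thesis
    unfolding wform_snoc[OF q] del_op_explicit sum_distrib_left by (intro sum.cong) auto
qed

text \<open>Twist equivalence: up to signs attached to words, only q_ii and q_ij q_ji matter. The
  sign \<tau> is the product of \<open>t\<close> over all pairs of positions of a word; the linear
  order puts the discrepancy of an unordered pair of letters on one of its two orientations.\<close>

lemma wform_twist:
  fixes q q' :: "'a::linorder \<Rightarrow> 'a \<Rightarrow> complex"
  assumes q: "\<And>i j. q i j * q i j = 1" and q': "\<And>i j. q' i j * q' i j = 1"
    and diag: "\<And>i. i \<in> I \<Longrightarrow> q i i = q' i i"
    and sym: "\<And>i j. i \<in> I \<Longrightarrow> j \<in> I \<Longrightarrow> q i j * q j i = q' i j * q' j i"
  shows "\<exists>\<tau>. (\<forall>v. \<tau> v * \<tau> v = 1) \<and>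
    (\<forall>u w. set u \<subseteq> I \<longrightarrow> set w \<subseteq> I \<longrightarrow> wform q' u w = \<tau> u * \<tau> w * (wform q u w :: complex))"
proof -
  define t where "t i j = (if i < j then q i j * q' i j else 1)" for i j
  have tsq: "t i j * t i j = 1" for i j
    using q[of i j] q'[of i j] unfolding t_def by (simp add: algebra_simps)
  have tq: "q' j i = q j i * (t j i * t i j)" if "i \<in> I" "j \<in> I" for i j
  proof -
    consider "i < j" | "i = j" | "j < i" by (metis linorder_neqE)
    then show ?thesis
    proof cases
      case 1
      have "q j i * (t j i * t i j) = (q i j * q j i) * q' i j" using 1 by (simp add: t_def)
      also have "\<dots> = q' j i * (q' i j * q' i j)" using sym[OF that] by simp
      finally show ?thesis using q' by simp
    next
      case 2 then show ?thesis using diag that by (simp add: t_def)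
    next
      case 3
      have "q j i * (t j i * t i j) = (q j i * q j i) * q' j i" using 3 by (simp add: t_def)
      then show ?thesis using q by simp
    qed
  qed
  define \<tau> where "\<tau> = rec_list (1::complex) (\<lambda>j v r. prod_list (map (t j) v) * r)"
  have \<tau>N: "\<tau> [] = 1" and \<tau>C: "\<And>j v. \<tau> (j # v) = prod_list (map (t j) v) * \<tau> v"
    by (auto simp: \<tau>_def)
  have psq: "prod_list (map (t j) v) * prod_list (map (t j) v) = 1" for j v
  proof (induction v)
    case (Cons x v)
    have "prod_list (map (t j) (x # v)) * prod_list (map (t j) (x # v))
        = (t j x * t j x) * (prod_list (map (t j) v) * prod_list (map (t j) v))"
      by (simp add: algebra_simps)
    then show ?case using Cons tsq by simp
  qed simp
  have \<tau>sq: "\<tau> v * \<tau> v = 1" for v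
  proof (induction v)
    case (Cons j v)
    have "\<tau> (j # v) * \<tau> (j # v) = (prod_list (map (t j) v) * prod_list (map (t j) v)) * (\<tau> v * \<tau> v)"
      unfolding \<tau>C by (simp add: algebra_simps)
    then show ?case using Cons psq by simp
  qed (simp add: \<tau>N)
  have \<tau>ins: "\<tau> (v @ i # v') = \<tau> (v @ v') * prod_list (map (\<lambda>j. t j i) v) * prod_list (map (t i) v')" for v i v'
    by (induction v) (simp_all add: \<tau>C algebra_simps)
  have main: "wform q' u w = \<tau> u * \<tau> w * wform q u w" if "set u \<subseteq> I" "set w \<subseteq> I" for u w
    using that
  proof (induction u arbitrary: w)
    case Nil
    show ?case by (simp add: \<tau>N)
  next
    case (Cons i u)
    have "prod_list (map (\<lambda>j. q' j i) (take p w)) * wform q' u (take p w @ drop (Suc p) w)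
      = \<tau> (i # u) * \<tau> w * (prod_list (map (\<lambda>j. q j i) (take p w)) * wform q u (take p w @ drop (Suc p) w))"
      if p: "p < length w" "w ! p = i" for p
    proof (cases "wform q u (take p w @ drop (Suc p) w) = 0")
      case True
      have "set (take p w @ drop (Suc p) w) \<subseteq> I"
        using Cons.prems set_take_subset[of p w] set_drop_subset[of "Suc p" w] by auto
      then have "wform q' u (take p w @ drop (Suc p) w) = 0"
        using True Cons by (metis Cons.IH insert_subset list.simps(15) mult_zero_right)
      then show ?thesis using True by simp
    next
      case False
      let ?A = "take p w" and ?B = "drop (Suc p) w"
      have sub: "set (?A @ ?B) \<subseteq> I"
        using Cons.prems set_take_subset[of p w] set_drop_subset[of "Suc p" w] by auto
      have w: "w = ?A @ i # ?B" using id_take_nth_drop[OF p(1)] p(2) by simp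
      have ms: "mset u = mset (?A @ ?B)" using False wform_mset by metis
      have "prod_list (map (t i) u) = prod_list (map (t i) (?A @ ?B))"
        using ms by (metis mset_map prod_mset_prod_list)
      then have tu: "\<tau> (i # u) = prod_list (map (t i) ?A) * prod_list (map (t i) ?B) * \<tau> u"
        by (simp add: \<tau>C)
      have tw: "\<tau> w = \<tau> (?A @ ?B) * prod_list (map (\<lambda>j. t j i) ?A) * prod_list (map (t i) ?B)"
        using \<tau>ins[of ?A i ?B] w by simp
      have qA: "prod_list (map (\<lambda>j. q' j i) v)
         = prod_list (map (\<lambda>j. q j i) v) * (prod_list (map (\<lambda>j. t j i) v) * prod_list (map (t i) v))"
        if "set v \<subseteq> I" for v
        using that
      proof (induction v)
        case (Cons x v)
        then show ?case using tq[of i x] Cons \<open>set (i # u) \<subseteq> I\<close> by (simp add: algebra_simps)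
      qed simp
      have IH: "wform q' u (?A @ ?B) = \<tau> u * \<tau> (?A @ ?B) * wform q u (?A @ ?B)"
        using Cons.IH sub Cons.prems by auto
      \<comment> \<open>Letters behind the inserted \<open>i\<close> contribute \<open>t i j\<close>
        twice and cancel. Letters in front contribute \<open>t j i * t i j\<close>, which is the
        quotient of \<open>q'\<close> and \<open>q\<close>.\<close>
      have "\<tau> (i # u) * \<tau> w * (prod_list (map (\<lambda>j. q j i) ?A) * wform q u (?A @ ?B))
         = (prod_list (map (t i) ?B) * prod_list (map (t i) ?B)) *
           (prod_list (map (\<lambda>j. q j i) ?A) * (prod_list (map (\<lambda>j. t j i) ?A) * prod_list (map (t i) ?A)))
           * (\<tau> u * \<tau> (?A @ ?B) * wform q u (?A @ ?B))"
        unfolding tu tw by (simp add: algebra_simps)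
      also have "\<dots> = prod_list (map (\<lambda>j. q' j i) ?A) * wform q' u (?A @ ?B)"
        unfolding psq using qA[of ?A] sub IH by simp
      finally show ?thesis by simp
    qed
    then show ?case
      unfolding wform.simps del_op_explicit sum_distrib_left by (intro sum.cong) auto
  qed
  show ?thesis using \<tau>sq main by blast
qed

section \<open>The span of the rows of the form\<close>

text \<open>One graded component of the row space: by \<open>wform_mset\<close> a row vanishes on
  words with other letters than its own.\<close>

inductive_set row_span :: "('a \<Rightarrow> 'a \<Rightarrow> complex) \<Rightarrow> 'a multiset \<Rightarrow> ('a list \<Rightarrow> complex) set"
  for q M where
  zero: "(\<lambda>_. 0) \<in> row_span q M"
| add: "\<Phi> \<in> row_span q M \<Longrightarrow> mset u = M \<Longrightarrow> (\<lambda>w. \<Phi> w + c * wform q u w) \<in> row_span q M"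

lemma row_span_row: "mset u = M \<Longrightarrow> wform q u \<in> row_span q M"
  using row_span.add[OF row_span.zero, of u M 1 q] by simp

lemma row_span_scale: "\<Phi> \<in> row_span q M \<Longrightarrow> (\<lambda>w. a * \<Phi> w) \<in> row_span q M"
proof (induction rule: row_span.induct)
  case zero then show ?case using row_span.zero by simp
next
  case (add \<Phi> u c)
  then show ?case using row_span.add[OF add(3) add(2), of "a * c"] by (simp add: algebra_simps)
qed

lemma row_span_add:
  "\<Phi> \<in> row_span q M \<Longrightarrow> \<Psi> \<in> row_span q M \<Longrightarrow> (\<lambda>w. \<Psi> w + \<Phi> w) \<in> row_span q M"
proof (induction rule: row_span.induct)
  case zero then show ?case by simp
next
  case (add \<Phi> u c)
  then show ?case using row_span.add[OF add(3)[OF add(4)] add(2), of c] by (simp add: algebra_simps)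
qed

lemma row_span_combine:
  assumes "\<Phi> \<in> row_span q M" "\<Psi> \<in> row_span q M"
  shows "(\<lambda>w. a * \<Phi> w + b * \<Psi> w) \<in> row_span q M"
  using row_span_add[OF row_span_scale[OF assms(2), of b] row_span_scale[OF assms(1), of a]] .

lemma row_span_del_left:
  "\<Phi> \<in> row_span q M \<Longrightarrow> del_op (\<lambda>j. q j i) i \<Phi> \<in> row_span q (add_mset i M)"
proof (induction rule: row_span.induct)
  case zero
  have "del_op (\<lambda>j. q j i) i (\<lambda>_. 0) = (\<lambda>_. 0)" by (auto simp: del_op_zero)
  then show ?case using row_span.zero by simp
next
  case (add \<Phi> u c)
  have "del_op (\<lambda>j. q j i) i (\<lambda>w. \<Phi> w + c * wform q u w)
     = (\<lambda>w. del_op (\<lambda>j. q j i) i \<Phi> w + c * wform q (i # u) w)"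
    by (auto simp: del_op_add del_op_scale)
  then show ?case using row_span.add[OF add(3), of "i # u" c] add(2) by simp
qed

lemma row_span_del_right:
  assumes q: "\<And>i j. q i j * q i j = 1"
  shows "\<Phi> \<in> row_span q M \<Longrightarrow> del_op (q i) i \<Phi> \<in> row_span q (add_mset i M)"
proof (induction rule: row_span.induct)
  case zero
  have "del_op (q i) i (\<lambda>_. 0) = (\<lambda>_. 0)" by (auto simp: del_op_zero)
  then show ?case using row_span.zero by simp
next
  case (add \<Phi> u c)
  let ?k = "prod_list (map (q i) u)"
  have k: "?k \<noteq> 0" using q by (auto simp: prod_list_zero_iff) (metis mult_zero_left zero_neq_one)
  have "del_op (q i) i (\<lambda>w. \<Phi> w + c * wform q u w)
     = (\<lambda>w. del_op (q i) i \<Phi> w + (c / ?k) * wform q (u @ [i]) w)"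
    using k by (auto simp: del_op_add del_op_scale wform_snoc[OF q])
  then show ?case using row_span.add[OF add(3), of "u @ [i]" "c / ?k"] add(2) by simp
qed

text \<open>Turns a nonzero value of a constructed function into a nonzero entry of the symmetrizer
  in the same degree.\<close>

lemma row_span_nonzero:
  assumes "\<Phi> \<in> row_span q M" "\<Phi> w \<noteq> 0"
  shows "\<exists>u. mset u = M \<and> wform q u w \<noteq> 0"
  using assms
proof (induction rule: row_span.induct)
  case (add \<Phi> u c)
  then show ?case by (cases "wform q u w = 0") auto
qed simp

text \<open>Passing a neighbour of \<open>i\<close> changes the relative sign of the left and the right insertion, so this
  keeps the insertions of \<open>i\<close> behind an even (resp. odd) number of neighbours.\<close>

definition gap_op :: "('a \<Rightarrow> 'a \<Rightarrow> complex) \<Rightarrow> bool \<Rightarrow> 'a \<Rightarrow> ('a list \<Rightarrow> complex) \<Rightarrow> 'a list \<Rightarrow> complex" where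
  "gap_op q even_gap i \<Phi> w = (del_op (q i) i \<Phi> w + (if even_gap then 1 else -1) * del_op (\<lambda>j. q j i) i \<Phi> w) / 2"

lemma gap_op_Nil: "gap_op q e i \<Phi> [] = 0"
  by (simp add: gap_op_def)

text \<open>One recursion for the half sum and the half difference: reading a letter exchanges them
  exactly if it is a neighbour of \<open>i\<close>.\<close>

lemma gap_op_Cons:
  assumes "q j i = (if nb then - q i j else q i j)"
  shows "gap_op q e i \<Phi> (j # w) = (if j = i \<and> e then \<Phi> w else 0)
      + q i j * gap_op q (e = (\<not> nb)) i (\<lambda>v. \<Phi> (j # v)) w"
  using assms by (auto simp: gap_op_def field_simps)

lemma gap_op_zero: "gap_op q e i (\<lambda>_. 0) w = 0"
  by (simp add: gap_op_def del_op_zero)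

lemma row_span_gap:
  assumes q: "\<And>i j. q i j * q i j = 1" and "\<Phi> \<in> row_span q M"
  shows "gap_op q e i \<Phi> \<in> row_span q (add_mset i M)"
  using row_span_combine[OF row_span_del_right[OF assms] row_span_del_left[OF assms(2)],
      where a = "1/2" and b = "(if e then 1 else -1) / 2"]
  by (simp add: gap_op_def[abs_def] add_divide_distrib)

lemma wform_single: "wform q [i] w = (if w = [i] then 1 else 0)"
proof -
  have "wform q [] = (\<lambda>v. if v = [] then 1 else 0)" by auto
  then have "wform q [i] w = del_op (\<lambda>j. q j i) i (\<lambda>v. if v = [] then 1 else 0) w" by simp
  also have "\<dots> = (if w = [i] then 1 else 0)" by (cases w) (auto simp: del_op_zero)
  finally show ?thesis .
qed

lemma gap_op_delta:
  "gap_op q e i (\<lambda>v. if v = [] then 1 else 0) w = (if e \<and> w = [i] then 1 else 0)"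
proof -
  have "del_op a i (\<lambda>v. if v = [] then 1 else 0) w = (if w = [i] then 1 else 0)" for a
    by (cases w) (auto simp: del_op_zero)
  then show ?thesis by (simp add: gap_op_def)
qed

section \<open>The triangle\<close>

text \<open>The gauge in which the signs arise from the eigenvalues -1, 1, -1 in
  \<open>infinite_triangle\<close>, so that the triangle is used without a twist.\<close>

definition tri_q :: "int \<Rightarrow> int \<Rightarrow> complex" where
  "tri_q i j = (if (j - i) mod 3 = 2 then 1 else -1)"

lemma tri_q_sq: "tri_q i j * tri_q i j = 1"
  by (simp add: tri_q_def)

lemma tri_q_sym: "tri_q j i = (if (j - i) mod 3 \<noteq> 0 then - tri_q i j else tri_q i j)"
proof -
  have "(i - j) mod 3 = (- ((j - i) mod 3)) mod 3" by (simp add: mod_minus_eq)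
  moreover have "(j - i) mod 3 \<in> {0, 1, 2}"
    using pos_mod_sign[of 3 "j - i"] pos_mod_bound[of 3 "j - i"] by auto
  ultimately show ?thesis by (auto simp: tri_q_def)
qed

text \<open>\<open>tri_full a\<close> is the indicator function of the word \<open>a, a + 1, \<dots>, 7\<close> (letters modulo 3).
  \<open>tri_hole a\<close> is that of \<open>a, \<dots>, 5\<close> followed by \<open>1\<close>: the letter \<open>0\<close> expected at \<open>6\<close> is missing.\<close>

fun tri_full :: "int \<Rightarrow> int list \<Rightarrow> complex" where
  "tri_full a [] = (if a = 8 then 1 else 0)"
| "tri_full a (j # w) = (if j = a mod 3 then tri_full (a + 1) w else 0)"

fun tri_hole :: "int \<Rightarrow> int list \<Rightarrow> complex" where
  "tri_hole a [] = 0"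
| "tri_hole a (j # w) = (if a = 6 then if j = 1 \<and> w = [] then 1 else 0
     else if j = a mod 3 then tri_hole (a + 1) w else 0)"

lemma tri_gap_Cons:
  "gap_op tri_q e i \<Phi> (j # w) = (if j = i \<and> e then \<Phi> w else 0)
      + tri_q i j * gap_op tri_q (e = ((j - i) mod 3 = 0)) i (\<lambda>v. \<Phi> (j # v)) w"
  using gap_op_Cons[of tri_q j i "(j - i) mod 3 \<noteq> 0" e \<Phi> w] tri_q_sym[of j i] by simp

lemma tri_full_ge: "a \<ge> 8 \<Longrightarrow> tri_full a w = (if a = 8 \<and> w = [] then 1 else 0)"
  by (induction w arbitrary: a) auto

text \<open>An equation of functions, so that it rewrites the argument that
  \<open>tri_gap_Cons\<close> leaves under \<open>gap_op\<close>.\<close>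

lemma tri_full_Cons_fun:
  "(\<lambda>v. tri_full a (j # v)) = (if j = a mod 3 then tri_full (a + 1) else (\<lambda>_. 0))"
  by auto

lemma tri_hole_Cons_fun:
  "(\<lambda>v. tri_hole a (j # v)) = (if a = 6 then if j = 1 then (\<lambda>v. if v = [] then 1 else 0) else (\<lambda>_. 0)
     else if j = a mod 3 then tri_hole (a + 1) else (\<lambda>_. 0))"
  by auto

lemma tri_q_simps [simp]:
  "tri_q 0 0 = -1" "tri_q 0 1 = -1" "tri_q 0 2 = 1" "tri_q 1 0 = 1" "tri_q 1 1 = -1" "tri_q 1 2 = -1"
  "tri_q 2 0 = -1" "tri_q 2 1 = 1" "tri_q 2 2 = -1"
  by (auto simp: tri_q_def)

lemma mod3_cases:
  fixes a :: int
  obtains "a mod 3 = 0" "(a + 1) mod 3 = 1" "(a - 1) mod 3 = 2"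
  | "a mod 3 = 1" "(a + 1) mod 3 = 2" "(a - 1) mod 3 = 0"
  | "a mod 3 = 2" "(a + 1) mod 3 = 0" "(a - 1) mod 3 = 1"
proof -
  have "(a mod 3 = 0 \<and> (a + 1) mod 3 = 1 \<and> (a - 1) mod 3 = 2)
    \<or> (a mod 3 = 1 \<and> (a + 1) mod 3 = 2 \<and> (a - 1) mod 3 = 0)
    \<or> (a mod 3 = 2 \<and> (a + 1) mod 3 = 0 \<and> (a - 1) mod 3 = 1)"
    by presburger
  then show thesis by (elim disjE conjE) (rule that; assumption)+
qed


text \<open>Every letter other than \<open>i\<close> is a neighbour, so along the path the gaps
  alternately contain and lack an \<open>i\<close>. The parity \<open>e\<close> selects those that
  contain one, where insertion before and after it cancels, and the front gap if the path starts at
  \<open>i + 1\<close>. The letter \<open>2\<close> is excluded because the path ends in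
  \<open>1\<close>, where this parity would also accept a \<open>2\<close>.\<close>

lemma tri_gap_full:
  assumes "i \<in> {0, 1}" "e = (a mod 3 \<noteq> (i + 2) mod 3)"
  shows "gap_op tri_q e i (tri_full a) w
    = (if a mod 3 = (i + 1) mod 3 then tri_full (a - 1) w else 0)"
  using assms
proof (induction w arbitrary: a e)
  case Nil
  then show ?case by (auto simp: gap_op_Nil)
next
  case (Cons j w)
  \<comment> \<open>The equations are premises, so that the rule still matches after
    \<open>i\<close> has become a numeral and the parity has been simplified.\<close>
  have IH: "gap_op tri_q e' i' (tri_full (a + 1)) w
    = (if (a + 1) mod 3 = (i' + 1) mod 3 then tri_full a w else 0)"
    if "i' = i" "e' = ((a + 1) mod 3 \<noteq> (i' + 2) mod 3)" for e' i'
    using Cons.IH[of e' "a + 1"] that Cons.prems(1) by simp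
  note [simp] = Cons.prems(2) tri_gap_Cons tri_full_Cons_fun IH gap_op_zero
  consider "i = 0" "j = a mod 3" | "i = 1" "j = a mod 3" | "i = 0" "j \<noteq> a mod 3" | "i = 1" "j \<noteq> a mod 3"
    using Cons.prems by auto
  note cs = this
  show ?case
  proof (cases a rule: mod3_cases)
    case 1
    show ?thesis using cs by cases (simp_all add: 1)
  next
    case 2
    show ?thesis using cs by cases (simp_all add: 2)
  next
    case 3
    show ?thesis using cs by cases (simp_all add: 3)
  qed
qed

text \<open>The missing \<open>0\<close> is a neighbour of \<open>2\<close>, so the gap after the
  last letter changes parity and no letter is accepted at the finish. Instead the hole accepts
  \<open>0\<close>. The sign is the product of \<open>tri_q 0 j\<close> over the letters before the
  hole: a run \<open>0, 1, 2\<close> contributes 1, and only a start at \<open>1\<close> leaves a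
  -1.\<close>

lemma tri_gap_hole:
  assumes "i \<in> {0, 1, 2}" "e = (a mod 3 \<noteq> (i + 2) mod 3)" "a \<le> 6"
  shows "gap_op tri_q e i (tri_hole a) w
    = (if a mod 3 = (i + 1) mod 3 then tri_hole (a - 1) w else 0)
      + (if i = 0 then (if a mod 3 = 1 then -1 else 1) * tri_full a w else 0)"
  using assms
proof (induction w arbitrary: a e)
  case Nil
  then show ?case by (auto simp: gap_op_Nil)
next
  case (Cons j w)
  show ?case
  proof (cases "a = 6")
    case True
    have eq: "gap_op tri_q e i (tri_hole a) (j # w) = (if j = i \<and> e then tri_hole 6 w else 0)
      + (if j = 1 \<and> e = ((1 - i) mod 3 = 0) \<and> w = [i] then tri_q i 1 else 0)"
      unfolding tri_gap_Cons tri_hole_Cons_fun True by (simp add: gap_op_zero gap_op_delta)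
    consider "i = 0" | "i = 1" | "i = 2" using Cons.prems by auto
    then show ?thesis
    proof cases
      case 1
      then have "e = True" using True Cons.prems(2) by simp
      with 1 show ?thesis unfolding eq unfolding True by (cases w) (simp_all add: tri_full_ge)
    next
      case 2
      then have "e = False" using True Cons.prems(2) by simp
      with 2 show ?thesis unfolding eq unfolding True by (cases w) (simp_all add: tri_full_ge)
    next
      case 3
      then have "e = True" using True Cons.prems(2) by simp
      with 3 show ?thesis unfolding eq unfolding True by (cases w) (simp_all add: tri_full_ge)
    qed
  next
    case False
    have IH: "gap_op tri_q e' i' (tri_hole (a + 1)) w
      = (if (a + 1) mod 3 = (i' + 1) mod 3 then tri_hole a w else 0)
        + (if i' = 0 then (if (a + 1) mod 3 = 1 then -1 else 1) * tri_full (a + 1) w else 0)"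
      if "i' = i" "e' = ((a + 1) mod 3 \<noteq> (i' + 2) mod 3)" for e' i'
      using Cons.IH[of e' "a + 1"] that Cons.prems False by simp
    note [simp] = False Cons.prems(2) tri_gap_Cons tri_hole_Cons_fun IH gap_op_zero
    consider "i = 0" "j = a mod 3" | "i = 1" "j = a mod 3" | "i = 2" "j = a mod 3"
      | "i = 0" "j \<noteq> a mod 3" | "i = 1" "j \<noteq> a mod 3" | "i = 2" "j \<noteq> a mod 3"
      using Cons.prems by auto
    note cs = this
    have 7: "a \<noteq> 7" using Cons.prems by simp
    show ?thesis
    proof (cases a rule: mod3_cases)
      case 1
      show ?thesis using cs by cases (simp_all add: 1 7)
    next
      case 2
      show ?thesis using cs by cases (simp_all add: 2 7)
    next
      case 3
      show ?thesis using cs by cases (simp_all add: 3 7)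
    qed
  qed
qed

text \<open>One turn backwards puts \<open>1\<close>, \<open>0\<close>, \<open>2\<close> in front of
  a path starting at \<open>2\<close>. Only the \<open>0\<close> in front of a \<open>1\<close> also
  fills the hole. The full path to be removed is available: in front of a \<open>2\<close> the
  letter \<open>0\<close> can do nothing but fill the hole, and \<open>1\<close> extends the
  resulting full path.\<close>

lemma tri_hole_span:
  "\<exists>M. set_mset M \<subseteq> {0, 1, 2} \<and> tri_hole (5 - 3 * int k) \<in> row_span tri_q M"
proof (induction k)
  case 0
  have "tri_hole 6 w = wform tri_q [1] w" for w
    by (cases w) (auto simp: wform_single simp del: wform.simps)
  then have "tri_hole 6 = wform tri_q [1]" by auto
  then have "tri_hole 6 \<in> row_span tri_q {#1#}"
    using row_span_row[where u = "[1]" and q = tri_q] by simp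
  then have "gap_op tri_q True 2 (tri_hole 6) \<in> row_span tri_q {#2, 1#}"
    using row_span_gap[where q = tri_q, OF tri_q_sq] by blast
  moreover have "gap_op tri_q True 2 (tri_hole 6) = tri_hole 5"
    by (rule ext, subst tri_gap_hole) simp_all
  ultimately show ?case by (intro exI[of _ "{#2, 1#}"]) simp
next
  case (Suc k)
  define a where "a = 5 - 3 * int k"
  have m: "a mod 3 = 2" "(a - 1) mod 3 = 1" "(a - 2) mod 3 = 0"
    unfolding a_def by presburger+
  have le: "a \<le> 6" "a - 1 \<le> 6" "a - 2 \<le> 6" by (simp_all add: a_def)
  obtain M where M: "set_mset M \<subseteq> {0, 1, 2}" "tri_hole a \<in> row_span tri_q M"
    using Suc a_def by auto
  note g = row_span_gap[where q = tri_q, OF tri_q_sq]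
  have "gap_op tri_q False 0 (tri_hole a) = tri_full a"
    by (rule ext, subst tri_gap_hole) (simp_all add: m le)
  then have F: "tri_full a \<in> row_span tri_q (add_mset 0 M)"
    using g[OF M(2)] by metis
  have "gap_op tri_q True 1 (tri_full a) = tri_full (a - 1)"
    by (rule ext, subst tri_gap_full) (simp_all add: m)
  then have F1: "tri_full (a - 1) \<in> row_span tri_q (add_mset 1 (add_mset 0 M))"
    using g[OF F] by metis
  have "gap_op tri_q True 1 (tri_hole a) = tri_hole (a - 1)"
    by (rule ext, subst tri_gap_hole) (simp_all add: m le)
  then have Z1: "tri_hole (a - 1) \<in> row_span tri_q (add_mset 1 M)"
    using g[OF M(2)] by metis
  have "tri_hole (a - 2) = (\<lambda>w. 1 * gap_op tri_q True 0 (tri_hole (a - 1)) w + 1 * tri_full (a - 1) w)"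
    by (rule ext, subst tri_gap_hole) (simp_all add: m le)
  also have "\<dots> \<in> row_span tri_q (add_mset 0 (add_mset 1 M))"
    by (rule row_span_combine[OF g[OF Z1]]) (use F1 in \<open>simp add: add_mset_commute\<close>)
  finally have Z2: "tri_hole (a - 2) \<in> row_span tri_q (add_mset 0 (add_mset 1 M))" .
  have "gap_op tri_q True 2 (tri_hole (a - 2)) = tri_hole (a - 3)"
    by (rule ext, subst tri_gap_hole) (simp_all add: m le)
  then have Z3: "tri_hole (a - 3) \<in> row_span tri_q (add_mset 2 (add_mset 0 (add_mset 1 M)))"
    using g[OF Z2] by metis
  have "5 - 3 * int (Suc k) = a - 3" by (simp add: a_def)
  show ?case
    unfolding \<open>5 - 3 * int (Suc k) = a - 3\<close>
    using Z3 M(1) by (intro exI[of _ "add_mset 2 (add_mset 0 (add_mset 1 M))"]) simp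
qed

lemma tri_hole_word: "\<exists>w. tri_hole (5 - 3 * int k) w = 1 \<and> length w = 3 * k + 2"
proof (induction k)
  case 0
  show ?case by (intro exI[of _ "[2, 1]"]) simp
next
  case (Suc k)
  define a where "a = 2 - 3 * int k"
  have m: "a mod 3 = 2" "(a + 1) mod 3 = 0" "(a + 2) mod 3 = 1" unfolding a_def by presburger+
  have le: "a \<noteq> 6" "a + 1 \<noteq> 6" "a + 2 \<noteq> 6" by (simp_all add: a_def)
  have "5 - 3 * int k = a + 3" by (simp add: a_def)
  then obtain w where "tri_hole (a + 3) w = 1" "length w = 3 * k + 2" using Suc by metis
  moreover have "tri_hole a (2 # v) = tri_hole (a + 1) v" for v
    using m(1) le(1) by simp
  moreover have "tri_hole (a + 1) (0 # v) = tri_hole (a + 2) v" for v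
    using m(2) le(2) by (simp add: add.commute[of 2 a] add.commute[of 3 a])
  moreover have "tri_hole (a + 2) (1 # v) = tri_hole (a + 3) v" for v
    using m(3) le(3) by (simp add: add.commute[of 2 a] add.commute[of 3 a])
  ultimately have "tri_hole a (2 # 0 # 1 # w) = 1 \<and> length (2 # 0 # 1 # w) = 3 * Suc k + 2"
    by (simp del: tri_hole.simps)
  moreover have "5 - 3 * int (Suc k) = a" by (simp add: a_def)
  ultimately show ?case by (metis (no_types))
qed

lemma tri_wform_nonzero:
  "\<exists>u w. set u \<subseteq> {0, 1, 2} \<and> set w \<subseteq> {0, 1, 2} \<and> length u = 3 * k + 2 \<and> wform tri_q u w \<noteq> 0"
proof -
  obtain M where M: "set_mset M \<subseteq> {0, 1, 2}" "tri_hole (5 - 3 * int k) \<in> row_span tri_q M"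
    using tri_hole_span by blast
  obtain w where w: "tri_hole (5 - 3 * int k) w = 1" "length w = 3 * k + 2"
    using tri_hole_word by blast
  obtain u where u: "mset u = M" "wform tri_q u w \<noteq> 0"
    using row_span_nonzero[OF M(2), of w] w by auto
  have "mset w = M" using wform_mset[OF u(2)] u(1) by simp
  then have "set w = set u" "length w = length u"
    using u(1) by (auto dest: mset_eq_setD mset_eq_length)
  moreover have "set u \<subseteq> {0, 1, 2}" using M(1) u(1) by auto
  ultimately show ?thesis using u(2) w(2)
    by (intro exI[of _ u] exI[of _ w] conjI) (simp_all del: insert_subset)
qed

section \<open>The hexagon\<close>

text \<open>Residues are wrapped in a constant because the arithmetic solver of the simplifier splits
  every visible \<open>mod\<close>, which blows up in the case distinctions below.\<close>

definition res6 :: "int \<Rightarrow> int" where "res6 a = a mod 6"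

lemma res6_simps [simp]:
  "res6 (- 1) = 5" "res6 0 = 0" "res6 1 = 1" "res6 2 = 2" "res6 3 = 3" "res6 4 = 4" "res6 5 = 5" "res6 6 = 0" "res6 7 = 1" "res6 8 = 2" "res6 9 = 3" "res6 10 = 4" "res6 11 = 5"
  by (simp_all add: res6_def)

lemma res6_rules:
  assumes "res6 a = r"
  shows "res6 (a + k) = res6 (r + k)" "res6 (a + 1 + k) = res6 (r + 1 + k)"
    "res6 (a - 1) = res6 (r - 1)" "res6 (a - 1 + k) = res6 (r - 1 + k)"
    "res6 (k + a) = res6 (k + r)"
proof -
  have "r' - 1 + k = r' + (k - 1)" for r' by simp
  then show "res6 (a + k) = res6 (r + k)" "res6 (a + 1 + k) = res6 (r + 1 + k)"
    "res6 (a - 1) = res6 (r - 1)" "res6 (a - 1 + k) = res6 (r - 1 + k)"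
    unfolding assms[symmetric] res6_def
    by (simp_all only: add.assoc mod_add_left_eq mod_diff_left_eq)
  show "res6 (k + a) = res6 (k + r)"
    unfolding assms[symmetric] res6_def by (simp only: mod_add_right_eq)
qed

lemma res6_cases: "res6 a = 0 \<or> res6 a = 1 \<or> res6 a = 2 \<or> res6 a = 3 \<or> res6 a = 4 \<or> res6 a = 5"
  using pos_mod_sign[of 6 a] pos_mod_bound[of 6 a] unfolding res6_def by linarith

text \<open>A gauge that only depends on the cyclic distance; the braiding that occurs below is reached
  by \<open>wform_twist\<close>.\<close>

definition hex_q :: "int \<Rightarrow> int \<Rightarrow> complex" where
  "hex_q i j = (if (j - i) mod 6 \<in> {0, 1} then -1 else 1)"

definition hex_adj :: "int \<Rightarrow> int \<Rightarrow> bool" where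
  "hex_adj i j \<longleftrightarrow> (j - i) mod 6 \<in> {1, 5}"

lemma hex_q_simps [simp]:
  "hex_q 0 0 = -1"
  "hex_q 0 1 = -1"
  "hex_q 0 2 = 1"
  "hex_q 0 3 = 1"
  "hex_q 0 4 = 1"
  "hex_q 0 5 = 1"
  "hex_q 1 0 = 1"
  "hex_q 1 1 = -1"
  "hex_q 1 2 = -1"
  "hex_q 1 3 = 1"
  "hex_q 1 4 = 1"
  "hex_q 1 5 = 1"
  "hex_q 2 0 = 1"
  "hex_q 2 1 = 1"
  "hex_q 2 2 = -1"
  "hex_q 2 3 = -1"
  "hex_q 2 4 = 1"
  "hex_q 2 5 = 1"
  "hex_q 3 0 = 1"
  "hex_q 3 1 = 1"
  "hex_q 3 2 = 1"
  "hex_q 3 3 = -1"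
  "hex_q 3 4 = -1"
  "hex_q 3 5 = 1"
  "hex_q 4 0 = 1"
  "hex_q 4 1 = 1"
  "hex_q 4 2 = 1"
  "hex_q 4 3 = 1"
  "hex_q 4 4 = -1"
  "hex_q 4 5 = -1"
  "hex_q 5 0 = -1"
  "hex_q 5 1 = 1"
  "hex_q 5 2 = 1"
  "hex_q 5 3 = 1"
  "hex_q 5 4 = 1"
  "hex_q 5 5 = -1"
  by (simp_all add: hex_q_def)

lemma hex_adj_simps [simp]:
  "\<not> hex_adj 0 0"
  "hex_adj 0 1"
  "\<not> hex_adj 0 2"
  "\<not> hex_adj 0 3"
  "\<not> hex_adj 0 4"
  "hex_adj 0 5"
  "hex_adj 1 0"
  "\<not> hex_adj 1 1"
  "hex_adj 1 2"
  "\<not> hex_adj 1 3"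
  "\<not> hex_adj 1 4"
  "\<not> hex_adj 1 5"
  "\<not> hex_adj 2 0"
  "hex_adj 2 1"
  "\<not> hex_adj 2 2"
  "hex_adj 2 3"
  "\<not> hex_adj 2 4"
  "\<not> hex_adj 2 5"
  "\<not> hex_adj 3 0"
  "\<not> hex_adj 3 1"
  "hex_adj 3 2"
  "\<not> hex_adj 3 3"
  "hex_adj 3 4"
  "\<not> hex_adj 3 5"
  "\<not> hex_adj 4 0"
  "\<not> hex_adj 4 1"
  "\<not> hex_adj 4 2"
  "hex_adj 4 3"
  "\<not> hex_adj 4 4"
  "hex_adj 4 5"
  "hex_adj 5 0"
  "\<not> hex_adj 5 1"
  "\<not> hex_adj 5 2"
  "\<not> hex_adj 5 3"
  "hex_adj 5 4"
  "\<not> hex_adj 5 5"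
  by (simp_all add: hex_adj_def)

lemma hex_q_sq: "hex_q i j * hex_q i j = 1"
  by (simp add: hex_q_def)

lemma hex_q_sym: "hex_q j i = (if hex_adj i j then - hex_q i j else hex_q i j)"
proof -
  define x y where "x = (j - i) mod 6" and "y = (i - j) mod 6"
  have y: "y = (- x) mod 6" unfolding x_def y_def by (simp only: mod_minus_eq minus_diff_eq)
  have "x = 0 \<or> x = 1 \<or> x = 2 \<or> x = 3 \<or> x = 4 \<or> x = 5"
    using res6_cases[of "j - i"] unfolding res6_def x_def .
  then have "(x = 0 \<and> y = 0) \<or> (x = 1 \<and> y = 5) \<or> (x = 2 \<and> y = 4) \<or> (x = 3 \<and> y = 3)
      \<or> (x = 4 \<and> y = 2) \<or> (x = 5 \<and> y = 1)"
    unfolding y by (elim disjE) simp_all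
  then show ?thesis
    unfolding hex_q_def hex_adj_def x_def[symmetric] y_def[symmetric] by (elim disjE) simp_all
qed

lemma hex_gap_Cons:
  "gap_op hex_q e i \<Phi> (j # w) = (if j = i \<and> e then \<Phi> w else 0)
      + hex_q i j * gap_op hex_q (e = (\<not> hex_adj i j)) i (\<lambda>v. \<Phi> (j # v)) w"
  using gap_op_Cons[of hex_q j i "hex_adj i j" e \<Phi> w] hex_q_sym[of j i] by simp

text \<open>Two particles sit at the integers \<open>a\<close> and \<open>a + d\<close>, \<open>1 \<le> d \<le> 5\<close>, taken modulo 6; the letter \<open>i\<close>
  moves the particle at \<open>i\<close> to \<open>i + 1\<close> if that place is free. \<open>hex_full\<close> accepts the words that move the particles
  to \<open>7\<close> and \<open>8\<close>. In \<open>hex_hole\<close> both end up at \<open>7\<close>: the last letter \<open>1\<close>, which would have made room for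
  the final move \<open>0\<close>, is left out.\<close>

fun hex_full :: "int \<Rightarrow> int \<Rightarrow> int list \<Rightarrow> complex" where
  "hex_full a d [] = (if a = 7 \<and> d = 1 then 1 else 0)"
| "hex_full a d (j # w) = (if j = res6 a \<and> d \<noteq> 1 then hex_full (a + 1) (d - 1) w
     else if j = res6 (a + d) \<and> d \<noteq> 5 then hex_full a (d + 1) w else 0)"

fun hex_hole :: "int \<Rightarrow> int \<Rightarrow> int list \<Rightarrow> complex" where
  "hex_hole a d [] = 0"
| "hex_hole a d (j # w) = (if a = 6 \<and> d = 1 \<and> j = 0 then if w = [] then 1 else 0
     else if j = res6 a \<and> d \<noteq> 1 then hex_hole (a + 1) (d - 1) w
     else if j = res6 (a + d) \<and> d \<noteq> 5 then hex_hole a (d + 1) w else 0)"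

lemma if_apply: "(if P then f else g) v = (if P then f v else g v)"
  by simp

lemma hex_full_Cons_fun:
  "(\<lambda>v. hex_full a d (j # v)) = (if j = res6 a \<and> d \<noteq> 1 then hex_full (a + 1) (d - 1)
     else if j = res6 (a + d) \<and> d \<noteq> 5 then hex_full a (d + 1) else (\<lambda>_. 0))"
  by (rule ext) (simp only: hex_full.simps if_apply)

lemma hex_hole_Cons_fun:
  "(\<lambda>v. hex_hole a d (j # v)) = (if a = 6 \<and> d = 1 \<and> j = 0 then (\<lambda>v. if v = [] then 1 else 0)
     else if j = res6 a \<and> d \<noteq> 1 then hex_hole (a + 1) (d - 1)
     else if j = res6 (a + d) \<and> d \<noteq> 5 then hex_hole a (d + 1) else (\<lambda>_. 0))"
  by (rule ext) (simp only: hex_hole.simps if_apply)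

text \<open>Along a path, gaps of \<open>i\<close> with and without an \<open>i\<close> alternate. In an aligned state the gap that is
  currently open is one of those that contain an \<open>i\<close>.\<close>

definition aligned :: "int \<Rightarrow> int \<Rightarrow> int \<Rightarrow> bool" where
  "aligned i a d \<longleftrightarrow> (res6 a = i \<or> res6 a = res6 (i + 1)) \<noteq> (res6 (a + d) = i \<or> res6 (a + d) = res6 (i + 1))"

text \<open>Undoes the letter \<open>i\<close>: the particle at \<open>i + 1\<close> returns to
  \<open>i\<close>. The bounds on \<open>d\<close> say that \<open>i\<close> is free.\<close>

definition step_back :: "(int \<Rightarrow> int \<Rightarrow> int list \<Rightarrow> complex) \<Rightarrow> int \<Rightarrow> int \<Rightarrow> int \<Rightarrow> int list \<Rightarrow> complex" where
  "step_back g i a d w = (if res6 a = res6 (i + 1) \<and> d \<noteq> 5 then g (a - 1) (d + 1) w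
     else if res6 (a + d) = res6 (i + 1) \<and> d \<noteq> 1 then g a (d - 1) w else 0)"

text \<open>A neighbour of \<open>i\<close> brings a particle into the pair of places
  \<open>i, i + 1\<close> or takes one out, so the parity of their number changes with the same
  letters as the parity in \<open>gap_op\<close>. While exactly one particle is in the pair, it has
  to make the move \<open>i\<close> before the gap closes, unless it starts at \<open>i + 1\<close>.
  Insertions on both sides of that move cancel; letters in between that are not neighbours have
  \<open>hex_q = 1\<close>, which is why an indicator without signs works. The letter
  \<open>2\<close> is excluded because the particle at \<open>8\<close> could move on.\<close>

lemma hex_gap_full:
  assumes "i \<in> {0, 1, 3, 4, 5}" "d \<in> {1, 2, 3, 4, 5}" "e = aligned i a d"
  shows "gap_op hex_q e i (hex_full a d) w = step_back hex_full i a d w"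
  using assms
proof (induction w arbitrary: a d e)
  case Nil
  then have d: "d \<noteq> 0" and i: "i \<in> {0, 1, 3, 4, 5}" by auto
  show ?case
  proof (cases "a = 7 \<and> d = 2")
    case True
    with i show ?thesis
      by (elim insertE emptyE) (simp_all add: gap_op_Nil step_back_def)
  next
    case False
    with d show ?thesis by (auto simp: gap_op_Nil step_back_def)
  qed
next
  case (Cons j w)
  define r where "r = res6 a"
  have r: "res6 a = r" by (simp add: r_def)
  have rc: "r = 0 \<or> r = 1 \<or> r = 2 \<or> r = 3 \<or> r = 4 \<or> r = 5" unfolding r_def by (rule res6_cases)
  have dc: "d = 1 \<or> d = 2 \<or> d = 3 \<or> d = 4 \<or> d = 5" using Cons.prems(2) by simp
  have ic: "i = 0 \<or> i = 1 \<or> i = 3 \<or> i = 4 \<or> i = 5" using Cons.prems(1) by simp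
  have jc: "j = r \<or> j = res6 (r + d) \<or> (j \<noteq> r \<and> j \<noteq> res6 (r + d))" by blast
  have IH: "gap_op hex_q e' i' (hex_full a' d') w = step_back hex_full i' a' d' w"
    if "i' = i" "d' \<in> {1, 2, 3, 4, 5}" "e' = aligned i' a' d'" for i' e' a' d'
    using Cons.IH[OF Cons.prems(1) that(2) that(3)[unfolded that(1)]] unfolding that(1) .
  note [simp] = Cons.prems(3) hex_gap_Cons hex_full_Cons_fun IH gap_op_zero aligned_def step_back_def
     res6_rules[OF r] r
  show ?case
    using rc dc ic jc by (elim disjE) simp_all
qed

lemma hex_hole_beyond: "a + d > 7 \<Longrightarrow> hex_hole a d w = 0"
  by (induction w arbitrary: a d) auto

lemma hex_full_beyond: "a + d > 8 \<Longrightarrow> hex_full a d w = 0"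
  by (induction w arbitrary: a d) auto

lemma hex_full_last: "hex_full 7 1 w = (if w = [] then 1 else 0)"
  by (cases w) (auto simp: hex_full_beyond)

text \<open>With the leading particle at its goal, \<open>7\<close> for \<open>hex_hole\<close> and
  \<open>8\<close> for \<open>hex_full\<close>, only the other one moves, by the same letters in
  both cases. Hence the inserted letter \<open>1\<close> leads from the hole function to the full
  one.\<close>

lemma hex_hole_eq_full:
  assumes "d \<in> {1, 2, 3, 4}"
  shows "hex_hole (7 - d) d w = hex_full (7 - d) (d + 1) w"
  using assms
proof (induction w arbitrary: d)
  case (Cons j w)
  have IH: "hex_hole 6 1 w = hex_full 6 2 w" "hex_hole 5 2 w = hex_full 5 3 w"
    "hex_hole 4 3 w = hex_full 4 4 w"
    using Cons.IH[of 1] Cons.IH[of 2] Cons.IH[of 3] by simp_all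
  show ?case
    using Cons.prems
    by (elim insertE emptyE) (simp_all add: IH hex_hole_beyond hex_full_beyond hex_full_last)
qed auto

text \<open>The state before the final \<open>0\<close>, the only place where
  \<open>hex_hole\<close> breaks the rule that the target must be free.\<close>

lemma hex_gap_hole_end:
  assumes "i \<in> {0, 1, 2, 3, 4, 5}" "e = aligned i 6 1"
  shows "gap_op hex_q e i (hex_hole 6 1) w = step_back hex_hole i 6 1 w + (if i = 1 then hex_full 6 1 w else 0)"
proof (cases w)
  case Nil
  then show ?thesis using assms by (auto simp: gap_op_Nil step_back_def)
next
  case (Cons j v)
  have z: "hex_hole 6 2 = (\<lambda>_. 0)" using hex_hole_beyond[of 6 2] by auto
  have eq: "gap_op hex_q e i (hex_hole 6 1) (j # v) = (if j = i \<and> e then hex_hole 6 1 v else 0)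
      + (if j = 0 \<and> e = (\<not> hex_adj i 0) \<and> v = [i] then hex_q i 0 else 0)"
    unfolding hex_gap_Cons hex_hole_Cons_fun by (simp add: gap_op_zero gap_op_delta z)
  show ?thesis unfolding Cons unfolding eq unfolding assms(2)
    using assms(1) by (elim insertE emptyE; cases v)
      (simp_all add: aligned_def step_back_def hex_hole_beyond hex_full_beyond hex_full_last)
qed

text \<open>The sign with which the letter \<open>1\<close> reaches the hole, moving in from the front.\<close>

definition hole_sign :: "int \<Rightarrow> int \<Rightarrow> complex" where
  "hole_sign a d = (if res6 a = 2 then -1 else 1) * (if res6 (a + d) = 2 then -1 else 1)"

text \<open>Both particles finish at \<open>7\<close>, so at the finish every pair
  \<open>i, i + 1\<close> holds none or two of them and no letter is accepted there, not even
  \<open>2\<close>. The remaining gap is the hole, where the leading particle waits at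
  \<open>7\<close> for its move \<open>1\<close>. Among the letters, \<open>hex_q 1 j = -1\<close>
  for \<open>j = 1, 2\<close> only; a particle on its way to \<open>7\<close> makes these two moves
  equally often unless it starts at residue 2, whence \<open>hole_sign\<close>.\<close>

lemma hex_gap_hole:
  assumes "i \<in> {0, 1, 2, 3, 4, 5}" "d \<in> {1, 2, 3, 4, 5}" "a + d \<le> 7" "e = aligned i a d"
  shows "gap_op hex_q e i (hex_hole a d) w
    = step_back hex_hole i a d w + (if i = 1 then hole_sign a d * hex_full a d w else 0)"
  using assms
proof (induction w arbitrary: a d e)
  case Nil
  then show ?case
    by (auto simp: gap_op_Nil step_back_def)
next
  case (Cons j w)
  define r where "r = res6 a"
  have r: "res6 a = r" by (simp add: r_def)
  have rc: "r = 0 \<or> r = 1 \<or> r = 2 \<or> r = 3 \<or> r = 4 \<or> r = 5" unfolding r_def by (rule res6_cases)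
  have dc: "d = 1 \<or> d = 2 \<or> d = 3 \<or> d = 4 \<or> d = 5" using Cons.prems(2) by simp
  have ic: "i = 0 \<or> i = 1 \<or> i = 2 \<or> i = 3 \<or> i = 4 \<or> i = 5" using Cons.prems(1) by simp
  have jc: "j = r \<or> j = res6 (r + d) \<or> (j \<noteq> r \<and> j \<noteq> res6 (r + d))" by blast
  have IH: "gap_op hex_q e' i' (hex_hole a' d') w
      = step_back hex_hole i' a' d' w + (if i' = 1 then hole_sign a' d' * hex_full a' d' w else 0)"
    if "i' = i" "d' \<in> {1, 2, 3, 4, 5}" "a' + d' \<le> 7" "e' = aligned i' a' d'" for i' e' a' d'
    using Cons.IH[OF Cons.prems(1) that(2,3) that(4)[unfolded that(1)]] unfolding that(1) .
  note rules = Cons.prems(4) hex_gap_Cons hex_hole_Cons_fun IH gap_op_zero aligned_def step_back_def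
     hole_sign_def
  consider "a = 6" "d = 1" | "a + d = 7" "d \<noteq> 1" | "a + d < 7" using Cons.prems(3) by linarith
  then show ?case
  proof cases
    case 1
    then show ?thesis
      using hex_gap_hole_end[of i e "j # w"] Cons.prems(1,4) by (simp add: hole_sign_def)
  next
    case 2
    have z: "hex_hole a (d + 1) = (\<lambda>_. 0)" using 2 by (intro ext hex_hole_beyond) simp
    have eqs: "hex_hole 6 1 w = hex_full 6 2 w" "hex_hole 5 2 w = hex_full 5 3 w"
      "hex_hole 4 3 w = hex_full 4 4 w" "hex_hole 3 4 w = hex_full 3 5 w"
      using hex_hole_eq_full[of 1 w] hex_hole_eq_full[of 2 w] hex_hole_eq_full[of 3 w]
        hex_hole_eq_full[of 4 w] by simp_all
    have "(d = 2 \<and> a = 5) \<or> (d = 3 \<and> a = 4) \<or> (d = 4 \<and> a = 3) \<or> (d = 5 \<and> a = 2)"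
      using 2 dc by auto
    moreover have "j = res6 a \<or> j = 1 \<or> (j \<noteq> res6 a \<and> j \<noteq> 1)" by blast
    ultimately show ?thesis
      using ic z by (elim disjE conjE) (simp_all add: rules eqs hex_hole_beyond)
  next
    \<comment> \<open>Away from the finish only the residue of \<open>a\<close> matters, which
      leaves finitely many cases.\<close>
    case 3
    then have n: "\<not> (a = 6 \<and> d = 1)" "a + d < 7" by auto
    show ?thesis
      using rc dc ic jc n
      by (elim disjE) (simp_all add: rules res6_rules[OF r] r)
  qed
qed

lemma hole_back:
  assumes "hex_hole a d \<in> row_span hex_q M" "i \<in> {0, 2, 3, 4, 5}" "d \<in> {1, 2, 3, 4, 5}" "a + d \<le> 7"
    "\<And>w. step_back hex_hole i a d w = g w"
  shows "g \<in> row_span hex_q (add_mset i M)"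
proof -
  have "gap_op hex_q (aligned i a d) i (hex_hole a d) = g"
    using hex_gap_hole[of i d a "aligned i a d"] assms(2-5) by auto
  then show ?thesis using row_span_gap[OF hex_q_sq assms(1)] by metis
qed

lemma full_back:
  assumes "hex_full a d \<in> row_span hex_q M" "i \<in> {0, 1, 3, 4, 5}" "d \<in> {1, 2, 3, 4, 5}"
    "\<And>w. step_back hex_full i a d w = g w"
  shows "g \<in> row_span hex_q (add_mset i M)"
proof -
  have "gap_op hex_q (aligned i a d) i (hex_full a d) = g"
    using hex_gap_full[of i d "aligned i a d" a] assms(2-4) by auto
  then show ?thesis using row_span_gap[OF hex_q_sq assms(1)] by metis
qed

lemma hole_sign_sq: "hole_sign a d * hole_sign a d = 1"
  by (simp add: hole_sign_def)

text \<open>For states in which no particle can return from \<open>2\<close> to \<open>1\<close>: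
  there the letter \<open>1\<close> only fills the hole.\<close>

lemma hole_fill:
  assumes "hex_hole a d \<in> row_span hex_q M" "d \<in> {1, 2, 3, 4, 5}" "a + d \<le> 7"
    "\<And>w. step_back hex_hole 1 a d w = 0"
  shows "hex_full a d \<in> row_span hex_q (add_mset 1 M)"
proof -
  have "gap_op hex_q (aligned 1 a d) 1 (hex_hole a d) = (\<lambda>w. hole_sign a d * hex_full a d w)"
    using hex_gap_hole[of 1 d a "aligned 1 a d"] assms(2-4) by auto
  then have "(\<lambda>w. hole_sign a d * hex_full a d w) \<in> row_span hex_q (add_mset 1 M)"
    using row_span_gap[OF hex_q_sq assms(1), of "aligned 1 a d" 1] by simp
  from row_span_scale[OF this, of "hole_sign a d"]
  show ?thesis by (simp add: mult.assoc[symmetric] hole_sign_sq)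
qed

text \<open>Here \<open>1\<close> both steps back and fills the hole; the second contribution is
  subtracted.\<close>

lemma hole_back_fill:
  assumes "hex_hole a d \<in> row_span hex_q M" "d \<in> {1, 2, 3, 4, 5}" "a + d \<le> 7"
    "hex_full a d \<in> row_span hex_q (add_mset 1 M)" "\<And>w. step_back hex_hole 1 a d w = g w"
  shows "g \<in> row_span hex_q (add_mset 1 M)"
proof -
  have "g = (\<lambda>w. 1 * gap_op hex_q (aligned 1 a d) 1 (hex_hole a d) w + (- hole_sign a d) * hex_full a d w)"
    using hex_gap_hole[of 1 d a "aligned 1 a d"] assms(2,3,5) by auto
  also have "\<dots> \<in> row_span hex_q (add_mset 1 M)"
    by (rule row_span_combine[OF row_span_gap[OF hex_q_sq assms(1)] assms(4)])
  finally show ?thesis .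
qed

section \<open>One turn of both particles backwards around the hexagon\<close>

lemma res6_diff:
  assumes "res6 a = r"
  shows "res6 (a - k) = res6 (r - k)" "res6 (a - k + l) = res6 (r - k + l)" "res6 (a + l) = res6 (r + l)"
    "res6 (l + a) = res6 (l + r)"
proof -
  have "x - k + l = x + (l - k)" for x by simp
  then show "res6 (a - k) = res6 (r - k)" "res6 (a - k + l) = res6 (r - k + l)" "res6 (a + l) = res6 (r + l)"
    "res6 (l + a) = res6 (l + r)"
    unfolding assms[symmetric] res6_def by (simp_all only: mod_add_left_eq mod_add_right_eq mod_diff_left_eq)
qed

lemma res6_neg [simp]: "res6 12 = 0" "res6 (-2) = 4" "res6 (-3) = 3" "res6 (-4) = 2"
  by (simp_all add: res6_def)

text \<open>Only the letter \<open>1\<close> needs care, when a particle returns from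
  \<open>2\<close> to \<open>1\<close>; this happens once for each. Before each return the particles
  stand at \<open>1\<close> and \<open>2\<close>, so the move is blocked and
  \<open>hole_fill\<close> gives a full path. The letter \<open>0\<close> takes both functions to
  the state where the return is possible, and \<open>hole_back_fill\<close> applies.\<close>

lemma hex_hole_period:
  assumes "hex_hole a 5 \<in> row_span hex_q M" "res6 a = 2" "a \<le> 2"
  shows "\<exists>N. set_mset N \<subseteq> {0, 1, 2, 3, 4, 5} \<and> hex_hole (a - 6) 5 \<in> row_span hex_q (N + M)"
proof -
  note sb = step_back_def res6_diff[OF assms(2)] assms(2)
  have F1: "hex_full a 5 \<in> row_span hex_q (add_mset 1 M)"
    by (rule hole_fill[OF assms(1)]) (use assms(3) in \<open>simp_all add: sb\<close>)
  have F2: "hex_full a 4 \<in> row_span hex_q (add_mset 1 (add_mset 0 M))"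
    unfolding add_mset_commute[of 1 0]
    by (rule full_back[OF F1]) (use assms(3) in \<open>simp_all add: sb\<close>)
  have "hex_hole a 4 \<in> row_span hex_q (add_mset 0 M)"
    by (rule hole_back[OF assms(1)]) (use assms(3) in \<open>simp_all add: sb\<close>)
  from this have "hex_hole (a - 1) 5 \<in> row_span hex_q (add_mset 1 (add_mset 0 M))"
    by (rule hole_back_fill[OF _ _ _ F2]) (use assms(3) in \<open>simp_all add: sb\<close>)
  from this have "hex_hole (a - 1) 4 \<in> row_span hex_q (add_mset 5 (add_mset 1 (add_mset 0 M)))"
    by (rule hole_back) (use assms(3) in \<open>simp_all add: sb\<close>)
  from this have "hex_hole (a - 1) 3 \<in> row_span hex_q (add_mset 4 (add_mset 5 (add_mset 1 (add_mset 0 M))))"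
    by (rule hole_back) (use assms(3) in \<open>simp_all add: sb\<close>)
  from this have "hex_hole (a - 1) 2 \<in> row_span hex_q (add_mset 3 (add_mset 4 (add_mset 5 (add_mset 1 (add_mset 0 M)))))"
    by (rule hole_back) (use assms(3) in \<open>simp_all add: sb\<close>)
  from this have "hex_hole (a - 1) 1 \<in> row_span hex_q (add_mset 2 (add_mset 3 (add_mset 4 (add_mset 5 (add_mset 1 (add_mset 0 M))))))"
    by (rule hole_back) (use assms(3) in \<open>simp_all add: sb\<close>)
  then have Z: "hex_hole (a - 1) 1 \<in> row_span hex_q ({#0, 1, 2, 3, 4, 5#} + M)" (is "_ \<in> row_span _ ?K")
    by (simp add: add_mset_commute)
  have G1: "hex_full (a - 1) 1 \<in> row_span hex_q (add_mset 1 ?K)"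
    by (rule hole_fill[OF Z]) (use assms(3) in \<open>simp_all add: sb\<close>)
  have G2: "hex_full (a - 2) 2 \<in> row_span hex_q (add_mset 1 (add_mset 0 ?K))"
    unfolding add_mset_commute[of 1 0]
    by (rule full_back[OF G1]) (use assms(3) in \<open>simp_all add: sb\<close>)
  have "hex_hole (a - 2) 2 \<in> row_span hex_q (add_mset 0 ?K)"
    by (rule hole_back[OF Z]) (use assms(3) in \<open>simp_all add: sb\<close>)
  from this have "hex_hole (a - 2) 1 \<in> row_span hex_q (add_mset 1 (add_mset 0 ?K))"
    by (rule hole_back_fill[OF _ _ _ G2]) (use assms(3) in \<open>simp_all add: sb\<close>)
  from this have "hex_hole (a - 3) 2 \<in> row_span hex_q (add_mset 5 (add_mset 1 (add_mset 0 ?K)))"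
    by (rule hole_back) (use assms(3) in \<open>simp_all add: sb\<close>)
  from this have "hex_hole (a - 4) 3 \<in> row_span hex_q (add_mset 4 (add_mset 5 (add_mset 1 (add_mset 0 ?K))))"
    by (rule hole_back) (use assms(3) in \<open>simp_all add: sb\<close>)
  from this have "hex_hole (a - 5) 4 \<in> row_span hex_q (add_mset 3 (add_mset 4 (add_mset 5 (add_mset 1 (add_mset 0 ?K)))))"
    by (rule hole_back) (use assms(3) in \<open>simp_all add: sb\<close>)
  from this have "hex_hole (a - 6) 5 \<in> row_span hex_q (add_mset 2 (add_mset 3 (add_mset 4 (add_mset 5 (add_mset 1 (add_mset 0 ?K))))))"
    by (rule hole_back) (use assms(3) in \<open>simp_all add: sb\<close>)
  then show ?thesis
    by (intro exI[of _ "add_mset 2 (add_mset 3 (add_mset 4 (add_mset 5 (add_mset 1 (add_mset 0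
      {#0, 1, 2, 3, 4, 5#})))))"]) simp
qed

lemma hex_hole_span:
  "\<exists>M. set_mset M \<subseteq> {0, 1, 2, 3, 4, 5} \<and> hex_hole (2 - 6 * int k) 5 \<in> row_span hex_q M"
proof (induction k)
  case 0
  have "hex_hole 6 1 w = wform hex_q [0] w" for w
    by (cases w) (auto simp: wform_single hex_hole_beyond simp del: wform.simps)
  then have "hex_hole 6 1 = wform hex_q [0]" by auto
  then have "hex_hole 6 1 \<in> row_span hex_q {#0#}"
    using row_span_row[where u = "[0]" and q = hex_q] by simp
  from this have "hex_hole 5 2 \<in> row_span hex_q {#5, 0#}"
    by (rule hole_back) (simp_all add: step_back_def)
  from this have "hex_hole 4 3 \<in> row_span hex_q {#4, 5, 0#}"
    by (rule hole_back) (simp_all add: step_back_def)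
  from this have "hex_hole 3 4 \<in> row_span hex_q {#3, 4, 5, 0#}"
    by (rule hole_back) (simp_all add: step_back_def)
  from this have "hex_hole 2 5 \<in> row_span hex_q {#2, 3, 4, 5, 0#}"
    by (rule hole_back) (simp_all add: step_back_def)
  then show ?case by (intro exI[of _ "{#2, 3, 4, 5, 0#}"]) simp
next
  case (Suc k)
  then obtain M where M: "set_mset M \<subseteq> {0, 1, 2, 3, 4, 5}" "hex_hole (2 - 6 * int k) 5 \<in> row_span hex_q M"
    by blast
  have "res6 (2 - 6 * int k) = 2" unfolding res6_def by presburger
  then obtain N where N: "set_mset N \<subseteq> {0, 1, 2, 3, 4, 5}"
      "hex_hole (2 - 6 * int k - 6) 5 \<in> row_span hex_q (N + M)"
    using hex_hole_period[OF M(2)] by auto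
  have "2 - 6 * int (Suc k) = 2 - 6 * int k - 6" by simp
  then show ?case using M(1) N by (metis (no_types, lifting) Un_least set_mset_union)
qed

lemma hex_hole_word: "\<exists>w. hex_hole (2 - 6 * int k) 5 w = 1 \<and> length w = 12 * k + 5"
proof (induction k)
  case 0
  show ?case by (intro exI[of _ "[2, 3, 4, 5, 0]"]) simp
next
  case (Suc k)
  define a where "a = 2 - 6 * int (Suc k)"
  have a: "a \<le> - 4" by (simp add: a_def)
  have r: "res6 a = 2" unfolding a_def res6_def by presburger
  note st = res6_diff[OF r] r a
  have e: "2 - 6 * int k = a + 6" by (simp add: a_def)
  obtain w where w: "hex_hole (a + 6) 5 w = 1" "length w = 12 * k + 5" using Suc unfolding e by blast
  have move: "hex_hole (a + c) d (j # v) = hex_hole (a + c') d' v"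
    if "c \<le> 6" "(j = res6 (2 + c) \<and> d \<noteq> 1 \<and> c' = c + 1 \<and> d' = d - 1)
      \<or> (j \<noteq> res6 (2 + c) \<and> j = res6 (2 + c + d) \<and> d \<noteq> 5 \<and> c' = c \<and> d' = d + 1)"
      "\<not> (c = 6 \<and> d = 1)" for c d c' d' j v
  proof -
    have "res6 (a + c) = res6 (2 + c)" "res6 (a + c + d) = res6 (2 + c + d)"
      using res6_diff(3)[OF r] by (simp_all add: add.assoc)
    then show ?thesis using that a by (auto simp: add.assoc)
  qed
  \<comment> \<open>The letters that \<open>hex_hole_period\<close> puts in front, in reading
    order.\<close>
  have "hex_hole (a + 0) 5 ([2, 3, 4, 5, 1, 0, 2, 3, 4, 5, 1, 0] @ w) = hex_hole (a + 6) 5 w"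
    using move[of 0 2 5 1 4] move[of 1 3 4 2 3] move[of 2 4 3 3 2] move[of 3 5 2 4 1]
      move[of 4 1 1 4 2] move[of 4 0 2 5 1] move[of 5 2 1 5 2] move[of 5 3 2 5 3] move[of 5 4 3 5 4]
      move[of 5 5 4 5 5] move[of 5 1 5 6 4] move[of 6 0 4 6 5]
    by (simp del: hex_hole.simps)
  then have "hex_hole a 5 ([2, 3, 4, 5, 1, 0, 2, 3, 4, 5, 1, 0] @ w) = 1" using w by simp
  then show ?case using w(2) unfolding a_def[symmetric]
    by (intro exI[of _ "[2, 3, 4, 5, 1, 0, 2, 3, 4, 5, 1, 0] @ w"]) (simp del: hex_hole.simps)
qed

lemma hex_wform_nonzero:
  "\<exists>u w. set u \<subseteq> {0, 1, 2, 3, 4, 5} \<and> set w \<subseteq> {0, 1, 2, 3, 4, 5} \<and> length u = 12 * k + 5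
     \<and> wform hex_q u w \<noteq> 0"
proof -
  obtain M where M: "set_mset M \<subseteq> {0, 1, 2, 3, 4, 5}" "hex_hole (2 - 6 * int k) 5 \<in> row_span hex_q M"
    using hex_hole_span by blast
  obtain w where w: "hex_hole (2 - 6 * int k) 5 w = 1" "length w = 12 * k + 5"
    using hex_hole_word by blast
  obtain u where u: "mset u = M" "wform hex_q u w \<noteq> 0"
    using row_span_nonzero[OF M(2), of w] w by auto
  have "mset w = M" using wform_mset[OF u(2)] u(1) by simp
  then have "set w = set u" "length w = length u"
    using u(1) by (auto dest: mset_eq_setD mset_eq_length)
  moreover have "set u \<subseteq> {0, 1, 2, 3, 4, 5}" using M(1) u(1) by auto
  ultimately show ?thesis using u(2) w(2)
    by (intro exI[of _ u] exI[of _ w] conjI) (simp_all del: insert_subset)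
qed

section \<open>Digits\<close>

definition undig :: "nat \<Rightarrow> (nat \<Rightarrow> nat) \<Rightarrow> nat \<Rightarrow> nat" where
  "undig D f m = (\<Sum>p<m. f p * D ^ p)"

lemma undig_less:
  assumes "\<And>p. p < m \<Longrightarrow> f p < D"
  shows "undig D f m < D ^ m"
  using assms
proof (induction m)
  case (Suc m)
  have "undig D f (Suc m) < D ^ m + f m * D ^ m" using Suc by (simp add: undig_def)
  also have "\<dots> = Suc (f m) * D ^ m" by simp
  also have "\<dots> \<le> D * D ^ m" using Suc.prems[of m] by (intro mult_right_mono) auto
  finally show ?case by simp
qed (simp add: undig_def)

lemma dig_add_high:
  assumes "p < m"
  shows "dig D (r + D ^ m * h) p = dig D r p"
proof (cases "D = 0")
  case False
  have "D ^ m = D ^ p * (D * D ^ (m - Suc p))"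
    using assms by (metis Suc_leI le_add_diff_inverse power_Suc power_add mult.assoc mult.commute)
  then have "(r + D ^ m * h) div D ^ p = r div D ^ p + D * (D ^ (m - Suc p) * h)"
    using False by (simp add: mult.assoc)
  then show ?thesis by (simp add: dig_def)
qed (use assms in \<open>simp add: dig_def power_0_left\<close>)

lemma dig_high:
  assumes "r < D ^ m" "h < D"
  shows "dig D (r + D ^ m * h) m = h"
  using assms by (simp add: dig_def)

lemma dig_undig:
  assumes "\<And>p. p < m \<Longrightarrow> f p < D" "p < m"
  shows "dig D (undig D f m) p = f p"
  using assms
proof (induction m)
  case (Suc m)
  have u: "undig D f (Suc m) = undig D f m + D ^ m * f m" by (simp add: undig_def)
  show ?case
  proof (cases "p = m")
    case True
    then show ?thesis unfolding u using Suc.prems undig_less[of m f D] by (simp add: dig_high)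
  next
    case False
    then show ?thesis unfolding u using Suc by (simp add: dig_add_high)
  qed
qed simp

lemma undig_dig: "undig D (dig D r) m = r mod D ^ m"
proof (induction m)
  case (Suc m)
  have "undig D (dig D r) (Suc m) = r mod D ^ m + D ^ m * (r div D ^ m mod D)"
    using Suc by (simp add: undig_def dig_def)
  also have "\<dots> = r mod (D ^ m * D)" by (simp add: mod_mult2_eq)
  finally show ?case by (simp add: mult.commute)
qed (simp add: undig_def)

lemma undig_cong: "(\<And>p. p < m \<Longrightarrow> f p = g p) \<Longrightarrow> undig D f m = undig D g m"
  by (simp add: undig_def)

lemma sum_mult_split:
  fixes f :: "nat \<Rightarrow> complex"
  shows "(\<Sum>s<n * k. f s) = (\<Sum>h<n. \<Sum>l<k. f (l + k * h))"
proof -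
  have "(\<Sum>s<n * k. f s) = (\<Sum>h<n. sum f {h * k..<h * k + k})"
    by (rule sum.nat_group[symmetric])
  also have "\<dots> = (\<Sum>h<n. \<Sum>l<k. f (l + k * h))"
  proof (rule sum.cong[OF refl])
    fix h
    show "sum f {h * k..<h * k + k} = (\<Sum>l<k. f (l + k * h))"
      using sum.shift_bounds_nat_ivl[of f 0 "h * k" k]
      by (simp add: lessThan_atLeast0 add.commute mult.commute)
  qed
  finally show ?thesis .
qed

lemma sum_power_Suc:
  fixes f :: "nat \<Rightarrow> complex"
  shows "(\<Sum>s<D ^ Suc m. f s) = (\<Sum>h<D. \<Sum>l<D ^ m. f (l + D ^ m * h))"
  using sum_mult_split[of f D "D ^ m"] by simp

section \<open>Tensors and the quantum symmetrizer\<close>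

definition tensor :: "nat \<Rightarrow> (nat \<Rightarrow> complex) list \<Rightarrow> complex vec" where
  "tensor D xs = vec (D ^ length xs) (\<lambda>r. \<Prod>p<length xs. (xs ! p) (dig D r p))"

lemma tensor_carrier: "length xs = m \<Longrightarrow> tensor D xs \<in> carrier_vec (D ^ m)"
  by (simp add: tensor_def)

text \<open>Only columns that agree with the row off the two positions contribute. They are
  parametrised by the two free digits, and the sum over these is the one in the hypothesis.\<close>

lemma bmat_tensor:
  assumes braid: "\<And>u v. u < D \<Longrightarrow> v < D \<Longrightarrow>
      (\<Sum>a<D. \<Sum>b<D. cf u v a b * y a * z b) = c * z u * y v"
    and m: "m = length pre + 2 + length suf"
  shows "bmat D cf m (length pre) *\<^sub>v tensor D (pre @ [y, z] @ suf)
       = c \<cdot>\<^sub>v tensor D (pre @ [z, y] @ suf)"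
proof (rule eq_vecI)
  fix r
  assume "r < dim_vec (c \<cdot>\<^sub>v tensor D (pre @ [z, y] @ suf))"
  then have r: "r < D ^ m" using m by (simp add: tensor_def)
  let ?k = "length pre" and ?xs = "pre @ [y, z] @ suf"
  have D: "D > 0" using r m by (cases D) auto
  have dg: "dig D s p < D" for s p using D by (simp add: dig_def)
  let ?C = "\<lambda>s. \<forall>p<m. p \<noteq> ?k \<and> p \<noteq> Suc ?k \<longrightarrow> dig D r p = dig D s p"
  let ?G = "\<lambda>s. cf (dig D r ?k) (dig D r (Suc ?k)) (dig D s ?k) (dig D s (Suc ?k))
              * (\<Prod>p<m. (?xs ! p) (dig D s p))"
  let ?f = "\<lambda>a b. (dig D r)(?k := a, Suc ?k := b)"
  have km: "?k < m" "Suc ?k < m" using m by auto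
  have f: "?f a b p < D" if "a < D" "b < D" for a b p using that dg by simp
  have "(bmat D cf m ?k *\<^sub>v tensor D ?xs) $ r
      = (\<Sum>s<D ^ m. (if ?C s then cf (dig D r ?k) (dig D r (Suc ?k)) (dig D s ?k) (dig D s (Suc ?k)) else 0)
          * (\<Prod>p<m. (?xs ! p) (dig D s p)))"
    using r m by (simp add: bmat_def tensor_def scalar_prod_def lessThan_atLeast0)
  also have "\<dots> = (\<Sum>s<D ^ m. if ?C s then ?G s else 0)"
    by (intro sum.cong) auto
  also have "\<dots> = (\<Sum>s\<in>{s. s < D ^ m \<and> ?C s}. ?G s)"
    by (simp add: sum.If_cases) (intro sum.cong, auto)
  also have "\<dots> = (\<Sum>(a, b)\<in>{..<D} \<times> {..<D}. ?G (undig D (?f a b) m))"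
  proof (rule sum.reindex_bij_witness[where j = "\<lambda>s. (dig D s ?k, dig D s (Suc ?k))"
        and i = "\<lambda>(a, b). undig D (?f a b) m"])
    fix s assume s: "s \<in> {s. s < D ^ m \<and> ?C s}"
    then have "undig D (?f (dig D s ?k) (dig D s (Suc ?k))) m = undig D (dig D s) m"
      by (intro undig_cong) auto
    then have e: "undig D (?f (dig D s ?k) (dig D s (Suc ?k))) m = s" using s by (simp add: undig_dig)
    then show "(\<lambda>(a, b). undig D (?f a b) m) (dig D s ?k, dig D s (Suc ?k)) = s" by simp
    show "(dig D s ?k, dig D s (Suc ?k)) \<in> {..<D} \<times> {..<D}" using dg by simp
    show "(case (dig D s ?k, dig D s (Suc ?k)) of (a, b) \<Rightarrow> ?G (undig D (?f a b) m)) = ?G s"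
      using e by simp
  next
    fix ab assume ab: "ab \<in> {..<D} \<times> {..<D}"
    obtain a b where [simp]: "ab = (a, b)" by (cases ab)
    have lt: "a < D" "b < D" using ab by auto
    have d: "dig D (undig D (?f a b) m) p = ?f a b p" if "p < m" for p
      using dig_undig[of m "?f a b" D p] f[OF lt] that by blast
    show "(case ab of (a, b) \<Rightarrow> undig D (?f a b) m) \<in> {s. s < D ^ m \<and> ?C s}"
      using undig_less[of m "?f a b" D] f[OF lt] d by auto
    show "(dig D (case ab of (a, b) \<Rightarrow> undig D (?f a b) m) ?k,
        dig D (case ab of (a, b) \<Rightarrow> undig D (?f a b) m) (Suc ?k)) = ab"
      using d km by simp
  qed
  also have "\<dots> = (\<Sum>a<D. \<Sum>b<D. ?G (undig D (?f a b) m))"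
    by (simp add: sum.cartesian_product)
  also have "\<dots> = (\<Sum>a<D. \<Sum>b<D. (cf (dig D r ?k) (dig D r (Suc ?k)) a b * y a * z b)
        * (\<Prod>p\<in>{..<m} - {?k, Suc ?k}. (?xs ! p) (dig D r p)))"
  proof (intro sum.cong refl)
    fix a b assume "a \<in> {..<D}" "b \<in> {..<D}"
    then have lt: "a < D" "b < D" by auto
    have d: "dig D (undig D (?f a b) m) p = ?f a b p" if "p < m" for p
      using dig_undig[of m "?f a b" D p] f[OF lt] that by blast
    have "(\<Prod>p<m. (?xs ! p) (dig D (undig D (?f a b) m) p)) = (\<Prod>p<m. (?xs ! p) (?f a b p))"
      by (intro prod.cong refl arg_cong[where f = "\<lambda>t. (?xs ! _) t"] d) simp
    also have "\<dots> = (\<Prod>p\<in>{..<m} - {?k, Suc ?k}. (?xs ! p) (?f a b p)) * (\<Prod>p\<in>{?k, Suc ?k}. (?xs ! p) (?f a b p))"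
      by (rule prod.subset_diff) (use km in auto)
    also have "(\<Prod>p\<in>{?k, Suc ?k}. (?xs ! p) (?f a b p)) = y a * z b"
      by (simp add: nth_append)
    also have "(\<Prod>p\<in>{..<m} - {?k, Suc ?k}. (?xs ! p) (?f a b p))
        = (\<Prod>p\<in>{..<m} - {?k, Suc ?k}. (?xs ! p) (dig D r p))"
      by (intro prod.cong) auto
    finally have P: "(\<Prod>p<m. (?xs ! p) (dig D (undig D (?f a b) m) p))
        = (\<Prod>p\<in>{..<m} - {?k, Suc ?k}. (?xs ! p) (dig D r p)) * (y a * z b)" .
    show "?G (undig D (?f a b) m) = (cf (dig D r ?k) (dig D r (Suc ?k)) a b * y a * z b)
        * (\<Prod>p\<in>{..<m} - {?k, Suc ?k}. (?xs ! p) (dig D r p))"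
      unfolding P d[OF km(1)] d[OF km(2)] by (simp add: mult.assoc mult.left_commute mult.commute)
  qed
  also have "\<dots> = c * z (dig D r ?k) * y (dig D r (Suc ?k))
        * (\<Prod>p\<in>{..<m} - {?k, Suc ?k}. (?xs ! p) (dig D r p))"
    unfolding sum_distrib_right[symmetric] braid[OF dg dg] ..
  also have "(\<Prod>p\<in>{..<m} - {?k, Suc ?k}. (?xs ! p) (dig D r p))
      = (\<Prod>p\<in>{..<m} - {?k, Suc ?k}. ((pre @ [z, y] @ suf) ! p) (dig D r p))"
    by (intro prod.cong refl) (auto simp: nth_append nth_Cons split: nat.split)
  also have "c * z (dig D r ?k) * y (dig D r (Suc ?k))
      * (\<Prod>p\<in>{..<m} - {?k, Suc ?k}. ((pre @ [z, y] @ suf) ! p) (dig D r p))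
      = c * ((\<Prod>p\<in>{..<m} - {?k, Suc ?k}. ((pre @ [z, y] @ suf) ! p) (dig D r p))
        * (\<Prod>p\<in>{?k, Suc ?k}. ((pre @ [z, y] @ suf) ! p) (dig D r p)))"
    by (simp add: nth_append algebra_simps)
  also have "\<dots> = c * (\<Prod>p<m. ((pre @ [z, y] @ suf) ! p) (dig D r p))"
    by (subst prod.subset_diff[of "{?k, Suc ?k}" "{..<m}"]) (use km in auto)
  also have "\<dots> = (c \<cdot>\<^sub>v tensor D (pre @ [z, y] @ suf)) $ r"
    using r m by (simp add: tensor_def)
  finally show "(bmat D cf m ?k *\<^sub>v tensor D ?xs) $ r = (c \<cdot>\<^sub>v tensor D (pre @ [z, y] @ suf)) $ r" .
qed (simp add: bmat_def tensor_def m)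

text \<open>Evaluation of a pure tensor of functionals; bilinear, without complex
  conjugation.\<close>

definition tensor_pair :: "nat \<Rightarrow> (nat \<Rightarrow> complex) list \<Rightarrow> complex vec \<Rightarrow> complex" where
  "tensor_pair D fs v = (\<Sum>r<D ^ length fs. (\<Prod>p<length fs. (fs ! p) (dig D r p)) * v $ r)"

lemma tensor_pair_zero: "tensor_pair D fs (0\<^sub>v (D ^ length fs)) = 0"
  by (simp add: tensor_pair_def)

lemma tensor_pair_add:
  assumes "v \<in> carrier_vec (D ^ length fs)" "w \<in> carrier_vec (D ^ length fs)"
  shows "tensor_pair D fs (v + w) = tensor_pair D fs v + tensor_pair D fs w"
  using assms by (simp add: tensor_pair_def distrib_left sum.distrib)

lemma tensor_pair_smult:
  assumes "v \<in> carrier_vec (D ^ length fs)"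
  shows "tensor_pair D fs (c \<cdot>\<^sub>v v) = c * tensor_pair D fs v"
  using assms by (simp add: tensor_pair_def sum_distrib_left mult.left_commute)

lemma ext_op_tensor:
  assumes X: "X \<in> carrier_mat (D ^ m) (D ^ m)" and xs: "length xs = m" and r: "l < D ^ m" "h < D"
  shows "(ext_op D X (Suc m) *\<^sub>v tensor D (xs @ [y])) $ (l + D ^ m * h) = (X *\<^sub>v tensor D xs) $ l * y h"
proof -
  have "D > 0" using r by simp
  have lt: "l' + D ^ m * h' < D ^ Suc m" if "l' < D ^ m" "h' < D" for l' h'
  proof -
    have "l' + D ^ m * h' < D ^ m * Suc h'" using that by simp
    also have "\<dots> \<le> D ^ m * D" using that by (intro mult_left_mono) auto
    finally show ?thesis by (simp add: mult.commute)
  qed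
  have "(ext_op D X (Suc m) *\<^sub>v tensor D (xs @ [y])) $ (l + D ^ m * h)
      = (\<Sum>s<D ^ Suc m. (if h = s div D ^ m then X $$ (l, s mod D ^ m) else 0)
           * (\<Prod>p<Suc m. ((xs @ [y]) ! p) (dig D s p)))"
    using lt[OF r] r xs
    by (simp add: ext_op_def tensor_def scalar_prod_def lessThan_atLeast0 del: power_Suc prod.lessThan_Suc prod.atLeast0_lessThan_Suc cong: if_cong)
  also have "\<dots> = (\<Sum>h'<D. \<Sum>l'<D ^ m. (if h = h' then X $$ (l, l') else 0)
           * ((\<Prod>p<m. (xs ! p) (dig D l' p)) * y h'))"
    unfolding sum_power_Suc
  proof (intro sum.cong refl)
    fix h' l' assume "h' \<in> {..<D}" "l' \<in> {..<D ^ m}"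
    then have hl: "h' < D" "l' < D ^ m" by auto
    have "(\<Prod>p<m. ((xs @ [y]) ! p) (dig D (l' + D ^ m * h') p)) = (\<Prod>p<m. (xs ! p) (dig D l' p))"
      using xs by (intro prod.cong refl) (auto simp: nth_append dig_add_high)
    moreover have "((xs @ [y]) ! m) = y" using xs by (metis nth_append_length)
    ultimately show "(if h = (l' + D ^ m * h') div D ^ m then X $$ (l, (l' + D ^ m * h') mod D ^ m) else 0)
           * (\<Prod>p<Suc m. ((xs @ [y]) ! p) (dig D (l' + D ^ m * h') p))
      = (if h = h' then X $$ (l, l') else 0) * ((\<Prod>p<m. (xs ! p) (dig D l' p)) * y h')"
      using hl xs by (simp add: dig_high)
  qed
  also have "\<dots> = (\<Sum>h'<D. if h = h' then (\<Sum>l'<D ^ m. X $$ (l, l') * ((\<Prod>p<m. (xs ! p) (dig D l' p)) * y h')) else 0)"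
    by (intro sum.cong refl) auto
  also have "\<dots> = (\<Sum>l'<D ^ m. X $$ (l, l') * ((\<Prod>p<m. (xs ! p) (dig D l' p)) * y h))"
    using r by simp
  also have "\<dots> = (X *\<^sub>v tensor D xs) $ l * y h"
    using r X xs by (simp add: tensor_def scalar_prod_def lessThan_atLeast0 sum_distrib_right mult.assoc)
  finally show ?thesis .
qed

lemma tensor_pair_ext:
  assumes X: "X \<in> carrier_mat (D ^ m) (D ^ m)" and xs: "length xs = m" and fs: "length fs = m"
  shows "tensor_pair D (fs @ [f]) (ext_op D X (Suc m) *\<^sub>v tensor D (xs @ [y]))
     = tensor_pair D fs (X *\<^sub>v tensor D xs) * (\<Sum>a<D. f a * y a)"
proof -
  have len: "length (fs @ [f]) = Suc m" using fs by simp
  have "tensor_pair D (fs @ [f]) (ext_op D X (Suc m) *\<^sub>v tensor D (xs @ [y]))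
    = (\<Sum>h<D. \<Sum>l<D ^ m. (\<Prod>p<Suc m. ((fs @ [f]) ! p) (dig D (l + D ^ m * h) p))
        * (ext_op D X (Suc m) *\<^sub>v tensor D (xs @ [y])) $ (l + D ^ m * h))"
    unfolding tensor_pair_def len sum_power_Suc ..
  also have "\<dots> = (\<Sum>h<D. \<Sum>l<D ^ m. ((\<Prod>p<m. (fs ! p) (dig D l p)) * (X *\<^sub>v tensor D xs) $ l) * (f h * y h))"
  proof (intro sum.cong refl)
    fix h l assume "h \<in> {..<D}" "l \<in> {..<D ^ m}"
    then have hl: "h < D" "l < D ^ m" by auto
    have "(\<Prod>p<m. ((fs @ [f]) ! p) (dig D (l + D ^ m * h) p)) = (\<Prod>p<m. (fs ! p) (dig D l p))"
      using fs by (intro prod.cong refl) (auto simp: nth_append dig_add_high)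
    moreover have "((fs @ [f]) ! m) = f" using fs by (metis nth_append_length)
    ultimately have "(\<Prod>p<Suc m. ((fs @ [f]) ! p) (dig D (l + D ^ m * h) p)) = (\<Prod>p<m. (fs ! p) (dig D l p)) * f h"
      using hl fs by (simp add: dig_high)
    then show "(\<Prod>p<Suc m. ((fs @ [f]) ! p) (dig D (l + D ^ m * h) p))
        * (ext_op D X (Suc m) *\<^sub>v tensor D (xs @ [y])) $ (l + D ^ m * h)
      = ((\<Prod>p<m. (fs ! p) (dig D l p)) * (X *\<^sub>v tensor D xs) $ l) * (f h * y h)"
      unfolding ext_op_tensor[OF X xs hl(2,1)] by (simp add: mult.assoc mult.left_commute mult.commute)
  qed
  also have "\<dots> = (\<Sum>l<D ^ m. (\<Prod>p<m. (fs ! p) (dig D l p)) * (X *\<^sub>v tensor D xs) $ l) * (\<Sum>a<D. f a * y a)"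
    by (simp add: sum_distrib_left sum_distrib_right)
  finally show ?thesis using fs by (simp add: tensor_pair_def)
qed

lemma foldr_mult_carrier:
  assumes "\<And>A. A \<in> set As \<Longrightarrow> A \<in> carrier_mat k k" "B \<in> carrier_mat k k"
  shows "foldr (*) As B \<in> carrier_mat k k"
  using assms
proof (induction As)
  case (Cons A As)
  then have "A \<in> carrier_mat k k" "foldr (*) As B \<in> carrier_mat k k" by auto
  then show ?case by simp
qed simp

lemma foldr_mult:
  assumes "\<And>A. A \<in> set As \<Longrightarrow> A \<in> carrier_mat k k" "B \<in> carrier_mat k k"
  shows "foldr (*) As (B :: complex mat) = foldr (*) As (1\<^sub>m k) * B"
  using assms
proof (induction As)
  case (Cons A As)
  have "foldr (*) As (1\<^sub>m k) \<in> carrier_mat k k"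
    by (rule foldr_mult_carrier) (use Cons in auto)
  then show ?case using Cons by (auto simp: assoc_mult_mat[of A k k _ k _ k])
qed simp

lemma bmat_carrier: "bmat D cf m k \<in> carrier_mat (D ^ m) (D ^ m)"
  by (simp add: bmat_def)

text \<open>A single summand of \<open>shuffle_op\<close>. The rightmost factor acts first, so the
  letter with \<open>j\<close> letters behind it is carried to the last place.\<close>

definition bmat_chain :: "nat \<Rightarrow> (nat \<Rightarrow> nat \<Rightarrow> nat \<Rightarrow> nat \<Rightarrow> complex) \<Rightarrow> nat \<Rightarrow> nat \<Rightarrow> complex mat" where
  "bmat_chain D cf m j = foldr (*) (map (\<lambda>l. bmat D cf m (m - 2 - l)) [0..<j]) (1\<^sub>m (D ^ m))"

lemma bmat_chain_carrier: "bmat_chain D cf m j \<in> carrier_mat (D ^ m) (D ^ m)"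
  unfolding bmat_chain_def by (rule foldr_mult_carrier) (auto simp: bmat_carrier)

lemma bmat_chain_Suc: "bmat_chain D cf m (Suc j) = bmat_chain D cf m j * bmat D cf m (m - 2 - j)"
proof -
  have "bmat D cf m (m - 2 - j) * 1\<^sub>m (D ^ m) = bmat D cf m (m - 2 - j)"
    by (rule right_mult_one_mat[OF bmat_carrier])
  then have "bmat_chain D cf m (Suc j)
      = foldr (*) (map (\<lambda>l. bmat D cf m (m - 2 - l)) [0..<j]) (bmat D cf m (m - 2 - j))"
    by (simp add: bmat_chain_def)
  also have "\<dots> = bmat_chain D cf m j * bmat D cf m (m - 2 - j)"
    unfolding bmat_chain_def by (rule foldr_mult) (auto simp: bmat_carrier)
  finally show ?thesis .
qed

lemma shuffle_op_eq: "shuffle_op D cf m = foldr (+) (map (bmat_chain D cf m) [0..<m]) (0\<^sub>m (D ^ m) (D ^ m))"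
  unfolding shuffle_op_def bmat_chain_def ..

lemma foldr_add_carrier:
  assumes "\<And>A. A \<in> set As \<Longrightarrow> A \<in> carrier_mat k k"
  shows "foldr (+) As (0\<^sub>m k k) \<in> carrier_mat k k"
  using assms by (induction As) auto

lemma shuffle_op_carrier: "shuffle_op D cf m \<in> carrier_mat (D ^ m) (D ^ m)"
  unfolding shuffle_op_eq by (rule foldr_add_carrier) (auto simp: bmat_chain_carrier)

lemma qsym_carrier: "qsym D cf m \<in> carrier_mat (D ^ m) (D ^ m)"
proof (cases m)
  case (Suc k)
  have "ext_op D (qsym D cf k) (Suc k) \<in> carrier_mat (D ^ Suc k) (D ^ Suc k)"
    by (simp add: ext_op_def)
  then show ?thesis using Suc shuffle_op_carrier[of D cf "Suc k"]
    by (metis mult_carrier_mat qsym.simps(2))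
qed simp

lemma zero_mat_mult_vec: "t \<in> carrier_vec k \<Longrightarrow> 0\<^sub>m l k *\<^sub>v t = 0\<^sub>v l"
  by (intro eq_vecI) (auto simp: scalar_prod_def)

lemma tensor_pair_sum_list:
  assumes "\<And>A. A \<in> set As \<Longrightarrow> A \<in> carrier_mat k k" "E \<in> carrier_mat k k" "t \<in> carrier_vec k"
    "k = D ^ length fs"
  shows "tensor_pair D fs (E *\<^sub>v (foldr (+) As (0\<^sub>m k k) *\<^sub>v t))
    = (\<Sum>A\<leftarrow>As. tensor_pair D fs (E *\<^sub>v (A *\<^sub>v t)))"
  using assms(1)
proof (induction As)
  case Nil
  have "0\<^sub>m k k *\<^sub>v t = 0\<^sub>v k" "E *\<^sub>v 0\<^sub>v k = 0\<^sub>v k"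
    using assms(2,3) by (intro eq_vecI; auto simp: scalar_prod_def)+
  then show ?case using tensor_pair_zero[of D fs] assms(4) by simp
next
  case (Cons A As)
  have F: "foldr (+) As (0\<^sub>m k k) \<in> carrier_mat k k"
    by (rule foldr_add_carrier) (use Cons in auto)
  have A: "A \<in> carrier_mat k k" using Cons by simp
  have "E *\<^sub>v ((A + foldr (+) As (0\<^sub>m k k)) *\<^sub>v t)
      = E *\<^sub>v (A *\<^sub>v t) + E *\<^sub>v (foldr (+) As (0\<^sub>m k k) *\<^sub>v t)"
    using A F assms(2,3)
    by (metis add_mult_distrib_mat_vec mult_add_distrib_mat_vec mult_mat_vec_carrier)
  moreover have "E *\<^sub>v (A *\<^sub>v t) \<in> carrier_vec (D ^ length fs)"
    "E *\<^sub>v (foldr (+) As (0\<^sub>m k k) *\<^sub>v t) \<in> carrier_vec (D ^ length fs)"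
    using A F assms(2-4) by (auto intro!: mult_mat_vec_carrier)
  ultimately show ?case using Cons by (simp add: tensor_pair_add)
qed

text \<open>The \<open>x i\<close> span a braided subspace of diagonal type. Duality on the
  \<open>x j\<close> is what the functionals must satisfy, since the symmetrizer maps tensors of the
  \<open>x j\<close> to combinations of such tensors.\<close>

locale diagonal_part =
  fixes D :: nat and cf :: "nat \<Rightarrow> nat \<Rightarrow> nat \<Rightarrow> nat \<Rightarrow> complex"
    and q :: "'a \<Rightarrow> 'a \<Rightarrow> complex" and I :: "'a set" and x f :: "'a \<Rightarrow> nat \<Rightarrow> complex"
  assumes braid: "\<And>i j u v. i \<in> I \<Longrightarrow> j \<in> I \<Longrightarrow> u < D \<Longrightarrow> v < D \<Longrightarrow>
      (\<Sum>a<D. \<Sum>b<D. cf u v a b * x i a * x j b) = q i j * x j u * x i v"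
    and dual: "\<And>i j. i \<in> I \<Longrightarrow> j \<in> I \<Longrightarrow> (\<Sum>a<D. f i a * x j a) = (if i = j then 1 else 0)"
    and q_sq: "\<And>i j. q i j * q i j = 1"
begin

lemma bmat_chain_tensor:
  assumes "set pre \<subseteq> I" "i \<in> I" "set suf \<subseteq> I" "m = length pre + 1 + length suf"
  shows "bmat_chain D cf m (length suf) *\<^sub>v tensor D (map x (pre @ i # suf))
    = prod_list (map (q i) suf) \<cdot>\<^sub>v tensor D (map x (pre @ suf @ [i]))"
  using assms
proof (induction suf arbitrary: pre)
  case Nil
  have "tensor D (map x (pre @ [i])) \<in> carrier_vec (D ^ m)"
    by (rule tensor_carrier) (simp add: Nil)
  then show ?case by (simp add: bmat_chain_def)
next
  case (Cons s suf)
  have t: "tensor D (map x (pre @ i # s # suf)) \<in> carrier_vec (D ^ m)"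
    "tensor D (map x ((pre @ [s]) @ i # suf)) \<in> carrier_vec (D ^ m)"
    "tensor D (map x (pre @ s # suf @ [i])) \<in> carrier_vec (D ^ m)"
    by (rule tensor_carrier, simp add: Cons.prems)+
  have mm: "m - 2 - length suf = length (map x pre)" using Cons.prems(4) by simp
  have "bmat D cf m (length (map x pre)) *\<^sub>v tensor D (map x pre @ [x i, x s] @ map x suf)
      = q i s \<cdot>\<^sub>v tensor D (map x pre @ [x s, x i] @ map x suf)"
    by (rule bmat_tensor[OF braid]) (use Cons.prems in auto)
  then have b: "bmat D cf m (m - 2 - length suf) *\<^sub>v tensor D (map x (pre @ i # s # suf))
      = q i s \<cdot>\<^sub>v tensor D (map x ((pre @ [s]) @ i # suf))"
    unfolding mm by simp
  have "bmat_chain D cf m (length (s # suf)) *\<^sub>v tensor D (map x (pre @ i # s # suf))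
      = bmat_chain D cf m (length suf) *\<^sub>v (bmat D cf m (m - 2 - length suf) *\<^sub>v tensor D (map x (pre @ i # s # suf)))"
    using assoc_mult_mat_vec[OF bmat_chain_carrier bmat_carrier t(1)] by (simp add: bmat_chain_Suc)
  also have "\<dots> = q i s \<cdot>\<^sub>v (bmat_chain D cf m (length suf) *\<^sub>v tensor D (map x ((pre @ [s]) @ i # suf)))"
    unfolding b by (rule mult_mat_vec[OF bmat_chain_carrier t(2)])
  also have "bmat_chain D cf m (length suf) *\<^sub>v tensor D (map x ((pre @ [s]) @ i # suf))
      = prod_list (map (q i) suf) \<cdot>\<^sub>v tensor D (map x ((pre @ [s]) @ suf @ [i]))"
    by (rule Cons.IH) (use Cons.prems in auto)
  finally show ?case by (simp add: smult_smult_assoc)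
qed

text \<open>The shuffle operator carries each letter of \<open>w\<close> in turn to the last place,
  and the last functional keeps those equal to the last letter of \<open>u\<close>: the recursion of
  \<open>wform_snoc_explicit\<close>.\<close>

lemma qsym_pair:
  assumes "set u \<subseteq> I" "set w \<subseteq> I" "length u = m" "length w = m"
  shows "tensor_pair D (map f u) (qsym D cf m *\<^sub>v tensor D (map x w)) = wform q u w"
  using assms
proof (induction m arbitrary: u w)
  case 0
  have "tensor D [] \<in> carrier_vec 1" by (simp add: tensor_def)
  then have "1\<^sub>m 1 *\<^sub>v tensor D [] = tensor D []" by (rule one_mult_mat_vec)
  then show ?case using 0 by (simp add: tensor_pair_def tensor_def)
next
  case (Suc m)
  obtain u' i where u: "u = u' @ [i]" using Suc.prems(3) by (cases u rule: rev_cases) auto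
  have u': "set u' \<subseteq> I" "i \<in> I" "length u' = m" using Suc.prems u by auto
  let ?E = "ext_op D (qsym D cf m) (Suc m)" and ?t = "tensor D (map x w)"
  have E: "?E \<in> carrier_mat (D ^ Suc m) (D ^ Suc m)" by (simp add: ext_op_def)
  have t: "?t \<in> carrier_vec (D ^ Suc m)" by (rule tensor_carrier) (simp add: Suc.prems)
  let ?h = "\<lambda>j. tensor_pair D (map f u) (?E *\<^sub>v (bmat_chain D cf (Suc m) j *\<^sub>v ?t))"
  have "tensor_pair D (map f u) (qsym D cf (Suc m) *\<^sub>v ?t)
     = tensor_pair D (map f u) (?E *\<^sub>v (shuffle_op D cf (Suc m) *\<^sub>v ?t))"
    using assoc_mult_mat_vec[OF E shuffle_op_carrier t] by simp
  also have "\<dots> = (\<Sum>A\<leftarrow>map (bmat_chain D cf (Suc m)) [0..<Suc m]. tensor_pair D (map f u) (?E *\<^sub>v (A *\<^sub>v ?t)))"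
    unfolding shuffle_op_eq
    by (rule tensor_pair_sum_list[OF _ E t]) (use bmat_chain_carrier[of D cf "Suc m"] Suc.prems in \<open>auto simp del: power_Suc\<close>)
  also have "\<dots> = (\<Sum>j<Suc m. ?h j)"
    by (simp only: map_map o_def interv_sum_list_conv_sum_set_nat lessThan_atLeast0 set_upt)
  \<comment> \<open>From the number \<open>j\<close> of letters passed to the position
    \<open>p\<close> of the travelling letter.\<close>
  also have "\<dots> = (\<Sum>p<Suc m. ?h (Suc m - Suc p))"
    by (rule sum.nat_diff_reindex[symmetric])
  also have "\<dots> = (\<Sum>p<length w. if w ! p = i
      then prod_list (map (q i) (drop (Suc p) w)) * wform q u' (take p w @ drop (Suc p) w) else 0)"
    unfolding Suc.prems(4)
  proof (intro sum.cong refl)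
    fix p assume "p \<in> {..<Suc m}"
    then have p: "p < length w" using Suc.prems by simp
    let ?A = "take p w" and ?B = "drop (Suc p) w" and ?k = "w ! p"
    have w: "w = ?A @ ?k # ?B" using id_take_nth_drop[OF p] .
    have sub: "set ?A \<subseteq> I" "set ?B \<subseteq> I" "?k \<in> I"
      using Suc.prems(2) p set_take_subset[of p w] set_drop_subset[of "Suc p" w] by auto
    have lenB: "Suc m - Suc p = length ?B" using Suc.prems by simp
    have l: "length (map x (?A @ ?B)) = m" using p Suc.prems by simp
    have c: "bmat_chain D cf (Suc m) (Suc m - Suc p) *\<^sub>v ?t
        = prod_list (map (q ?k) ?B) \<cdot>\<^sub>v tensor D (map x (?A @ ?B) @ [x ?k])"
      using bmat_chain_tensor[OF sub(1,3,2), of "Suc m"] p Suc.prems lenB w by simp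
    have tc: "tensor D (map x (?A @ ?B) @ [x ?k]) \<in> carrier_vec (D ^ Suc m)"
      by (rule tensor_carrier) (use l in simp)
    have "?h (Suc m - Suc p) = prod_list (map (q ?k) ?B)
        * tensor_pair D (map f u) (?E *\<^sub>v tensor D (map x (?A @ ?B) @ [x ?k]))"
      unfolding c mult_mat_vec[OF E tc]
      by (rule tensor_pair_smult) (use mult_mat_vec_carrier[OF E tc] Suc.prems in simp)
    also have "tensor_pair D (map f u) (?E *\<^sub>v tensor D (map x (?A @ ?B) @ [x ?k]))
        = tensor_pair D (map f u') (qsym D cf m *\<^sub>v tensor D (map x (?A @ ?B))) * (\<Sum>a<D. f i a * x ?k a)"
      using tensor_pair_ext[OF qsym_carrier l, where fs = "map f u'" and f = "f i" and y = "x ?k"] u' u by simp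
    also have "\<dots> = wform q u' (?A @ ?B) * (if ?k = i then 1 else 0)"
      using Suc.IH[of u' "?A @ ?B"] u' sub l dual[OF u'(2) sub(3)] by simp
    finally show "?h (Suc m - Suc p) = (if ?k = i then prod_list (map (q i) ?B) * wform q u' (?A @ ?B) else 0)"
      by simp
  qed
  also have "\<dots> = wform q u w" unfolding u wform_snoc_explicit[OF q_sq] ..
  finally show ?case .
qed

lemma qsym_nonzero:
  assumes "set u \<subseteq> I" "set w \<subseteq> I" "length w = length u" "wform q u w \<noteq> 0"
  shows "qsym D cf (length u) \<noteq> 0\<^sub>m (D ^ length u) (D ^ length u)"
proof
  assume z: "qsym D cf (length u) = 0\<^sub>m (D ^ length u) (D ^ length u)"
  have "tensor D (map x w) \<in> carrier_vec (D ^ length u)" by (rule tensor_carrier) (simp add: assms)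
  then have "qsym D cf (length u) *\<^sub>v tensor D (map x w) = 0\<^sub>v (D ^ length (map f u))"
    unfolding z using zero_mat_mult_vec by simp
  then show False using qsym_pair[OF assms(1,2) refl assms(3)] assms(4) tensor_pair_zero[of D "map f u"]
    by metis
qed

end

section \<open>Rank\<close>

text \<open>A nonzero entry is a nonvanishing minor of size 1.\<close>

lemma rank_nonzero:
  fixes A :: "complex mat"
  assumes A: "A \<in> carrier_mat n nc" and "A \<noteq> 0\<^sub>m n nc"
  shows "vec_space.rank n A \<noteq> 0"
proof -
  have "\<exists>i<n. \<exists>j<nc. A $$ (i, j) \<noteq> 0"
  proof (rule ccontr)
    assume neg: "\<not> ?thesis"
    have "A = 0\<^sub>m n nc"
    proof (rule eq_matI)
      fix i j assume "i < dim_row (0\<^sub>m n nc)" "j < dim_col (0\<^sub>m n nc)"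
      then have ij: "i < n" "j < nc" by simp_all
      then have "A $$ (i, j) = 0" using neg by blast
      then show "A $$ (i, j) = 0\<^sub>m n nc $$ (i, j)" unfolding index_zero_mat(1)[OF ij] .
    next
      show "dim_row A = dim_row (0\<^sub>m n nc)" "dim_col A = dim_col (0\<^sub>m n nc)"
        using carrier_matD[OF A] by (simp_all only: index_zero_mat)
    qed
    with assms(2) show False by contradiction
  qed
  then obtain i j where ij: "i < n" "j < nc" "A $$ (i, j) \<noteq> 0" by blast
  let ?S = "submatrix A {i} {j}"
  note dimA = carrier_matD[OF A]
  have ci: "{k. k < n \<and> k \<in> {i}} = {i}" and cj: "{k. k < nc \<and> k \<in> {j}} = {j}"
    using ij by blast+
  have "?S \<in> carrier_mat 1 1"
    by (rule carrier_matI) (simp_all only: dim_submatrix dimA ci cj card.insert finite.emptyI card.empty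
      empty_iff not_False_eq_True One_nat_def)
  then have "det ?S = ?S $$ (0, 0)" by (rule det_single)
  also have "\<dots> = A $$ (i, j)"
  proof -
    have e: "{a \<in> {k}. a < k} = {}" for k :: nat by blast
    show ?thesis
      using submatrix_index_card[of i A j "{i}" "{j}", unfolded dimA e card.empty, OF ij(1,2) singletonI singletonI] .
  qed
  finally have "det ?S \<noteq> 0" using ij(3) by simp
  from vec_space.rank_gt_minor[OF A this] have "card {j} \<le> vec_space.rank n A" unfolding cj .
  then show ?thesis by simp
qed

lemma nichols_dim_infinite:
  assumes "\<And>K. \<exists>m\<ge>K. qsym D cf m \<noteq> 0\<^sub>m (D ^ m) (D ^ m)"
  shows "nichols_dim D cf = \<infinity>"
proof -
  let ?s = "\<lambda>N. \<Sum>m<N. enat (vec_space.rank (D ^ m) (qsym D cf m))"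
  have "\<exists>N. enat k \<le> ?s N" for k
  proof (induction k)
    case 0
    show ?case by (simp add: zero_enat_def[symmetric])
  next
    case (Suc k)
    then obtain N where N: "enat k \<le> ?s N" by blast
    obtain m where m: "m \<ge> N" "qsym D cf m \<noteq> 0\<^sub>m (D ^ m) (D ^ m)" using assms by blast
    have "?s N \<le> ?s m" by (rule sum_mono2) (use m in auto)
    moreover have "enat 1 \<le> enat (vec_space.rank (D ^ m) (qsym D cf m))"
      using rank_nonzero[OF qsym_carrier m(2)] by (simp add: Suc_le_eq)
    ultimately have "enat k + enat 1 \<le> ?s m + enat (vec_space.rank (D ^ m) (qsym D cf m))"
      by (intro add_mono order_trans[OF N])
    then show ?case by (intro exI[of _ "Suc m"]) simp
  qed
  note ex = this
  have le: "enat k \<le> nichols_dim D cf" for k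
  proof -
    obtain N where "enat k \<le> ?s N" using ex[of k] by (elim exE)
    also have "?s N \<le> nichols_dim D cf"
      unfolding nichols_dim_def by (rule SUP_upper) simp
    finally show ?thesis .
  qed
  show ?thesis
  proof (cases "nichols_dim D cf")
    case (enat k)
    then show ?thesis using le[of "Suc k"] by simp
  qed
qed

section \<open>The centralizer of the standard involution\<close>

lemma foldr_comp_append: "foldr (\<circ>) (xs @ ys) id = foldr (\<circ>) xs id \<circ> foldr (\<circ>) ys id"
  by (induction xs) (auto simp: comp_assoc)

lemma pi_std_Suc: "pi_std (Suc n) = pi_std n \<circ> Atr (Suc n)"
proof -
  have "[1..<Suc n + 1] = [1..<n + 1] @ [Suc n]" by simp
  then show ?thesis unfolding pi_std_def by (simp only: map_append foldr_comp_append) simp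
qed

lemma Atr_apply: "i \<ge> 1 \<Longrightarrow> Atr i x = (if x = 2 * i - 1 then 2 * i else if x = 2 * i then 2 * i - 1 else x)"
  by (simp add: Atr_def transpose_def)

lemma pi_std_apply:
  "pi_std n x = (if 1 \<le> x \<and> x \<le> 2 * n then if odd x then x + 1 else x - 1 else x)"
proof (induction n arbitrary: x)
  case 0
  then show ?case by (simp add: pi_std_def)
next
  case (Suc n)
  consider "x = 2 * n + 1" | "x = 2 * n + 2" | "x \<noteq> 2 * n + 1" "x \<noteq> 2 * n + 2" by blast
  then show ?case
    by cases (auto simp: pi_std_Suc Atr_apply Suc)
qed

lemma pi_std_odd: "1 \<le> i \<Longrightarrow> i \<le> n \<Longrightarrow> pi_std n (2 * i - 1) = 2 * i"
  by (cases i) (auto simp: pi_std_apply)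

lemma pi_std_even: "1 \<le> i \<Longrightarrow> i \<le> n \<Longrightarrow> pi_std n (2 * i) = 2 * i - 1"
  by (cases i) (auto simp: pi_std_apply)

lemma Atr_permutes: "1 \<le> i \<Longrightarrow> i \<le> n \<Longrightarrow> Atr i permutes {1..2 * n}"
  unfolding Atr_def by (rule permutes_swap_id) auto

lemma Btr_permutes: "1 \<le> j \<Longrightarrow> j < n \<Longrightarrow> Btr j permutes {1..2 * n}"
  unfolding Btr_def by (intro permutes_compose permutes_swap_id) auto

lemma pi_std_permutes: "pi_std n permutes {1..2 * n}"
proof (induction n)
  case 0
  then show ?case by (simp add: pi_std_def permutes_id id_def[symmetric])
next
  case (Suc n)
  have "pi_std n permutes {1..2 * Suc n}" by (rule permutes_subset[OF Suc]) auto
  moreover have "Atr (Suc n) permutes {1..2 * Suc n}" by (rule Atr_permutes) auto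
  ultimately show ?case unfolding pi_std_Suc by (intro permutes_compose)
qed

lemma pi_std_involution: "pi_std n \<circ> pi_std n = id"
  by (rule ext, auto simp: pi_std_apply elim!: oddE, presburger)

lemma centralizer_comp: "g \<in> centralizer n s \<Longrightarrow> h \<in> centralizer n s \<Longrightarrow> g \<circ> h \<in> centralizer n s"
  unfolding centralizer_def by (auto intro: permutes_compose) (metis comp_assoc)

lemma centralizer_id: "id \<in> centralizer n s"
  by (simp add: centralizer_def permutes_id)

lemma centralizer_inv:
  assumes "g \<in> centralizer n s"
  shows "inv_into UNIV g \<in> centralizer n s"
proof -
  have p: "g permutes {1..2 * n}" and c: "g \<circ> s = s \<circ> g" using assms by (auto simp: centralizer_def)
  note i = permutes_inv_o[OF p]
  have "inv_into UNIV g \<circ> s = inv_into UNIV g \<circ> s \<circ> (g \<circ> inv_into UNIV g)" using i by simp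
  also have "\<dots> = inv_into UNIV g \<circ> (s \<circ> g) \<circ> inv_into UNIV g" by (simp add: comp_assoc)
  also have "\<dots> = (inv_into UNIV g \<circ> g) \<circ> s \<circ> inv_into UNIV g" unfolding c[symmetric] by (simp add: comp_assoc)
  finally show ?thesis using i permutes_inv[OF p] by (simp add: centralizer_def)
qed

lemma pi_std_centralizer: "pi_std n \<in> centralizer n (pi_std n)"
  using pi_std_permutes[of n] by (simp add: centralizer_def)

lemma Atr_centralizer:
  assumes "1 \<le> i" "i \<le> n"
  shows "Atr i \<in> centralizer n (pi_std n)"
proof -
  have "Atr i (pi_std n x) = pi_std n (Atr i x)" for x
  proof -
    consider "x = 2 * i - 1" | "x = 2 * i" | "x \<noteq> 2 * i - 1" "x \<noteq> 2 * i" by blast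
    then show ?thesis
    proof cases
      case 3
      have "pi_std n (pi_std n x) = x" using pi_std_involution by (metis comp_apply id_apply)
      then have "pi_std n x \<noteq> 2 * i - 1" "pi_std n x \<noteq> 2 * i"
        using 3 pi_std_odd[OF assms] pi_std_even[OF assms] by metis+
      then show ?thesis using 3 assms by (simp add: Atr_apply)
    qed (use assms pi_std_odd[OF assms] pi_std_even[OF assms] in \<open>auto simp: Atr_apply\<close>)
  qed
  then show ?thesis using Atr_permutes[OF assms] by (auto simp: centralizer_def)
qed

lemma Btr_apply: "Btr (Suc m) x = (if x = 2 * m + 1 then 2 * m + 3 else if x = 2 * m + 3 then 2 * m + 1
    else if x = 2 * m + 2 then 2 * m + 4 else if x = 2 * m + 4 then 2 * m + 2 else x)"
  by (auto simp: Btr_def transpose_def)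

lemma Atr_apply_Suc: "Atr (Suc m) x = (if x = 2 * m + 1 then 2 * m + 2 else if x = 2 * m + 2 then 2 * m + 1 else x)"
  by (simp add: Atr_apply)

lemma pi_std_block:
  assumes "Suc m < n"
  shows "pi_std n (2 * m + 1) = 2 * m + 2" "pi_std n (2 * m + 2) = 2 * m + 1"
    "pi_std n (2 * m + 3) = 2 * m + 4" "pi_std n (2 * m + 4) = 2 * m + 3"
  using assms by (auto simp: pi_std_apply)

lemma pi_std_outside:
  assumes "Suc m < n" "x \<notin> {2 * m + 1, 2 * m + 2, 2 * m + 3, 2 * m + 4}"
  shows "pi_std n x \<notin> {2 * m + 1, 2 * m + 2, 2 * m + 3, 2 * m + 4}"
proof
  assume a: "pi_std n x \<in> {2 * m + 1, 2 * m + 2, 2 * m + 3, 2 * m + 4}"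
  have "pi_std n (pi_std n x) = x" using pi_std_involution by (metis comp_apply id_apply)
  then show False using a assms(2) pi_std_block[OF assms(1)] by auto
qed

lemma Btr_centralizer:
  assumes "1 \<le> j" "j < n"
  shows "Btr j \<in> centralizer n (pi_std n)"
proof -
  obtain m where j: "j = Suc m" using assms by (cases j) auto
  have m: "Suc m < n" using assms j by simp
  have "Btr j (pi_std n x) = pi_std n (Btr j x)" for x
  proof (cases "x \<in> {2 * m + 1, 2 * m + 2, 2 * m + 3, 2 * m + 4}")
    case True
    then show ?thesis using pi_std_block[OF m] unfolding j by (auto simp: Btr_apply)
  next
    case False
    then show ?thesis using pi_std_outside[OF m False] unfolding j by (simp add: Btr_apply)
  qed
  then show ?thesis using Btr_permutes[OF assms] by (auto simp: centralizer_def)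
qed

lemma Atr_involution: "Atr i \<circ> Atr i = id"
  by (simp add: Atr_def)

lemma Btr_involution: "1 \<le> j \<Longrightarrow> Btr j \<circ> Btr j = id"
  by (cases j) (auto simp: Btr_apply fun_eq_iff)

text \<open>Generation by the \<open>Atr i\<close> and \<open>Btr j\<close>: move the block of the largest non-fixed point back
  into place, one neighbour at a time.\<close>

lemma centralizer_induct [consumes 1, case_names id Atr Btr]:
  assumes "g \<in> centralizer n (pi_std n)"
    and "P id"
    and A: "\<And>i g. 1 \<le> i \<Longrightarrow> i \<le> n \<Longrightarrow> g \<in> centralizer n (pi_std n) \<Longrightarrow> P g \<Longrightarrow> P (Atr i \<circ> g)"
    and B: "\<And>j g. 1 \<le> j \<Longrightarrow> j < n \<Longrightarrow> g \<in> centralizer n (pi_std n) \<Longrightarrow> P g \<Longrightarrow> P (Btr j \<circ> g)"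
  shows "P g"
proof -
  let ?C = "centralizer n (pi_std n)"
  have "P g" if "g \<in> ?C" "k \<le> n" "\<And>x. x > 2 * k \<Longrightarrow> g x = x" for g k
    using that
  proof (induction k arbitrary: g)
    case 0
    have "g 0 = 0" using 0(1) by (auto simp: centralizer_def permutes_def)
    then have "g = id" using 0(3) by (metis eq_id_iff gr0I mult_0_right)
    show ?case unfolding \<open>g = id\<close> by (rule assms(2))
  next
    case (Suc k)
    \<comment> \<open>Counting blocks from 0, \<open>l\<close> is the block of the image of
      \<open>2 * k + 2\<close>, and \<open>e\<close> its distance to block \<open>k\<close>, which
      one \<open>Btr\<close> lowers by 1.\<close>
    have "P h" if "h \<in> ?C" "\<And>x. x > 2 * Suc k \<Longrightarrow> h x = x"
      "h (2 * k + 2) = 2 * l + 1 \<or> h (2 * k + 2) = 2 * l + 2" "l + e = k" for h l e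
      using that
    proof (induction e arbitrary: h l)
      case 0
      have comm: "h (pi_std n x) = pi_std n (h x)" for x
        using 0(1) by (auto simp: centralizer_def fun_eq_iff)
      have k: "Suc k \<le> n" using Suc.prems by simp
      have settled: "P f" if "f \<in> ?C" "f (2 * k + 2) = 2 * k + 2" "\<And>x. x > 2 * Suc k \<Longrightarrow> f x = x" for f
      proof -
        have "f (pi_std n (2 * k + 2)) = pi_std n (f (2 * k + 2))"
          using that(1) by (auto simp: centralizer_def fun_eq_iff)
        then have "f (2 * k + 1) = 2 * k + 1"
          using that(2) k pi_std_even[of "Suc k" n] by simp
        then have "f x = x" if "x > 2 * k" for x
        proof -
          have "x = 2 * k + 1 \<or> x = 2 * k + 2 \<or> x > 2 * Suc k" using that by auto
          then show ?thesis using \<open>f (2 * k + 1) = _\<close> \<open>f (2 * k + 2) = _\<close> \<open>\<And>x. x > 2 * Suc k \<Longrightarrow> f x = x\<close> by blast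
        qed
        then show ?thesis using Suc.IH[of f] that(1) k by simp
      qed
      from 0(3,4) consider "h (2 * k + 2) = 2 * k + 1" | "h (2 * k + 2) = 2 * k + 2" by auto
      then show ?case
      proof cases
        case 1
        have "P (Atr (Suc k) \<circ> h)"
          by (rule settled)
            (use 1 0 k in \<open>auto simp: Atr_apply_Suc intro!: centralizer_comp Atr_centralizer\<close>)
        note PA = this
        have "P (Atr (Suc k) \<circ> (Atr (Suc k) \<circ> h))"
          by (rule A[OF _ k centralizer_comp[OF Atr_centralizer 0(1)] PA]) (use k in simp_all)
        then show ?thesis by (simp add: Atr_involution flip: comp_assoc)
      next
        case 2
        then show ?thesis using settled 0 by blast
      qed
    next
      case (Suc e)
      have l: "Suc l < n" using Suc.prems \<open>Suc k \<le> n\<close> by simp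
      have "P (Btr (Suc l) \<circ> h)"
      proof (rule Suc.IH[of _ "Suc l"])
        show "Btr (Suc l) \<circ> h \<in> ?C"
          using Suc.prems l by (auto intro!: centralizer_comp Btr_centralizer)
        show "(Btr (Suc l) \<circ> h) x = x" if "x > 2 * Suc k" for x
          using Suc.prems that by (auto simp: Btr_apply)
        show "(Btr (Suc l) \<circ> h) (2 * k + 2) = 2 * Suc l + 1 \<or> (Btr (Suc l) \<circ> h) (2 * k + 2) = 2 * Suc l + 2"
          using Suc.prems(3) by (auto simp: Btr_apply)
        show "Suc l + e = k" using Suc.prems by simp
      qed
      note PB = this
      have "P (Btr (Suc l) \<circ> (Btr (Suc l) \<circ> h))"
        by (rule B[OF _ l centralizer_comp[OF Btr_centralizer Suc.prems(1)] PB]) (use l in simp_all)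
      then show ?case by (simp add: Btr_involution flip: comp_assoc)
    qed
    note inner = this
    have p: "g permutes {1..2 * n}" using Suc.prems by (simp add: centralizer_def)
    let ?y = "g (2 * k + 2)"
    have "?y \<in> {1..2 * n}" using permutes_in_image[OF p, of "2 * k + 2"] Suc.prems(2) by simp
    moreover have "?y \<le> 2 * k + 2"
    proof (rule ccontr)
      assume neg: "\<not> ?thesis"
      then have "?y > 2 * Suc k" by simp
      then have "g ?y = ?y" using Suc.prems(3) by blast
      then have "?y = 2 * k + 2" using permutes_inj[OF p] by (auto dest: injD)
      then show False using neg by simp
    qed
    ultimately have y: "1 \<le> ?y" "?y \<le> 2 * k + 2" by auto
    define l where "l = (?y - 1) div 2"
    have "?y = 2 * l + 1 \<or> ?y = 2 * l + 2" "l \<le> k" using y unfolding l_def by auto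
    then show ?case using inner[of g l "k - l"] Suc.prems by auto
  qed
  moreover have "g x = x" if "x > 2 * n" for x
    using assms(1) that by (auto simp: centralizer_def permutes_def)
  ultimately show ?thesis using assms(1) by blast
qed

section \<open>Three commuting conjugates\<close>

text \<open>With the points of the blocks \<open>j\<close> and \<open>j + 1\<close> called 1, 2, 3,
  4, these are (1 2)(3 4), (1 3)(2 4) and (1 4)(2 3), the nontrivial elements of the Klein
  four-group; elsewhere they agree with \<open>pi_std n\<close>. Written in the generators so that
  \<rho> can be evaluated on them.\<close>

definition conj_inv :: "nat \<Rightarrow> nat \<Rightarrow> nat \<Rightarrow> nat \<Rightarrow> nat" where
  "conj_inv n j k = (if k = 0 then pi_std n
     else if k = 1 then Btr j \<circ> (Atr j \<circ> Atr (Suc j)) \<circ> pi_std n else Btr j \<circ> pi_std n)"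

text \<open>The cycle (2 3 4) of these points, which permutes the three involutions cyclically by
  conjugation.\<close>

definition cycle3 :: "nat \<Rightarrow> nat \<Rightarrow> nat" where
  "cycle3 j = transpose (2 * j) (2 * j + 1) \<circ> transpose (2 * j + 1) (2 * j + 2)"

lemma cycle3_apply: "cycle3 (Suc m) x = (if x = 2 * m + 2 then 2 * m + 3 else if x = 2 * m + 3 then 2 * m + 4
    else if x = 2 * m + 4 then 2 * m + 2 else x)"
  by (auto simp: cycle3_def transpose_def)

lemma cycle3_permutes: "1 \<le> j \<Longrightarrow> j < n \<Longrightarrow> cycle3 j permutes {1..2 * n}"
  unfolding cycle3_def by (intro permutes_compose permutes_swap_id) auto

lemma conj_inv_apply:
  assumes "Suc m < n" "k \<in> {0, 1, 2}"
  shows "conj_inv n (Suc m) k (2 * m + 1) = 2 * m + 2 + k"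
    "x \<notin> {2 * m + 1, 2 * m + 2, 2 * m + 3, 2 * m + 4} \<Longrightarrow> conj_inv n (Suc m) k x = pi_std n x"
proof -
  show "conj_inv n (Suc m) k (2 * m + 1) = 2 * m + 2 + k"
    using assms(2) pi_std_block[OF assms(1)] by (auto simp: conj_inv_def Btr_apply Atr_apply_Suc)
  show "conj_inv n (Suc m) k x = pi_std n x" if x: "x \<notin> {2 * m + 1, 2 * m + 2, 2 * m + 3, 2 * m + 4}"
    using pi_std_outside[OF assms(1) x] by (simp add: conj_inv_def Btr_apply Atr_apply_Suc)
qed

lemma conj_inv_cycle3:
  assumes "1 \<le> j" "j < n" "k \<in> {0, 1, 2}"
  shows "conj_inv n j (Suc k mod 3) \<circ> cycle3 j = cycle3 j \<circ> conj_inv n j k"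
proof
  fix x
  obtain m where j: "j = Suc m" using assms by (cases j) auto
  have m: "Suc m < n" using assms j by simp
  show "(conj_inv n j (Suc k mod 3) \<circ> cycle3 j) x = (cycle3 j \<circ> conj_inv n j k) x"
  proof (cases "x \<in> {2 * m + 1, 2 * m + 2, 2 * m + 3, 2 * m + 4}")
    case True
    then show ?thesis using pi_std_block[OF m] assms(3) unfolding j
      by (elim insertE emptyE) (simp_all add: conj_inv_def Btr_apply Atr_apply_Suc cycle3_apply)
  next
    case False
    then have "cycle3 j x = x" unfolding j by (simp add: cycle3_apply)
    moreover have "cycle3 j (pi_std n x) = pi_std n x"
      using pi_std_outside[OF m False] unfolding j by (simp add: cycle3_apply)
    moreover have "Suc k mod 3 \<in> {0, 1, 2}" using assms(3) by auto
    ultimately show ?thesis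
      using conj_inv_apply(2)[OF m _ False] assms(3) unfolding j by simp
  qed
qed

lemma conj_inv_cycle3_power:
  assumes "1 \<le> j" "j < n" "k \<in> {0, 1, 2}"
  shows "conj_inv n j ((k + l) mod 3) \<circ> (cycle3 j ^^ l) = (cycle3 j ^^ l) \<circ> conj_inv n j k"
proof (induction l)
  case 0
  have "k mod 3 = k" using assms(3) by auto
  then show ?case by simp
next
  case (Suc l)
  have "(k + l) mod 3 < 3" by simp
  then have "(k + l) mod 3 \<in> {0, 1, 2}" by auto
  from conj_inv_cycle3[OF assms(1,2) this]
  have "conj_inv n j ((k + Suc l) mod 3) \<circ> cycle3 j = cycle3 j \<circ> conj_inv n j ((k + l) mod 3)"
    by (simp add: mod_Suc_eq)
  note e = this
  let ?c = "cycle3 j"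
  have "conj_inv n j ((k + Suc l) mod 3) \<circ> (?c ^^ Suc l)
      = (conj_inv n j ((k + Suc l) mod 3) \<circ> ?c) \<circ> (?c ^^ l)"
    by (simp only: funpow.simps comp_assoc)
  also have "\<dots> = ?c \<circ> (conj_inv n j ((k + l) mod 3) \<circ> (?c ^^ l))"
    unfolding e by (simp only: comp_assoc)
  also have "\<dots> = (?c ^^ Suc l) \<circ> conj_inv n j k"
    unfolding Suc by (simp only: funpow.simps comp_assoc)
  finally show ?case .
qed

lemma conj_inv_inj: "1 \<le> j \<Longrightarrow> j < n \<Longrightarrow> inj_on (conj_inv n j) {0, 1, 2}"
proof (rule inj_onI)
  fix k l
  assume a: "1 \<le> j" "j < n" "k \<in> {0, 1, 2}" "l \<in> {0, 1, 2}" "conj_inv n j k = conj_inv n j l"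
  obtain m where j: "j = Suc m" using a by (cases j) auto
  have m: "Suc m < n" using a j by simp
  show "k = l" using conj_inv_apply(1)[OF m a(3)] conj_inv_apply(1)[OF m a(4)] a(5) unfolding j by simp
qed

section \<open>Diagonal braided subspaces of the Yetter-Drinfeld module\<close>

abbreviation pinv :: "(nat \<Rightarrow> nat) \<Rightarrow> nat \<Rightarrow> nat" where "pinv \<equiv> inv_into UNIV"

text \<open>The hypothesis says that \<open>t I\<close> commutes with \<open>t J\<close>. For a
  second candidate \<open>h\<close>, the element \<open>pinv (g h) \<circ> g J\<close> would
  centralize \<open>s\<close>, which forces \<open>t h = t J\<close>.\<close>

lemma yd_h_eq:
  assumes yd: "yd_enum n s M t g" and IJ: "I < M" "J < M"
    and c: "pinv (g J) \<circ> t I \<circ> g J \<in> centralizer n s"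
  shows "yd_h n s M t g I J = J"
  unfolding yd_h_def
proof (rule the_equality)
  show "J < M \<and> pinv (g J) \<circ> t I \<circ> g J \<in> centralizer n s" using IJ c by simp
next
  fix h assume h: "h < M \<and> pinv (g h) \<circ> t I \<circ> g J \<in> centralizer n s"
  have p: "g k permutes {1..2 * n}" and tk: "t k = g k \<circ> s \<circ> pinv (g k)" if "k < M" for k
    using yd that by (auto simp: yd_enum_def)
  note ih = permutes_inv_o[OF p[OF conjunct1[OF h]]] and iJ = permutes_inv_o[OF p[OF IJ(2)]]
  let ?\<gamma> = "pinv (g h) \<circ> t I \<circ> g J" and ?\<delta> = "pinv (g J) \<circ> t I \<circ> g J"
  let ?e = "pinv (g h) \<circ> g J"
  have \<delta>p: "?\<delta> permutes {1..2 * n}" using c unfolding centralizer_def by blast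
  have "?\<gamma> = pinv (g h) \<circ> (g J \<circ> pinv (g J)) \<circ> t I \<circ> g J" unfolding iJ(1) comp_id ..
  also have "\<dots> = ?e \<circ> ?\<delta>" by (simp only: comp_assoc)
  finally have "?\<gamma> \<circ> pinv ?\<delta> = ?e \<circ> (?\<delta> \<circ> pinv ?\<delta>)" by (simp only: comp_assoc)
  then have e: "?e = ?\<gamma> \<circ> pinv ?\<delta>" unfolding permutes_inv_o(1)[OF \<delta>p] comp_id by (rule sym)
  have "?e \<in> centralizer n s"
    unfolding e by (rule centralizer_comp[OF conjunct2[OF h] centralizer_inv[OF c]])
  then have es: "?e \<circ> s = s \<circ> ?e" unfolding centralizer_def by blast
  have gJ: "g h \<circ> ?e = g J" unfolding comp_assoc[symmetric] ih(1) id_comp ..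
  have "g J \<circ> s = (g h \<circ> ?e) \<circ> s" unfolding gJ ..
  also have "\<dots> = g h \<circ> (?e \<circ> s)" by (rule comp_assoc)
  also have "\<dots> = g h \<circ> s \<circ> pinv (g h) \<circ> g J" unfolding es by (simp only: comp_assoc)
  finally have "g J \<circ> s \<circ> pinv (g J) = g h \<circ> s \<circ> pinv (g h) \<circ> (g J \<circ> pinv (g J))" by (simp only: comp_assoc)
  then have "t J = t h" unfolding iJ(1) comp_id tk[OF IJ(2), symmetric] tk[OF conjunct1[OF h], symmetric] .
  moreover have "inj_on t {..<M}" using yd by (auto simp: yd_enum_def bij_betw_def)
  ultimately show "h = J" using IJ(2) h unfolding inj_on_def by (metis lessThan_iff)
qed

text \<open>The coordinates of g_J \<otimes> \<xi>.\<close>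

definition block_vec :: "nat \<Rightarrow> nat \<Rightarrow> complex vec \<Rightarrow> nat \<Rightarrow> complex" where
  "block_vec d J \<xi> a = (if a div d = J then \<xi> $ (a mod d) else 0)"

lemma sum_block_vec:
  assumes "J < M" "d > 0"
  shows "(\<Sum>b<M * d. G b * block_vec d J \<xi> b) = (\<Sum>l<d. G (l + d * J) * \<xi> $ l)"
proof -
  have "(\<Sum>b<M * d. G b * block_vec d J \<xi> b) = (\<Sum>h<M. \<Sum>l<d. G (l + d * h) * block_vec d J \<xi> (l + d * h))"
    by (rule sum_mult_split)
  also have "\<dots> = (\<Sum>h<M. if h = J then (\<Sum>l<d. G (l + d * J) * \<xi> $ l) else 0)"
    using assms(2) by (intro sum.cong refl) (auto simp: block_vec_def)
  also have "\<dots> = (\<Sum>l<d. G (l + d * J) * \<xi> $ l)" using assms(1) by simp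
  finally show ?thesis .
qed

text \<open>For commuting degrees the braiding stays in block \<open>J\<close> and acts there by
  \<rho>(\<gamma>), a scalar on an eigenvector.\<close>

lemma yd_braid_block:
  assumes yd: "yd_enum n s M t g" and IJ: "I < M" "J < M"
    and c: "pinv (g J) \<circ> t I \<circ> g J \<in> centralizer n s"
    and \<rho>: "\<rho> (pinv (g J) \<circ> t I \<circ> g J) \<in> carrier_mat d d" and \<xi>: "\<xi> \<in> carrier_vec d"
    and ev: "\<rho> (pinv (g J) \<circ> t I \<circ> g J) *\<^sub>v \<xi> = k \<cdot>\<^sub>v \<xi>" and uv: "u < M * d" "v < M * d"
  shows "(\<Sum>a<M * d. \<Sum>b<M * d. yd_coeff n s M t g d \<rho> u v a b * block_vec d I \<eta> a * block_vec d J \<xi> b)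
    = k * block_vec d J \<xi> u * block_vec d I \<eta> v"
proof -
  have d: "d > 0" using uv by (cases d) auto
  let ?cf = "yd_coeff n s M t g d \<rho>" and ?m = "pinv (g J) \<circ> t I \<circ> g J"
  have "(\<Sum>a<M * d. \<Sum>b<M * d. ?cf u v a b * block_vec d I \<eta> a * block_vec d J \<xi> b)
     = (\<Sum>a<M * d. if a = v then block_vec d I \<eta> v * (\<Sum>b<M * d. ?cf u v v b * block_vec d J \<xi> b) else 0)"
    by (intro sum.cong refl) (auto simp: yd_coeff_def sum_distrib_left mult.assoc mult.left_commute)
  also have "\<dots> = block_vec d I \<eta> v * (\<Sum>b<M * d. ?cf u v v b * block_vec d J \<xi> b)"
    using uv by simp
  also have "\<dots> = block_vec d I \<eta> v * (k * block_vec d J \<xi> u)"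
  proof (cases "v div d = I")
    case True
    have h: "yd_h n s M t g I J = J" by (rule yd_h_eq[OF yd IJ c])
    have "(\<Sum>b<M * d. ?cf u v v b * block_vec d J \<xi> b) = (\<Sum>l<d. ?cf u v v (l + d * J) * \<xi> $ l)"
      by (rule sum_block_vec[OF IJ(2) d])
    also have "\<dots> = (\<Sum>l<d. (if u div d = J then \<rho> ?m $$ (u mod d, l) else 0) * \<xi> $ l)"
      using d True h by (intro sum.cong refl) (simp add: yd_coeff_def yd_gamma_def)
    also have "\<dots> = (if u div d = J then (\<Sum>l<d. \<rho> ?m $$ (u mod d, l) * \<xi> $ l) else 0)"
      by simp
    also have "(\<Sum>l<d. \<rho> ?m $$ (u mod d, l) * \<xi> $ l) = (\<rho> ?m *\<^sub>v \<xi>) $ (u mod d)"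
      using \<rho> \<xi> d by (auto simp: scalar_prod_def lessThan_atLeast0 intro!: sum.cong)
    also have "\<dots> = k * \<xi> $ (u mod d)" unfolding ev using \<xi> d by simp
    finally show ?thesis by (simp add: block_vec_def)
  qed (simp add: block_vec_def)
  finally show ?thesis by (simp add: mult.assoc mult.left_commute mult.commute)
qed

text \<open>The enumeration comes with arbitrary conjugators \<open>g\<close>, while eigenvalues are
  computed with convenient ones \<open>c\<close>. They differ by an element \<open>z\<close> of the
  centralizer, and g_J \<otimes> \<rho>(z^-1) \<xi> represents the vector c_k \<otimes> \<xi>.
  Duality is a condition inside one block, as different blocks have disjoint coordinates.\<close>

lemma yd_nichols_infinite:
  fixes \<tau> c :: "nat \<Rightarrow> nat \<Rightarrow> nat" and q :: "int \<Rightarrow> int \<Rightarrow> complex"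
  assumes rep: "is_rep (centralizer n s) d \<rho>" and d: "d > 0" and yd: "yd_enum n s M t g"
    and c: "\<And>k. k \<in> K \<Longrightarrow> c k permutes {1..2 * n}"
    and \<tau>: "\<And>k. k \<in> K \<Longrightarrow> c k \<circ> s \<circ> pinv (c k) = \<tau> k" and inj: "inj_on \<tau> K"
    and cen: "\<And>k l. k \<in> K \<Longrightarrow> l \<in> K \<Longrightarrow> pinv (c l) \<circ> \<tau> k \<circ> c l \<in> centralizer n s"
    and blk: "\<And>i. i \<in> I \<Longrightarrow> blk i \<in> K" and \<xi>: "\<And>i. i \<in> I \<Longrightarrow> \<xi> i \<in> carrier_vec d"
    and ev: "\<And>i j. i \<in> I \<Longrightarrow> j \<in> I \<Longrightarrow>
      \<rho> (pinv (c (blk j)) \<circ> \<tau> (blk i) \<circ> c (blk j)) *\<^sub>v \<xi> j = q i j \<cdot>\<^sub>v \<xi> j"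
    and \<phi>: "\<And>i. i \<in> I \<Longrightarrow> \<phi> i \<in> carrier_vec d"
    and dual: "\<And>i j. i \<in> I \<Longrightarrow> j \<in> I \<Longrightarrow> blk i = blk j \<Longrightarrow> \<phi> i \<bullet> \<xi> j = (if i = j then 1 else 0)"
    and q: "\<And>i j. q i j * q i j = 1"
    and inf: "\<And>N. \<exists>u w. set u \<subseteq> I \<and> set w \<subseteq> I \<and> N \<le> length u \<and> wform q u w \<noteq> 0"
  shows "nichols_dim (M * d) (yd_coeff n s M t g d \<rho>) = \<infinity>"
proof -
  let ?C = "centralizer n s"
  have \<rho>c: "\<rho> h \<in> carrier_mat d d" if "h \<in> ?C" for h using rep that by (simp add: is_rep_def)
  have \<rho>m: "\<rho> (h \<circ> h') = \<rho> h * \<rho> h'" if "h \<in> ?C" "h' \<in> ?C" for h h' using rep that by (simp add: is_rep_def)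
  have \<rho>1: "\<rho> id = 1\<^sub>m d" using rep by (simp add: is_rep_def)
  have bij: "bij_betw t {..<M} (conj_class n s)" using yd by (simp add: yd_enum_def)
  have gp: "g J permutes {1..2 * n}" and tJ: "t J = g J \<circ> s \<circ> pinv (g J)" if "J < M" for J
    using yd that by (auto simp: yd_enum_def)
  have "\<exists>J<M. t J = \<tau> k" if "k \<in> K" for k
  proof -
    have "\<tau> k \<in> conj_class n s" unfolding conj_class_def
      by (intro CollectI exI[of _ "c k"] conjI \<tau>[OF that, symmetric] c[OF that])
    then have "\<tau> k \<in> t ` {..<M}" using bij by (simp add: bij_betw_def)
    then show ?thesis by force
  qed
  then obtain J where J: "\<And>k. k \<in> K \<Longrightarrow> J k < M \<and> t (J k) = \<tau> k" by metis
  define z where "z k = pinv (c k) \<circ> g (J k)" for k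
  have z: "z k \<in> ?C" and gz: "g (J k) = c k \<circ> z k" if "k \<in> K" for k
  proof -
    note pc = permutes_inv_o[OF c[OF that]] and Jk = conjunct1[OF J[OF that]]
    note pg = permutes_inv_o[OF gp[OF Jk]]
    have "c k \<circ> s \<circ> pinv (c k) = g (J k) \<circ> s \<circ> pinv (g (J k))"
      unfolding \<tau>[OF that] tJ[OF Jk, symmetric] using J[OF that] by simp
    then have "pinv (c k) \<circ> (c k \<circ> s \<circ> pinv (c k)) \<circ> g (J k)
        = pinv (c k) \<circ> (g (J k) \<circ> s \<circ> pinv (g (J k))) \<circ> g (J k)" by simp
    then have "(pinv (c k) \<circ> c k) \<circ> s \<circ> z k = z k \<circ> s \<circ> (pinv (g (J k)) \<circ> g (J k))"
      unfolding z_def by (simp only: comp_assoc)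
    then have "s \<circ> z k = z k \<circ> s" unfolding pc pg by simp
    moreover have "z k permutes {1..2 * n}" unfolding z_def
      by (rule permutes_compose[OF gp[OF Jk] permutes_inv[OF c[OF that]]])
    ultimately show "z k \<in> ?C" by (simp add: centralizer_def)
    show "g (J k) = c k \<circ> z k" unfolding z_def comp_assoc[symmetric] pc by simp
  qed
  have pinv_comp: "pinv (c k \<circ> z k) = pinv (z k) \<circ> pinv (c k)" if "k \<in> K" for k
    using permutes_bij[OF c[OF that]] z[OF that]
    by (intro o_inv_distrib) (auto simp: centralizer_def dest: permutes_bij)
  have zi: "pinv (z k) \<circ> z k = id" "z k \<circ> pinv (z k) = id" if "k \<in> K" for k
    using z[OF that] by (auto simp: centralizer_def dest: permutes_inv_o)
  have zc: "pinv (z k) \<in> ?C" if "k \<in> K" for k using centralizer_inv[OF z[OF that]] .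
  have conj: "pinv (g (J l)) \<circ> t (J k) \<circ> g (J l) = pinv (z l) \<circ> (pinv (c l) \<circ> \<tau> k \<circ> c l) \<circ> z l"
    if "k \<in> K" "l \<in> K" for k l
    unfolding gz[OF that(2)] pinv_comp[OF that(2)] using J[OF that(1)] by (simp only: comp_assoc)
  have conjC: "pinv (g (J l)) \<circ> t (J k) \<circ> g (J l) \<in> ?C" if "k \<in> K" "l \<in> K" for k l
    unfolding conj[OF that] by (intro centralizer_comp zc z cen that)
  define \<zeta> where "\<zeta> i = \<rho> (pinv (z (blk i))) *\<^sub>v \<xi> i" for i
  have \<zeta>c: "\<zeta> i \<in> carrier_vec d" if "i \<in> I" for i
    unfolding \<zeta>_def using \<rho>c[OF zc[OF blk[OF that]]] \<xi>[OF that] by simp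
  have z\<zeta>: "\<rho> (z (blk i)) *\<^sub>v \<zeta> i = \<xi> i" if "i \<in> I" for i
  proof -
    let ?k = "blk i"
    have k: "?k \<in> K" using blk that .
    have "\<rho> (z ?k) *\<^sub>v \<zeta> i = (\<rho> (z ?k) * \<rho> (pinv (z ?k))) *\<^sub>v \<xi> i"
      unfolding \<zeta>_def by (rule assoc_mult_mat_vec[symmetric, OF \<rho>c[OF z[OF k]] \<rho>c[OF zc[OF k]] \<xi>[OF that]])
    also have "\<dots> = \<xi> i" unfolding \<rho>m[OF z[OF k] zc[OF k], symmetric] zi[OF k] \<rho>1 using \<xi>[OF that] by simp
    finally show ?thesis .
  qed
  have \<zeta>ev: "\<rho> (pinv (g (J (blk j))) \<circ> t (J (blk i)) \<circ> g (J (blk j))) *\<^sub>v \<zeta> j = q i j \<cdot>\<^sub>v \<zeta> j"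
    if "i \<in> I" "j \<in> I" for i j
  proof -
    let ?k = "blk i" and ?l = "blk j"
    have k: "?k \<in> K" and l: "?l \<in> K" using blk that by auto
    let ?m = "pinv (c ?l) \<circ> \<tau> ?k \<circ> c ?l"
    have m: "?m \<in> ?C" using cen k l .
    note C = \<rho>c[OF zc[OF l]] \<rho>c[OF m] \<rho>c[OF z[OF l]]
    have "\<rho> (pinv (z ?l) \<circ> ?m \<circ> z ?l) = \<rho> (pinv (z ?l)) * \<rho> ?m * \<rho> (z ?l)"
      by (simp only: \<rho>m centralizer_comp zc m z l)
    then have "\<rho> (pinv (z ?l) \<circ> ?m \<circ> z ?l) *\<^sub>v \<zeta> j = \<rho> (pinv (z ?l)) *\<^sub>v (\<rho> ?m *\<^sub>v (\<rho> (z ?l) *\<^sub>v \<zeta> j))"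
      by (simp only: assoc_mult_mat_vec[OF mult_carrier_mat[OF C(1,2)] C(3) \<zeta>c[OF that(2)]]
          assoc_mult_mat_vec[OF C(1,2) mult_mat_vec_carrier[OF C(3) \<zeta>c[OF that(2)]]])
    also have "\<dots> = \<rho> (pinv (z ?l)) *\<^sub>v (q i j \<cdot>\<^sub>v \<xi> j)" unfolding z\<zeta>[OF that(2)] ev[OF that] ..
    also have "\<dots> = q i j \<cdot>\<^sub>v \<zeta> j" unfolding \<zeta>_def by (rule mult_mat_vec[OF C(1) \<xi>[OF that(2)]])
    finally show ?thesis unfolding conj[OF k l] .
  qed
  \<comment> \<open>The functional \<phi> composed with \<rho>(z), so that its value at \<zeta> is
    that of \<phi> at \<xi>.\<close>
  define f where "f i a = (if a div d = J (blk i)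
      then (\<Sum>e<d. \<phi> i $ e * \<rho> (z (blk i)) $$ (e, a mod d)) else 0)" for i a
  have Jinj: "J k = J l \<longleftrightarrow> k = l" if "k \<in> K" "l \<in> K" for k l
    using J[OF that(1)] J[OF that(2)] inj_onD[OF inj _ that] by metis
  interpret diagonal_part "M * d" "yd_coeff n s M t g d \<rho>" q I "\<lambda>i. block_vec d (J (blk i)) (\<zeta> i)" f
  proof
    fix i j u v assume ij: "i \<in> I" "j \<in> I" and uv: "u < M * d" "v < M * d"
    have k: "blk i \<in> K" "blk j \<in> K" using blk ij by auto
    show "(\<Sum>a<M * d. \<Sum>b<M * d. yd_coeff n s M t g d \<rho> u v a b
        * block_vec d (J (blk i)) (\<zeta> i) a * block_vec d (J (blk j)) (\<zeta> j) b)
      = q i j * block_vec d (J (blk j)) (\<zeta> j) u * block_vec d (J (blk i)) (\<zeta> i) v"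
      by (rule yd_braid_block[where \<rho> = \<rho>, OF yd conjunct1[OF J[OF k(1)]] conjunct1[OF J[OF k(2)]] conjC[OF k]
            \<rho>c[OF conjC[OF k]] \<zeta>c[OF ij(2)] \<zeta>ev[OF ij] uv])
  next
    fix i j assume ij: "i \<in> I" "j \<in> I"
    have k: "blk i \<in> K" "blk j \<in> K" using blk ij by auto
    let ?k = "blk j"
    have "(\<Sum>a<M * d. f i a * block_vec d (J ?k) (\<zeta> j) a) = (\<Sum>l<d. f i (l + d * J ?k) * \<zeta> j $ l)"
      by (rule sum_block_vec) (use J[OF k(2)] d in auto)
    also have "\<dots> = (if blk i = ?k then \<phi> i \<bullet> \<xi> j else 0)"
    proof (cases "blk i = ?k")
      case True
      have "(\<Sum>l<d. f i (l + d * J ?k) * \<zeta> j $ l)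
          = (\<Sum>l<d. \<Sum>e<d. \<phi> i $ e * (\<rho> (z ?k) $$ (e, l) * \<zeta> j $ l))"
        using d True by (intro sum.cong refl) (simp add: f_def sum_distrib_right mult.assoc)
      also have "\<dots> = (\<Sum>e<d. \<phi> i $ e * (\<Sum>l<d. \<rho> (z ?k) $$ (e, l) * \<zeta> j $ l))"
        unfolding sum_distrib_left by (rule sum.swap)
      also have "\<dots> = (\<Sum>e<d. \<phi> i $ e * (\<rho> (z ?k) *\<^sub>v \<zeta> j) $ e)"
        using \<rho>c[OF z[OF k(2)]] \<zeta>c[OF ij(2)]
        by (intro sum.cong refl) (auto simp: scalar_prod_def lessThan_atLeast0 intro!: sum.cong)
      also have "\<dots> = \<phi> i \<bullet> \<xi> j"
        unfolding z\<zeta>[OF ij(2)] using \<xi>[OF ij(2)] by (simp add: scalar_prod_def lessThan_atLeast0)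
      finally show ?thesis using True by simp
    next
      case False
      then have ne: "J ?k \<noteq> J (blk i)" using Jinj[OF k(2,1)] by auto
      have "f i (l + d * J ?k) = 0" if "l < d" for l using that ne by (simp add: f_def)
      then have "(\<Sum>l<d. f i (l + d * J ?k) * \<zeta> j $ l) = 0" by simp
      then show ?thesis using False by simp
    qed
    also have "\<dots> = (if i = j then 1 else 0)" using dual[OF ij] by auto
    finally show "(\<Sum>a<M * d. f i a * block_vec d (J ?k) (\<zeta> j) a) = (if i = j then 1 else 0)" .
  qed (rule q)
  show ?thesis
  proof (rule nichols_dim_infinite)
    fix N
    obtain u w where uw: "set u \<subseteq> I" "set w \<subseteq> I" "N \<le> length u" "wform q u w \<noteq> 0" using inf by blast
    have "length w = length u" using wform_mset[OF uw(4)] by (rule mset_eq_length)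
    then show "\<exists>m\<ge>N. qsym (M * d) (yd_coeff n s M t g d \<rho>) m \<noteq> 0\<^sub>m ((M * d) ^ m) ((M * d) ^ m)"
      using qsym_nonzero[OF uw(1,2) _ uw(4)] uw(3) by blast
  qed
qed

section \<open>Irreducible representations of the centralizer\<close>

locale centralizer_irrep =
  fixes n d :: nat and \<rho> :: "(nat \<Rightarrow> nat) \<Rightarrow> complex mat"
  assumes irred: "irred_rep (centralizer n (pi_std n)) d \<rho>"
begin

abbreviation "C \<equiv> centralizer n (pi_std n)"

definition act :: "(nat \<Rightarrow> nat) \<Rightarrow> complex vec \<Rightarrow> complex vec" where
  "act g v = \<rho> g *\<^sub>v v"

lemma rep: "is_rep C d \<rho>" and d_pos: "d > 0"
  and irr: "\<And>W. invariant_subspace C d \<rho> W \<Longrightarrow> W = {0\<^sub>v d} \<or> W = carrier_vec d"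
  using irred by (auto simp: irred_rep_def)

lemma rho_carrier: "g \<in> C \<Longrightarrow> \<rho> g \<in> carrier_mat d d"
  using rep by (simp add: is_rep_def)

lemma act_carrier: "g \<in> C \<Longrightarrow> v \<in> carrier_vec d \<Longrightarrow> act g v \<in> carrier_vec d"
  unfolding act_def by (rule mult_mat_vec_carrier[OF rho_carrier])

lemma act_comp: "g \<in> C \<Longrightarrow> h \<in> C \<Longrightarrow> v \<in> carrier_vec d \<Longrightarrow> act (g \<circ> h) v = act g (act h v)"
  unfolding act_def using rep assoc_mult_mat_vec[OF rho_carrier rho_carrier] by (simp add: is_rep_def)

lemma act_id: "v \<in> carrier_vec d \<Longrightarrow> act id v = v"
  using rep by (simp add: act_def is_rep_def)

lemma act_add: "g \<in> C \<Longrightarrow> v \<in> carrier_vec d \<Longrightarrow> w \<in> carrier_vec d \<Longrightarrow> act g (v + w) = act g v + act g w"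
  unfolding act_def by (rule mult_add_distrib_mat_vec[OF rho_carrier])

lemma act_smult: "g \<in> C \<Longrightarrow> v \<in> carrier_vec d \<Longrightarrow> act g (k \<cdot>\<^sub>v v) = k \<cdot>\<^sub>v act g v"
  unfolding act_def by (rule mult_mat_vec[OF rho_carrier])

lemma act_involution:
  assumes "z \<in> C" "z \<circ> z = id" "v \<in> carrier_vec d"
  shows "act z (act z v) = v"
  using act_comp[OF assms(1,1,3)] assms(2,3) act_id by simp

text \<open>The vector \<open>act z v + e v\<close> is, up to a scalar, the projection of
  \<open>v\<close> to the eigenspace of \<open>e\<close>. The last clause serves to diagonalise
  commuting involutions one after the other.\<close>

lemma eigenvector:
  assumes "z \<in> C" "z \<circ> z = id" "v \<in> carrier_vec d" "e * e = 1" "act z v \<noteq> - e \<cdot>\<^sub>v v"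
  obtains w where "w \<in> carrier_vec d" "w \<noteq> 0\<^sub>v d" "act z w = e \<cdot>\<^sub>v w"
    "\<And>h f. h \<in> C \<Longrightarrow> h \<circ> z = z \<circ> h \<Longrightarrow> act h v = f \<cdot>\<^sub>v v \<Longrightarrow> act h w = f \<cdot>\<^sub>v w"
proof -
  let ?w = "act z v + e \<cdot>\<^sub>v v"
  have c: "act z v \<in> carrier_vec d" "e \<cdot>\<^sub>v v \<in> carrier_vec d" using assms act_carrier by auto
  have "act z ?w = v + e \<cdot>\<^sub>v act z v"
    using act_add[OF assms(1) c] act_involution[OF assms(1-3)] act_smult[OF assms(1,3)] by simp
  also have "\<dots> = e \<cdot>\<^sub>v ?w"
    using c assms(3,4)
    by (intro eq_vecI) (auto simp: distrib_left mult.assoc[symmetric])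
  finally have "act z ?w = e \<cdot>\<^sub>v ?w" .
  moreover have "?w \<noteq> 0\<^sub>v d"
  proof
    assume z: "?w = 0\<^sub>v d"
    have "act z v = - e \<cdot>\<^sub>v v"
    proof (rule eq_vecI)
      fix i assume "i < dim_vec (- e \<cdot>\<^sub>v v)"
      then have i: "i < d" using assms(3) by simp
      have "?w $ i = 0" unfolding z using i by simp
      then have "act z v $ i + e * v $ i = 0" using i c assms(3) by simp
      then show "act z v $ i = (- e \<cdot>\<^sub>v v) $ i" using i assms(3) by (simp add: add_eq_0_iff2)
    qed (use c assms(3) in auto)
    then show False using assms(5) by simp
  qed
  moreover have "?w \<in> carrier_vec d" using c by simp
  moreover have "act h ?w = f \<cdot>\<^sub>v ?w" if h: "h \<in> C" "h \<circ> z = z \<circ> h" "act h v = f \<cdot>\<^sub>v v" for h f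
  proof -
    have "act h (act z v) = act z (act h v)"
      using act_comp[OF h(1) assms(1,3)] act_comp[OF assms(1) h(1) assms(3)] h(2) by simp
    also have "\<dots> = f \<cdot>\<^sub>v act z v" unfolding h(3) by (rule act_smult[OF assms(1,3)])
    finally have "act h ?w = f \<cdot>\<^sub>v act z v + e \<cdot>\<^sub>v (f \<cdot>\<^sub>v v)"
      using act_add[OF h(1) c] act_smult[OF h(1) assms(3)] h(3) by simp
    also have "\<dots> = f \<cdot>\<^sub>v ?w"
      using c assms(3) by (intro eq_vecI) (auto simp: distrib_left mult.left_commute)
    finally show ?thesis .
  qed
  ultimately show ?thesis using that by blast
qed

text \<open>Schur's lemma for an involution, by means of its invariant fixed space. Commutation is
  required of the actions because \<open>Atr 1\<close> will commute with the group only after \<rho>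
  is applied.\<close>

lemma central_involution:
  assumes z: "z \<in> C" "z \<circ> z = id"
    and central: "\<And>g v. g \<in> C \<Longrightarrow> v \<in> carrier_vec d \<Longrightarrow> act g (act z v) = act z (act g v)"
  shows "(\<forall>v \<in> carrier_vec d. act z v = v) \<or> (\<forall>v \<in> carrier_vec d. act z v = - 1 \<cdot>\<^sub>v v)"
proof -
  let ?W = "{v \<in> carrier_vec d. act z v = v}"
  have "act z (0\<^sub>v d) = 0\<^sub>v d"
    unfolding act_def using rho_carrier[OF z(1)] by (intro eq_vecI) (auto simp: scalar_prod_def)
  then have "invariant_subspace C d \<rho> ?W"
    unfolding invariant_subspace_def act_def[symmetric]
    using act_add[OF z(1)] act_smult[OF z(1)] central[symmetric] act_carrier by auto
  from irr[OF this] show ?thesis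
  proof
    assume W: "?W = {0\<^sub>v d}"
    have "act z v = - 1 \<cdot>\<^sub>v v" if v: "v \<in> carrier_vec d" for v
    proof (rule ccontr)
      assume "act z v \<noteq> - 1 \<cdot>\<^sub>v v"
      from eigenvector[OF z v _ this] obtain w where "w \<in> carrier_vec d" "w \<noteq> 0\<^sub>v d" "act z w = 1 \<cdot>\<^sub>v w"
        by (metis mult_1)
      then have "w \<in> ?W" by simp
      then show False using W \<open>w \<noteq> 0\<^sub>v d\<close> by simp
    qed
    then show ?thesis by blast
  qed auto
qed

text \<open>Under scalars every subspace is invariant; for \<open>d > 1\<close> a coordinate
  hyperplane is a proper nonzero one.\<close>

lemma scalar_action_dim:
  assumes "\<And>g. g \<in> C \<Longrightarrow> \<exists>k. \<forall>v \<in> carrier_vec d. act g v = k \<cdot>\<^sub>v v"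
  shows "d = 1"
proof (rule ccontr)
  assume "d \<noteq> 1"
  then have d: "d > 1" using d_pos by simp
  let ?W = "{v \<in> carrier_vec d. v $ 0 = 0} :: complex vec set"
  have "invariant_subspace C d \<rho> ?W"
    unfolding invariant_subspace_def act_def[symmetric]
  proof (intro conjI ballI allI)
    fix g v assume gv: "g \<in> C" "v \<in> ?W"
    obtain k where "\<forall>v \<in> carrier_vec d. act g v = k \<cdot>\<^sub>v v" using assms[OF gv(1)] by blast
    then have "act g v = k \<cdot>\<^sub>v v" using gv(2) by blast
    moreover have "dim_vec v = d" using gv(2) by auto
    ultimately show "act g v \<in> ?W" using gv(2) d by auto
  next
    fix v w :: "complex vec" assume "v \<in> ?W" "w \<in> ?W"
    moreover from this have "dim_vec v = d" "dim_vec w = d" by auto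
    ultimately show "v + w \<in> ?W" using d by auto
  next
    fix k :: complex and v :: "complex vec" assume "v \<in> ?W"
    moreover from this have "dim_vec v = d" by auto
    ultimately show "k \<cdot>\<^sub>v v \<in> ?W" using d by auto
  qed (use d in auto)
  from irr[OF this] show False
  proof
    assume W: "?W = {0\<^sub>v d}"
    have "(unit_vec d 1 :: complex vec) \<in> ?W" using d by simp
    then have "unit_vec d 1 = (0\<^sub>v d :: complex vec)" using W by blast
    then have "unit_vec d 1 $ 1 = (0\<^sub>v d :: complex vec) $ 1" by simp
    then show False using d by simp
  next
    assume W: "?W = carrier_vec d"
    have "(unit_vec d 0 :: complex vec) \<in> ?W" unfolding W by simp
    then show False using d by simp
  qed
qed

lemma nonzero_entry:
  fixes v :: "complex vec"
  assumes "v \<in> carrier_vec d" "v \<noteq> 0\<^sub>v d"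
  obtains k where "k < d" "v $ k \<noteq> 0"
proof (rule ccontr)
  assume n: "\<not> thesis"
  note ob = that
  have z: "v $ k = 0" if "k < d" for k using ob[OF that] n by blast
  have "v = 0\<^sub>v d"
  proof (rule eq_vecI)
    fix i assume "i < dim_vec (0\<^sub>v d :: complex vec)"
    then have "i < d" by simp
    then show "v $ i = (0\<^sub>v d :: complex vec) $ i" using z by simp
  qed (use assms(1) in simp)
  then show False using assms(2) by contradiction
qed

definition coord :: "nat \<Rightarrow> complex vec \<Rightarrow> complex vec" where
  "coord k v = (1 / v $ k) \<cdot>\<^sub>v unit_vec d k"

lemma coord_self: "v \<in> carrier_vec d \<Longrightarrow> k < d \<Longrightarrow> v $ k \<noteq> 0 \<Longrightarrow> coord k v \<bullet> v = 1"
  by (simp add: coord_def)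

text \<open>Projects along the other eigenspace of the involution \<open>z\<close> before reading off a coordinate.\<close>

definition proj_coord :: "(nat \<Rightarrow> nat) \<Rightarrow> complex \<Rightarrow> nat \<Rightarrow> complex vec \<Rightarrow> complex vec" where
  "proj_coord z e k x = (1 / (2 * x $ k)) \<cdot>\<^sub>v vec d (\<lambda>b. (if b = k then 1 else 0) + e * \<rho> z $$ (k, b))"

text \<open>For signs, the factor \<open>1 + e * c\<close> is 2 on the eigenspace of
  \<open>e\<close> and 0 on the other one.\<close>

lemma proj_coord_apply:
  assumes "z \<in> C" "k < d" "v \<in> carrier_vec d" "act z v = c \<cdot>\<^sub>v v"
  shows "proj_coord z e k x \<bullet> v = (1 + e * c) * v $ k / (2 * x $ k)"
proof -
  have "vec d (\<lambda>b. (if b = k then 1 else 0) + e * \<rho> z $$ (k, b)) \<bullet> v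
      = (\<Sum>b<d. ((if b = k then 1 else 0) + e * \<rho> z $$ (k, b)) * v $ b)"
    using assms(3) by (simp add: scalar_prod_def lessThan_atLeast0)
  also have "\<dots> = (\<Sum>b<d. if b = k then v $ b else 0) + e * (\<Sum>b<d. \<rho> z $$ (k, b) * v $ b)"
    unfolding sum_distrib_left sum.distrib[symmetric] by (intro sum.cong refl) (auto simp: algebra_simps)
  also have "(\<Sum>b<d. \<rho> z $$ (k, b) * v $ b) = act z v $ k"
    unfolding act_def using rho_carrier[OF assms(1)] assms(2,3)
    by (auto simp: scalar_prod_def lessThan_atLeast0 intro!: sum.cong)
  also have "\<dots> = c * v $ k" unfolding assms(4) using assms(2,3) by simp
  finally show ?thesis
    using assms(2,3) unfolding proj_coord_def
    by (simp add: algebra_simps add_divide_distrib)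
qed

lemma proj_coord_carrier: "proj_coord z e k x \<in> carrier_vec d" "coord k x \<in> carrier_vec d"
  by (simp_all add: proj_coord_def coord_def)

end

section \<open>The four cases\<close>

text \<open>On a line with trivial braiding the Nichols algebra is a polynomial ring, and S_m is
  multiplication by m!.\<close>

lemma wform_replicate: "wform (\<lambda>_ _. 1) (replicate m i) (replicate m i) = fact m"
proof (induction m)
  case (Suc m)
  have e: "take p (replicate (Suc m) i) @ drop (Suc p) (replicate (Suc m) i) = replicate m i" if "p < Suc m" for p
  proof -
    have "take p (replicate (Suc m) i) @ drop (Suc p) (replicate (Suc m) i)
        = replicate (p + (m - p)) i"
      using that by (simp only: take_replicate drop_replicate replicate_add min_def) simp
    then show ?thesis using that by simp
  qed
  have p1: "prod_list (map (\<lambda>j. 1 :: complex) w) = 1" for w :: "'a list" by (induction w) auto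
  have "wform (\<lambda>_ _. 1) (replicate (Suc m) i) (replicate (Suc m) i)
      = (\<Sum>p<Suc m. wform (\<lambda>_ _. 1) (replicate m i) (replicate m i))"
    unfolding replicate_Suc wform.simps del_op_explicit unfolding replicate_Suc[symmetric] length_replicate
    by (intro sum.cong refl) (simp only: p1 e lessThan_iff nth_replicate, simp)
  then show ?case unfolding Suc by simp
qed simp

context centralizer_irrep
begin

lemma pi_scalar:
  "(\<forall>v \<in> carrier_vec d. act (pi_std n) v = v) \<or> (\<forall>v \<in> carrier_vec d. act (pi_std n) v = - 1 \<cdot>\<^sub>v v)"
proof (rule central_involution[OF pi_std_centralizer pi_std_involution])
  fix g and v :: "complex vec" assume gv: "g \<in> C" "v \<in> carrier_vec d"
  have "g \<circ> pi_std n = pi_std n \<circ> g" using gv(1) by (simp add: centralizer_def)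
  then show "act g (act (pi_std n) v) = act (pi_std n) (act g v)"
    using act_comp[OF gv(1) pi_std_centralizer gv(2)] act_comp[OF pi_std_centralizer gv] by simp
qed

lemma infinite_pi_trivial:
  assumes yd: "yd_enum n (pi_std n) M t g" and p: "\<And>v. v \<in> carrier_vec d \<Longrightarrow> act (pi_std n) v = v"
  shows "nichols_dim (M * d) (yd_coeff n (pi_std n) M t g d \<rho>) = \<infinity>"
proof (rule yd_nichols_infinite[OF rep d_pos yd, where K = "{0}" and c = "\<lambda>_. id" and \<tau> = "\<lambda>_. pi_std n"
      and I = "{0}" and blk = "\<lambda>_. 0" and \<xi> = "\<lambda>_. unit_vec d 0" and q = "\<lambda>_ _. 1" and \<phi> = "\<lambda>_. unit_vec d 0"])
  fix i j
  show "\<rho> (pinv id \<circ> pi_std n \<circ> id) *\<^sub>v unit_vec d 0 = 1 \<cdot>\<^sub>v unit_vec d 0"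
    using p[of "unit_vec d 0"] by (simp add: act_def)
next
  fix N
  show "\<exists>u w. set u \<subseteq> {0} \<and> set w \<subseteq> {0} \<and> N \<le> length u \<and> wform (\<lambda>_ _. 1) u (w :: int list) \<noteq> 0"
    by (intro exI[of _ "replicate N 0"]) (auto simp: wform_replicate)
qed (use d_pos pi_std_centralizer in \<open>auto simp: permutes_id\<close>)


lemma conj_inv_centralizer: "1 \<le> j \<Longrightarrow> j < n \<Longrightarrow> conj_inv n j k \<in> C"
  unfolding conj_inv_def
  by (auto intro!: centralizer_comp Atr_centralizer Btr_centralizer pi_std_centralizer)

lemma cycle3_power_permutes:
  assumes "1 \<le> j" "j < n"
  shows "(cycle3 j ^^ l) permutes {1..2 * n}"
proof (induction l)
  case 0
  show ?case unfolding funpow.simps by (rule permutes_id)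
next
  case (Suc l)
  show ?case unfolding funpow.simps by (rule permutes_compose[OF Suc cycle3_permutes[OF assms]])
qed

text \<open>Returning place \<open>l\<close> to place 0 lowers the index by \<open>l\<close>; the
  \<open>+ 3\<close> prevents truncated subtraction.\<close>

lemma conj_inv_conjugate:
  assumes j: "1 \<le> j" "j < n" and kl: "k \<in> {0, 1, 2}" "l \<in> {0, 1, 2}"
  shows "pinv (cycle3 j ^^ l) \<circ> conj_inv n j k \<circ> (cycle3 j ^^ l) = conj_inv n j ((k + 3 - l) mod 3)"
    "(cycle3 j ^^ l) \<circ> pi_std n \<circ> pinv (cycle3 j ^^ l) = conj_inv n j l"
proof -
  let ?c = "cycle3 j ^^ l" and ?k = "(k + 3 - l) mod 3"
  note i = permutes_inv_o[OF cycle3_power_permutes[OF j, of l]]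
  have "?k < 3" by simp
  then have k: "?k \<in> {0, 1, 2}" by auto
  have kk: "(?k + l) mod 3 = k" "(0 + l) mod 3 = l" using kl by auto
  have "pinv ?c \<circ> conj_inv n j k \<circ> ?c = pinv ?c \<circ> (conj_inv n j k \<circ> ?c)" by (rule comp_assoc)
  also have "\<dots> = (pinv ?c \<circ> ?c) \<circ> conj_inv n j ?k"
    using conj_inv_cycle3_power[OF j k, of l] unfolding kk by (simp only: comp_assoc)
  finally show "pinv ?c \<circ> conj_inv n j k \<circ> ?c = conj_inv n j ?k" unfolding i id_comp .
  have "?c \<circ> pi_std n = conj_inv n j l \<circ> ?c"
    using conj_inv_cycle3_power[OF j, of 0 l] unfolding kk by (simp add: conj_inv_def)
  then have "?c \<circ> pi_std n \<circ> pinv ?c = conj_inv n j l \<circ> (?c \<circ> pinv ?c)" by (simp only: comp_assoc)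
  then show "?c \<circ> pi_std n \<circ> pinv ?c = conj_inv n j l" unfolding i comp_id .
qed

lemma infinite_conj_inv:
  fixes I :: "int set"
  assumes yd: "yd_enum n (pi_std n) M t g" and j: "1 \<le> j" "j < n"
    and blk: "\<And>i. i \<in> I \<Longrightarrow> blk i \<in> {0, 1, 2}" and \<xi>: "\<And>i. i \<in> I \<Longrightarrow> \<xi> i \<in> carrier_vec d"
    and ev: "\<And>i k. i \<in> I \<Longrightarrow> k \<in> {0, 1, 2} \<Longrightarrow> act (conj_inv n j k) (\<xi> i) = ev i k \<cdot>\<^sub>v \<xi> i"
    and qev: "\<And>i i'. i \<in> I \<Longrightarrow> i' \<in> I \<Longrightarrow> q i i' = ev i' ((blk i + 3 - blk i') mod 3)"
    and \<phi>: "\<And>i. i \<in> I \<Longrightarrow> \<phi> i \<in> carrier_vec d"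
    and dual: "\<And>i i'. i \<in> I \<Longrightarrow> i' \<in> I \<Longrightarrow> blk i = blk i' \<Longrightarrow> \<phi> i \<bullet> \<xi> i' = (if i = i' then 1 else 0)"
    and q: "\<And>i i'. q i i' * q i i' = 1"
    and inf: "\<And>N. \<exists>u w. set u \<subseteq> I \<and> set w \<subseteq> I \<and> N \<le> length u \<and> wform q u w \<noteq> 0"
  shows "nichols_dim (M * d) (yd_coeff n (pi_std n) M t g d \<rho>) = \<infinity>"
proof (rule yd_nichols_infinite[OF rep d_pos yd, where K = "{0, 1, 2}" and c = "\<lambda>k. cycle3 j ^^ k"
      and \<tau> = "conj_inv n j" and I = I and blk = blk and \<xi> = \<xi> and q = q and \<phi> = \<phi>])
  fix k assume k: "k \<in> {0, 1, 2 :: nat}"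
  show "(cycle3 j ^^ k) permutes {1..2 * n}" by (rule cycle3_power_permutes[OF j])
  show "(cycle3 j ^^ k) \<circ> pi_std n \<circ> pinv (cycle3 j ^^ k) = conj_inv n j k"
    by (rule conj_inv_conjugate(2)[OF j k k])
next
  fix k l assume kl: "k \<in> {0, 1, 2 :: nat}" "l \<in> {0, 1, 2 :: nat}"
  show "pinv (cycle3 j ^^ l) \<circ> conj_inv n j k \<circ> (cycle3 j ^^ l) \<in> C"
    unfolding conj_inv_conjugate(1)[OF j kl] by (rule conj_inv_centralizer[OF j])
next
  fix i i' assume i: "i \<in> I" "i' \<in> I"
  let ?m = "(blk i + 3 - blk i') mod 3"
  have "?m < 3" by simp
  then have m: "?m \<in> {0, 1, 2}" by auto
  show "\<rho> (pinv (cycle3 j ^^ blk i') \<circ> conj_inv n j (blk i) \<circ> (cycle3 j ^^ blk i')) *\<^sub>v \<xi> i' = q i i' \<cdot>\<^sub>v \<xi> i'"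
    unfolding conj_inv_conjugate(1)[OF j blk[OF i(1)] blk[OF i(2)]] qev[OF i]
    using ev[OF i(2) m] unfolding act_def .
next
  show "inj_on (conj_inv n j) {0, 1, 2}" by (rule conj_inv_inj[OF j])
qed (fact blk \<xi> \<phi> dual q inf)+

lemma Atr_pair:
  assumes "1 \<le> j" "j < n"
  shows "Atr j \<circ> Atr (Suc j) \<in> C" "(Atr j \<circ> Atr (Suc j)) \<circ> (Atr j \<circ> Atr (Suc j)) = id"
    "(Atr j \<circ> Atr (Suc j)) \<circ> Btr j = Btr j \<circ> (Atr j \<circ> Atr (Suc j))"
proof -
  obtain m where j: "j = Suc m" using assms by (cases j) auto
  have a: "(Atr j \<circ> Atr (Suc j)) x = (if x = 2 * m + 1 then 2 * m + 2 else if x = 2 * m + 2 then 2 * m + 1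
      else if x = 2 * m + 3 then 2 * m + 4 else if x = 2 * m + 4 then 2 * m + 3 else x)" for x
    unfolding j by (simp add: Atr_apply_Suc)
  show "Atr j \<circ> Atr (Suc j) \<in> C" using assms by (intro centralizer_comp Atr_centralizer) auto
  show "(Atr j \<circ> Atr (Suc j)) \<circ> (Atr j \<circ> Atr (Suc j)) = id"
  proof
    fix x show "((Atr j \<circ> Atr (Suc j)) \<circ> (Atr j \<circ> Atr (Suc j))) x = id x"
      unfolding comp_apply[of "Atr j \<circ> Atr (Suc j)" "Atr j \<circ> Atr (Suc j)"] a by simp
  qed
  show "(Atr j \<circ> Atr (Suc j)) \<circ> Btr j = Btr j \<circ> (Atr j \<circ> Atr (Suc j))"
  proof
    fix x show "((Atr j \<circ> Atr (Suc j)) \<circ> Btr j) x = (Btr j \<circ> (Atr j \<circ> Atr (Suc j))) x"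
      unfolding comp_apply[of "Atr j \<circ> Atr (Suc j)" "Btr j"] comp_apply[of "Btr j" "Atr j \<circ> Atr (Suc j)"] a
      unfolding j Btr_apply by simp
  qed
qed

lemma infinite_triangle:
  assumes yd: "yd_enum n (pi_std n) M t g" and j: "1 \<le> j" "j < n"
    and p: "\<And>v. v \<in> carrier_vec d \<Longrightarrow> act (pi_std n) v = - 1 \<cdot>\<^sub>v v"
    and u: "u \<in> carrier_vec d" "act (Atr j \<circ> Atr (Suc j)) u \<noteq> u"
  shows "nichols_dim (M * d) (yd_coeff n (pi_std n) M t g d \<rho>) = \<infinity>"
proof -
  let ?a = "Atr j \<circ> Atr (Suc j)" and ?t = "conj_inv n j 1"
  note a = Atr_pair[OF j] and B = Btr_centralizer[OF j]
  have t1: "?t = Btr j \<circ> ?a \<circ> pi_std n" and t2: "conj_inv n j 2 = Btr j \<circ> pi_std n"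
    and t0: "conj_inv n j 0 = pi_std n" by (simp_all add: conj_inv_def)
  have tC: "?t \<in> C" by (rule conj_inv_centralizer[OF j])
  have Ba: "Btr j \<circ> ?a \<in> C" by (rule centralizer_comp[OF B a(1)])
  have BB: "Btr j \<circ> Btr j = id" by (rule Btr_involution[OF j(1)])
  have act_t: "act ?t v = - 1 \<cdot>\<^sub>v act (Btr j) (act ?a v)" if v: "v \<in> carrier_vec d" for v
    unfolding t1 act_comp[OF Ba pi_std_centralizer v] p[OF v] act_smult[OF Ba v] act_comp[OF B a(1) v] ..
  have act_t2: "act (conj_inv n j 2) v = - 1 \<cdot>\<^sub>v act (Btr j) v" if v: "v \<in> carrier_vec d" for v
    unfolding t2 act_comp[OF B pi_std_centralizer v] p[OF v] act_smult[OF B v] ..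
  obtain v where v: "v \<in> carrier_vec d" "v \<noteq> 0\<^sub>v d" "act ?a v = - 1 \<cdot>\<^sub>v v"
    by (rule eigenvector[OF a(1,2) u(1), of "- 1"]) (use u in auto)
  \<comment> \<open>\<open>Btr j\<close> commutes with \<open>?a\<close>, so projecting
    \<open>v\<close> to the eigenvalue 1 of \<open>Btr j\<close> preserves the eigenvalue of
    \<open>?a\<close>. The projection vanishes only if \<open>v\<close> is an eigenvector for -1
    already.\<close>
  have "\<exists>w \<epsilon>. w \<in> carrier_vec d \<and> w \<noteq> 0\<^sub>v d \<and> act ?a w = - 1 \<cdot>\<^sub>v w \<and> act (Btr j) w = \<epsilon> \<cdot>\<^sub>v w \<and> (\<epsilon> = 1 \<or> \<epsilon> = - 1)"
  proof (cases "act (Btr j) v = - 1 \<cdot>\<^sub>v v")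
    case True
    then show ?thesis using v by blast
  next
    case False
    obtain w where "w \<in> carrier_vec d" "w \<noteq> 0\<^sub>v d" "act (Btr j) w = 1 \<cdot>\<^sub>v w"
      "\<And>h f. h \<in> C \<Longrightarrow> h \<circ> Btr j = Btr j \<circ> h \<Longrightarrow> act h v = f \<cdot>\<^sub>v v \<Longrightarrow> act h w = f \<cdot>\<^sub>v w"
      by (rule eigenvector[OF B BB v(1), of 1]) (use False in auto)
    then show ?thesis using a(1,3) v(3) by blast
  qed
  then obtain w \<epsilon> where w: "w \<in> carrier_vec d" "w \<noteq> 0\<^sub>v d" "act ?a w = - 1 \<cdot>\<^sub>v w"
    "act (Btr j) w = \<epsilon> \<cdot>\<^sub>v w" and \<epsilon>: "\<epsilon> = 1 \<or> \<epsilon> = - 1" by blast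
  obtain k where k: "k < d" "w $ k \<noteq> 0" using nonzero_entry[OF w(1,2)] .
  define ev where "ev m = (if m = 0 then - 1 else if m = 1 then \<epsilon> else - \<epsilon>)" for m :: nat
  have evw: "act (conj_inv n j m) w = ev m \<cdot>\<^sub>v w" if "m \<in> {0, 1, 2}" for m
  proof -
    consider "m = 0" | "m = 1" | "m = 2" using \<open>m \<in> {0, 1, 2}\<close> by blast
    then show ?thesis
    proof cases
      case 1
      then show ?thesis unfolding 1 t0 using p[OF w(1)] by (simp add: ev_def)
    next
      case 2
      show ?thesis unfolding 2 act_t[OF w(1)] w(3) act_smult[OF B w(1)] w(4)
        by (simp add: ev_def smult_smult_assoc)
    next
      case 3
      show ?thesis unfolding 3 act_t2[OF w(1)] w(4) by (simp add: ev_def smult_smult_assoc)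
    qed
  qed
  \<comment> \<open>For \<epsilon> = -1 the eigenvalues at the differences 1 and 2 are exchanged;
    listing the places in the opposite order restores \<open>tri_q\<close>.\<close>
  define blk where "blk i = (if \<epsilon> = 1 then nat i else nat ((- i) mod 3))" for i :: int
  show ?thesis
  proof (rule infinite_conj_inv[OF yd j, where I = "{0, 1, 2}" and blk = blk and \<xi> = "\<lambda>_. w"
        and ev = "\<lambda>_. ev" and q = tri_q and \<phi> = "\<lambda>_. coord k w"])
    fix i :: int assume "i \<in> {0, 1, 2}"
    then show "blk i \<in> {0, 1, 2}" by (elim insertE emptyE) (simp_all add: blk_def)
  next
    fix i i' :: int assume "i \<in> {0, 1, 2}" "i' \<in> {0, 1, 2}"
    then show "tri_q i i' = ev ((blk i + 3 - blk i') mod 3)"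
      using \<epsilon> by (elim insertE emptyE disjE) (simp_all add: blk_def ev_def)
  next
    fix i i' :: int assume "i \<in> {0, 1, 2}" "i' \<in> {0, 1, 2}" "blk i = blk i'"
    then have "i = i'" using \<epsilon> by (elim insertE emptyE disjE) (simp_all add: blk_def)
    then show "coord k w \<bullet> w = (if i = i' then 1 else 0)" using coord_self[OF w(1) k] by simp
  next
    fix N
    show "\<exists>u w. set u \<subseteq> {0, 1, 2} \<and> set w \<subseteq> {0, 1, 2} \<and> N \<le> length u \<and> wform tri_q u w \<noteq> 0"
    proof -
      obtain u w where "set u \<subseteq> {0, 1, 2}" "set w \<subseteq> {0, 1, 2}" "length u = 3 * N + 2" "wform tri_q u w \<noteq> 0"
        using tri_wform_nonzero[of N] by blast
      then show ?thesis by (intro exI[of _ u] exI[of _ w]) simp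
    qed
  qed (use w evw proj_coord_carrier tri_q_sq in auto)
qed

text \<open>A residue modulo 6 encodes the eigenvector by its parity and the place by its residue
  modulo 3. Different eigenvector and different place then mean an odd difference other than 3, that
  is 1 or -1 modulo 6.\<close>

lemma infinite_hexagon:
  assumes yd: "yd_enum n (pi_std n) M t g" and j: "1 \<le> j" "j < n"
    and p: "\<And>v. v \<in> carrier_vec d \<Longrightarrow> act (pi_std n) v = - 1 \<cdot>\<^sub>v v"
    and a: "\<And>v. v \<in> carrier_vec d \<Longrightarrow> act (Atr j \<circ> Atr (Suc j)) v = v"
    and x: "x \<in> carrier_vec d" "x \<noteq> 0\<^sub>v d" "act (Btr j) x = - 1 \<cdot>\<^sub>v x"
    and y: "y \<in> carrier_vec d" "y \<noteq> 0\<^sub>v d" "act (Btr j) y = 1 \<cdot>\<^sub>v y"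
  shows "nichols_dim (M * d) (yd_coeff n (pi_std n) M t g d \<rho>) = \<infinity>"
proof -
  let ?a = "Atr j \<circ> Atr (Suc j)"
  note aC = Atr_pair(1)[OF j] and B = Btr_centralizer[OF j]
  have Ba: "Btr j \<circ> ?a \<in> C" by (rule centralizer_comp[OF B aC])
  have act_t: "act (conj_inv n j m) v = - 1 \<cdot>\<^sub>v (if m = 0 then v else act (Btr j) v)"
    if v: "v \<in> carrier_vec d" for v m
  proof -
    have "act (Btr j \<circ> ?a \<circ> pi_std n) v = - 1 \<cdot>\<^sub>v act (Btr j) v"
      unfolding act_comp[OF Ba pi_std_centralizer v] p[OF v] act_smult[OF Ba v] act_comp[OF B aC v] a[OF v] ..
    moreover have "act (Btr j \<circ> pi_std n) v = - 1 \<cdot>\<^sub>v act (Btr j) v"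
      unfolding act_comp[OF B pi_std_centralizer v] p[OF v] act_smult[OF B v] ..
    ultimately show ?thesis using p[OF v] by (simp add: conj_inv_def)
  qed
  obtain kx where kx: "kx < d" "x $ kx \<noteq> 0" using nonzero_entry[OF x(1,2)] .
  obtain ky where ky: "ky < d" "y $ ky \<noteq> 0" using nonzero_entry[OF y(1,2)] .
  define \<xi> where "\<xi> i = (if odd i then y else x)" for i :: int
  \<comment> \<open>Both eigenvectors occur in every place, so each functional has to kill the other
    one.\<close>
  define \<phi> where "\<phi> i = (if odd i then proj_coord (Btr j) 1 ky y else proj_coord (Btr j) (- 1) kx x)" for i :: int
  define ev where "ev i m = (if odd i \<or> m = 0 then - 1 else 1 :: complex)" for i :: int and m :: nat
  define q where "q i i' = (if odd i' \<or> (i - i') mod 3 = 0 then - 1 else 1 :: complex)" for i i' :: int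
  have qsq: "q i i' * q i i' = 1" for i i' by (simp add: q_def)
  let ?I = "{0, 1, 2, 3, 4, 5} :: int set"
  have pair: "\<phi> i \<bullet> \<xi> i' = (if odd i = odd i' then 1 else 0)" for i i'
    using proj_coord_apply[OF B kx(1) x(1,3)] proj_coord_apply[OF B kx(1) y(1,3)]
      proj_coord_apply[OF B ky(1) x(1,3)] proj_coord_apply[OF B ky(1) y(1,3)] kx ky
    by (simp add: \<phi>_def \<xi>_def)
  show ?thesis
  proof (rule infinite_conj_inv[OF yd j, where I = ?I and blk = "\<lambda>i. nat (i mod 3)" and \<xi> = \<xi>
        and ev = ev and q = q and \<phi> = \<phi>])
    fix i :: int assume "i \<in> ?I"
    then show "nat (i mod 3) \<in> {0, 1, 2}" by (elim insertE emptyE) simp_all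
  next
    fix i :: int and m :: nat
    show "act (conj_inv n j m) (\<xi> i) = ev i m \<cdot>\<^sub>v \<xi> i"
      using x y act_t[OF x(1), of m] act_t[OF y(1), of m]
      by (simp add: \<xi>_def ev_def smult_smult_assoc)
  next
    fix i i' :: int assume "i \<in> ?I" "i' \<in> ?I"
    then show "q i i' = ev i' ((nat (i mod 3) + 3 - nat (i' mod 3)) mod 3)"
      by (elim insertE emptyE) (simp_all add: q_def ev_def)
  next
    fix i i' :: int assume "i \<in> ?I" "i' \<in> ?I" "nat (i mod 3) = nat (i' mod 3)"
    then have "(odd i = odd i') = (i = i')" by (elim insertE emptyE) simp_all
    then show "\<phi> i \<bullet> \<xi> i' = (if i = i' then 1 else 0)" using pair by simp
  next
    fix N
    \<comment> \<open>Here \<open>q\<close> is -1 between some letters that are not neighbours,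
      against the requirement of the path functions; the twist leads to
      \<open>hex_q\<close>.\<close>
    have "\<exists>\<tau>. (\<forall>v. \<tau> v * \<tau> v = 1) \<and>
      (\<forall>u w. set u \<subseteq> ?I \<longrightarrow> set w \<subseteq> ?I \<longrightarrow> wform q u w = \<tau> u * \<tau> w * (wform hex_q u w :: complex))"
    proof (rule wform_twist[OF hex_q_sq qsq])
      fix i i' assume i: "i \<in> ?I"
      then show "hex_q i i = q i i" by (elim insertE emptyE) (simp_all add: q_def)
      assume "i' \<in> ?I"
      with i show "hex_q i i' * hex_q i' i = q i i' * q i' i"
        by (elim insertE emptyE) (simp_all add: q_def)
    qed
    then obtain \<tau> where \<tau>: "\<And>v. \<tau> v * \<tau> v = (1 :: complex)"
      "\<And>u w. set u \<subseteq> ?I \<Longrightarrow> set w \<subseteq> ?I \<Longrightarrow> wform q u w = \<tau> u * \<tau> w * wform hex_q u w"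
      by blast
    obtain u w where uw: "set u \<subseteq> ?I" "set w \<subseteq> ?I" "length u = 12 * N + 5" "wform hex_q u w \<noteq> 0"
      using hex_wform_nonzero[of N] by blast
    have "\<tau> v \<noteq> 0" for v using \<tau>(1)[of v] by auto
    then have "wform q u w \<noteq> 0" using \<tau>(2)[OF uw(1,2)] uw(4) by simp
    then show "\<exists>u w. set u \<subseteq> ?I \<and> set w \<subseteq> ?I \<and> N \<le> length u \<and> wform q u w \<noteq> 0"
      using uw(1-3) by (intro exI[of _ u] exI[of _ w]) simp
  qed (use x y qsq proj_coord_carrier in \<open>auto simp: \<xi>_def \<phi>_def\<close>)
qed


section \<open>The case where all A_j A_(j+1) act trivially\<close>

lemma act_Atr_eq:
  assumes "\<And>j v. 1 \<le> j \<Longrightarrow> j < n \<Longrightarrow> v \<in> carrier_vec d \<Longrightarrow> act (Atr j \<circ> Atr (Suc j)) v = v"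
    and "1 \<le> i" "i \<le> n" "v \<in> carrier_vec d"
  shows "act (Atr i) v = act (Atr 1) v"
  using assms(2,3)
proof (induction i rule: dec_induct)
  case (step j)
  have A: "Atr j \<in> C" "Atr (Suc j) \<in> C" using step by (auto intro!: Atr_centralizer)
  have "act (Atr (Suc j)) v = act (Atr j) (act (Atr j) (act (Atr (Suc j)) v))"
    using act_involution[OF A(1) Atr_involution act_carrier[OF A(2) assms(4)]] by simp
  also have "act (Atr j) (act (Atr (Suc j)) v) = v"
    using assms(1)[of j v] step assms(4) act_comp[OF A assms(4)] by simp
  finally show ?case using step by simp
qed simp

text \<open>Conjugation by B_j interchanges A_j and A_(j+1), which act alike. So A_1 acts as a
  central element even if it is not central in the group.\<close>

lemma act_Atr_scalar:
  assumes n: "n \<ge> 1"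
    and a: "\<And>j v. 1 \<le> j \<Longrightarrow> j < n \<Longrightarrow> v \<in> carrier_vec d \<Longrightarrow> act (Atr j \<circ> Atr (Suc j)) v = v"
  shows "(\<forall>v \<in> carrier_vec d. act (Atr 1) v = v) \<or> (\<forall>v \<in> carrier_vec d. act (Atr 1) v = - 1 \<cdot>\<^sub>v v)"
proof (rule central_involution)
  show A1: "Atr 1 \<in> C" using n by (intro Atr_centralizer) auto
  show "Atr 1 \<circ> Atr 1 = id" by (rule Atr_involution)
  have eqA: "act (Atr i) v = act (Atr 1) v" if "1 \<le> i" "i \<le> n" "v \<in> carrier_vec d" for i v
    by (rule act_Atr_eq) (use a that in auto)
  fix g and v :: "complex vec" assume "g \<in> C" "v \<in> carrier_vec d"
  then show "act g (act (Atr 1) v) = act (Atr 1) (act g v)"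
  proof (induction g arbitrary: v rule: centralizer_induct)
    case id
    show ?case unfolding act_id[OF id] act_id[OF act_carrier[OF A1 id]] ..
  next
    case (Atr i g)
    have i: "Atr i \<in> C" using Atr by (intro Atr_centralizer)
    note gv = act_carrier[OF Atr(3,5)]
    show ?case
      unfolding act_comp[OF i Atr(3) act_carrier[OF A1 Atr(5)]] act_comp[OF i Atr(3,5)] Atr(4)[OF Atr(5)]
        eqA[OF Atr(1,2) act_carrier[OF A1 gv]] eqA[OF Atr(1,2) gv] ..
  next
    case (Btr j g)
    have j: "Btr j \<in> C" using Btr by (intro Btr_centralizer)
    have Aj: "Atr j \<in> C" "Atr (Suc j) \<in> C" using Btr by (auto intro!: Atr_centralizer)
    have BA: "Btr j \<circ> Atr (Suc j) = Atr j \<circ> Btr j"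
    proof -
      obtain m where "j = Suc m" using Btr(1) by (cases j) auto
      then show ?thesis by (auto simp: fun_eq_iff Btr_apply Atr_apply_Suc)
    qed
    let ?w = "act g v"
    have w: "?w \<in> carrier_vec d" by (rule act_carrier[OF Btr(3,5)])
    have "act (Btr j) (act (Atr 1) ?w) = act (Btr j) (act (Atr (Suc j)) ?w)"
      using eqA[OF _ _ w, of "Suc j"] Btr(1,2) by simp
    also have "\<dots> = act (Atr j) (act (Btr j) ?w)"
      using act_comp[OF j Aj(2) w] act_comp[OF Aj(1) j w] BA by simp
    also have "\<dots> = act (Atr 1) (act (Btr j) ?w)"
      using eqA[OF _ _ act_carrier[OF j w], of j] Btr(1,2) by simp
    finally show ?case
      unfolding act_comp[OF j Btr(3) act_carrier[OF A1 Btr(5)]] act_comp[OF j Btr(3,5)] Btr(4)[OF Btr(5)] .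
  qed
qed

lemma act_pi_std_power:
  assumes A: "\<And>i v. 1 \<le> i \<Longrightarrow> i \<le> n \<Longrightarrow> v \<in> carrier_vec d \<Longrightarrow> act (Atr i) v = \<alpha> \<cdot>\<^sub>v v"
    and "m \<le> n" "v \<in> carrier_vec d"
  shows "pi_std m \<in> C \<and> act (pi_std m) v = \<alpha> ^ m \<cdot>\<^sub>v v"
  using assms(2,3)
proof (induction m arbitrary: v)
  case 0
  have "pi_std 0 = id" by (simp add: pi_std_def)
  show ?case
    unfolding \<open>pi_std 0 = id\<close> power_0 one_smult_vec act_id[OF 0(2)] using centralizer_id by blast
next
  case (Suc m)
  have Am: "Atr (Suc m) \<in> C" using Suc.prems by (intro Atr_centralizer) auto
  have IH: "pi_std m \<in> C" "act (pi_std m) v = \<alpha> ^ m \<cdot>\<^sub>v v" using Suc.IH Suc.prems by auto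
  have "act (pi_std m \<circ> Atr (Suc m)) v = \<alpha> ^ Suc m \<cdot>\<^sub>v v"
    using act_comp[OF IH(1) Am Suc.prems(2)] A[of "Suc m" v] act_smult[OF IH(1) Suc.prems(2)] IH(2) Suc.prems
    by (simp add: smult_smult_assoc)
  then show ?case unfolding pi_std_Suc using centralizer_comp[OF IH(1) Am] by blast
qed

lemma unit_vec_smult_inj:
  assumes "k \<cdot>\<^sub>v unit_vec d 0 = l \<cdot>\<^sub>v (unit_vec d 0 :: complex vec)"
  shows "k = l"
proof -
  have "(k \<cdot>\<^sub>v unit_vec d 0) $ 0 = (l \<cdot>\<^sub>v (unit_vec d 0 :: complex vec)) $ 0" unfolding assms ..
  then show ?thesis using d_pos by simp
qed

text \<open>The braid relation gives
  \<open>b j * (b (Suc j) * b j) = b (Suc j) * (b j * b (Suc j))\<close>, and the squares of the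
  signs are 1.\<close>

lemma Btr_sign_eq:
  assumes B: "\<And>j. 1 \<le> j \<Longrightarrow> j < n \<Longrightarrow> (b j = 1 \<or> b j = - 1) \<and> (\<forall>v \<in> carrier_vec d. act (Btr j) v = b j \<cdot>\<^sub>v v)"
    and "1 \<le> j" "j < n"
  shows "b j = b 1"
  using assms(2,3)
proof (induction j rule: dec_induct)
  case (step j)
  let ?u = "unit_vec d 0 :: complex vec"
  obtain m where m: "j = Suc m" using step by (cases j) auto
  have C: "Btr j \<in> C" "Btr (Suc j) \<in> C" using step by (auto intro!: Btr_centralizer)
  have b: "act (Btr j) v = b j \<cdot>\<^sub>v v" "act (Btr (Suc j)) v = b (Suc j) \<cdot>\<^sub>v v" if "v \<in> carrier_vec d" for v
    using B[of j] B[of "Suc j"] step that by auto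
  have braid: "Btr j \<circ> (Btr (Suc j) \<circ> Btr j) = Btr (Suc j) \<circ> (Btr j \<circ> Btr (Suc j))"
    using Btr_apply[of "Suc m"] unfolding m by (auto simp: fun_eq_iff Btr_apply)
  have u: "?u \<in> carrier_vec d" by simp
  have "act (Btr j \<circ> (Btr (Suc j) \<circ> Btr j)) ?u = (b j * (b (Suc j) * b j)) \<cdot>\<^sub>v ?u"
    using act_comp[OF C(1) centralizer_comp[OF C(2,1)] u] act_comp[OF C(2,1) u]
    by (simp add: b smult_smult_assoc act_smult[OF C(1)] act_smult[OF C(2)] ac_simps)
  moreover have "act (Btr (Suc j) \<circ> (Btr j \<circ> Btr (Suc j))) ?u = (b (Suc j) * (b j * b (Suc j))) \<cdot>\<^sub>v ?u"
    using act_comp[OF C(2) centralizer_comp[OF C(1,2)] u] act_comp[OF C(1,2) u]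
    by (simp add: b smult_smult_assoc act_smult[OF C(1)] act_smult[OF C(2)] ac_simps)
  ultimately have "b j * (b (Suc j) * b j) = b (Suc j) * (b j * b (Suc j))"
    unfolding braid by (metis unit_vec_smult_inj)
  moreover have "b j = 1 \<or> b j = - 1" "b (Suc j) = 1 \<or> b (Suc j) = - 1"
    using B[of j] B[of "Suc j"] step by auto
  ultimately have "b (Suc j) = b j" by auto
  then show ?case using step by simp
qed simp

lemma rho_scalar:
  assumes "d = 1" "g \<in> C" "\<And>v. v \<in> carrier_vec d \<Longrightarrow> act g v = k \<cdot>\<^sub>v v"
  shows "\<rho> g = mat 1 1 (\<lambda>_. k)"
proof (rule eq_matI)
  have c: "\<rho> g \<in> carrier_mat 1 1" using rho_carrier[OF assms(2)] assms(1) by simp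
  fix i j assume "i < dim_row (mat 1 1 (\<lambda>_. k))" "j < dim_col (mat 1 1 (\<lambda>_. k))"
  then have ij: "i = 0" "j = 0" by auto
  have "act g (unit_vec 1 0) $ 0 = (k \<cdot>\<^sub>v unit_vec 1 0) $ 0"
    using assms(3)[of "unit_vec 1 0"] assms(1) by simp
  moreover have "act g (unit_vec 1 0) $ 0 = \<rho> g $$ (0, 0)"
    unfolding act_def using c by (simp add: scalar_prod_def)
  ultimately show "\<rho> g $$ (i, j) = mat 1 1 (\<lambda>_. k) $$ (i, j)" using ij by simp
qed (use rho_carrier[OF assms(2)] assms(1) in auto)

text \<open>Covers both parities: oddness of \<open>n\<close> is part of the exceptional
  alternative, and \<beta>, the common sign of the B_j, tells the two characters apart.\<close>

lemma nichols_infinite_or_character: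
  assumes n: "n \<ge> 2" and yd: "yd_enum n (pi_std n) M t g"
  shows "nichols_dim (M * d) (yd_coeff n (pi_std n) M t g d \<rho>) = \<infinity> \<or>
    odd n \<and> d = 1 \<and> (\<forall>i\<in>{1..n}. \<rho> (Atr i) = mat 1 1 (\<lambda>_. - 1)) \<and>
    (\<exists>\<beta> \<in> {1, - 1}. \<forall>j\<in>{1..<n}. \<rho> (Btr j) = mat 1 1 (\<lambda>_. \<beta>))"
proof (rule disjCI)
  assume notchar: "\<not> (odd n \<and> d = 1 \<and> (\<forall>i\<in>{1..n}. \<rho> (Atr i) = mat 1 1 (\<lambda>_. - 1)) \<and>
    (\<exists>\<beta> \<in> {1, - 1}. \<forall>j\<in>{1..<n}. \<rho> (Btr j) = mat 1 1 (\<lambda>_. \<beta>)))"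
  let ?inf = "nichols_dim (M * d) (yd_coeff n (pi_std n) M t g d \<rho>) = \<infinity>"
  let ?u = "unit_vec d 0 :: complex vec"
  have u: "?u \<in> carrier_vec d" by simp
  show ?inf
  proof (cases "\<forall>v \<in> carrier_vec d. act (pi_std n) v = v")
    case True
    then show ?thesis using infinite_pi_trivial[OF yd] by blast
  next
    case False
    then have p: "act (pi_std n) v = - 1 \<cdot>\<^sub>v v" if "v \<in> carrier_vec d" for v using pi_scalar that by blast
    show ?thesis
    proof (cases "\<exists>j v. 1 \<le> j \<and> j < n \<and> v \<in> carrier_vec d \<and> act (Atr j \<circ> Atr (Suc j)) v \<noteq> v")
      case True
      then show ?thesis using infinite_triangle[OF yd _ _ p] by blast
    next
      case False
      then have a: "act (Atr j \<circ> Atr (Suc j)) v = v" if "1 \<le> j" "j < n" "v \<in> carrier_vec d" for j v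
        using that by blast
      have A1: "act (Atr 1) v = - 1 \<cdot>\<^sub>v v" if "v \<in> carrier_vec d" for v
      proof (rule ccontr)
        assume ne: "act (Atr 1) v \<noteq> - 1 \<cdot>\<^sub>v v"
        have "\<forall>v \<in> carrier_vec d. act (Atr 1) v = v"
          using act_Atr_scalar[OF _ a] n ne that by auto
        then have "act (Atr i) v = 1 \<cdot>\<^sub>v v" if "1 \<le> i" "i \<le> n" "v \<in> carrier_vec d" for i v
          using act_Atr_eq[OF a that] that(3) by simp
        from act_pi_std_power[OF this _ u, of n] have "act (pi_std n) ?u = 1 \<cdot>\<^sub>v ?u" by simp
        then have "(- 1) \<cdot>\<^sub>v ?u = 1 \<cdot>\<^sub>v ?u" using p[OF u] by simp
        then have "(- 1 :: complex) = 1" by (rule unit_vec_smult_inj)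
        then show False by simp
      qed
      have A: "act (Atr i) v = - 1 \<cdot>\<^sub>v v" if "1 \<le> i" "i \<le> n" "v \<in> carrier_vec d" for i v
        using act_Atr_eq[OF a that] A1[OF that(3)] by simp
      have "act (pi_std n) ?u = (- 1) ^ n \<cdot>\<^sub>v ?u" using act_pi_std_power[OF A _ u, of n] by simp
      then have "(- 1) ^ n \<cdot>\<^sub>v ?u = - 1 \<cdot>\<^sub>v ?u" using p[OF u] by simp
      then have "(- 1 :: complex) ^ n = - 1" by (rule unit_vec_smult_inj)
      then have odd: "odd n" by (cases "even n") auto
      show ?thesis
      proof (cases "\<exists>j. 1 \<le> j \<and> j < n \<and> (\<exists>v \<in> carrier_vec d. act (Btr j) v \<noteq> v)
          \<and> (\<exists>v \<in> carrier_vec d. act (Btr j) v \<noteq> - 1 \<cdot>\<^sub>v v)")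
        case True
        then obtain j v w where j: "1 \<le> j" "j < n" and v: "v \<in> carrier_vec d" "act (Btr j) v \<noteq> v"
          and w: "w \<in> carrier_vec d" "act (Btr j) w \<noteq> - 1 \<cdot>\<^sub>v w" by blast
        note B = Btr_centralizer[OF j] Btr_involution[OF j(1)]
        obtain x where x: "x \<in> carrier_vec d" "x \<noteq> 0\<^sub>v d" "act (Btr j) x = - 1 \<cdot>\<^sub>v x"
          by (rule eigenvector[OF B v(1), of "- 1"]) (use v in auto)
        obtain y where y: "y \<in> carrier_vec d" "y \<noteq> 0\<^sub>v d" "act (Btr j) y = 1 \<cdot>\<^sub>v y"
          by (rule eigenvector[OF B w(1), of 1]) (use w in auto)
        show ?thesis by (rule infinite_hexagon[OF yd j p a[OF j] x y])
      next
        case False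
        define b :: "nat \<Rightarrow> complex" where "b j = (if \<forall>v \<in> carrier_vec d. act (Btr j) v = v then 1 else - 1)" for j
        have b: "(b j = 1 \<or> b j = - 1) \<and> (\<forall>v \<in> carrier_vec d. act (Btr j) v = b j \<cdot>\<^sub>v v)"
          if "1 \<le> j" "j < n" for j
          using False that by (auto simp: b_def)
        have "\<exists>k. \<forall>v \<in> carrier_vec d. act h v = k \<cdot>\<^sub>v v" if "h \<in> C" for h
          using that
        proof (induction h rule: centralizer_induct)
          case id
          show ?case by (intro exI[of _ 1] ballI) (simp only: act_id one_smult_vec)
        next
          case (Atr i h)
          then obtain k where k: "\<forall>v \<in> carrier_vec d. act h v = k \<cdot>\<^sub>v v" by blast
          have "Atr i \<in> C" using Atr by (intro Atr_centralizer)
          then have "act (Atr i \<circ> h) v = (- k) \<cdot>\<^sub>v v" if "v \<in> carrier_vec d" for v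
            using act_comp[OF _ Atr(3) that] k that A[OF Atr(1,2)] by (simp add: smult_smult_assoc)
          then show ?case by blast
        next
          case (Btr j h)
          then obtain k where k: "\<forall>v \<in> carrier_vec d. act h v = k \<cdot>\<^sub>v v" by blast
          have "Btr j \<in> C" using Btr by (intro Btr_centralizer)
          then have "act (Btr j \<circ> h) v = (b j * k) \<cdot>\<^sub>v v" if "v \<in> carrier_vec d" for v
            using act_comp[OF _ Btr(3) that] k that b[OF Btr(1,2)] by (simp add: smult_smult_assoc)
          then show ?case by blast
        qed
        then have d1: "d = 1" by (rule scalar_action_dim)
        have "\<rho> (Atr i) = mat 1 1 (\<lambda>_. - 1)" if "i \<in> {1..n}" for i
          by (rule rho_scalar[OF d1 Atr_centralizer A]) (use that in auto)
        moreover have "\<rho> (Btr j) = mat 1 1 (\<lambda>_. b 1)" if "j \<in> {1..<n}" for j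
        proof (rule rho_scalar[OF d1 Btr_centralizer])
          have j: "1 \<le> j" "j < n" using that by auto
          show "1 \<le> j" "j < n" by (fact j)+
          have "b j = b 1" by (rule Btr_sign_eq) (use b j in blast)+
          then show "act (Btr j) v = b 1 \<cdot>\<^sub>v v" if "v \<in> carrier_vec d" for v
            using b[OF j] that by simp
        qed
        moreover have "b 1 \<in> {1, - 1}" using b[of 1] n by auto
        ultimately show ?thesis using notchar odd d1 by blast
      qed
    qed
  qed
qed

end

theorem theorem2p12:
  fixes n d M :: nat and \<rho> :: "(nat \<Rightarrow> nat) \<Rightarrow> complex mat"
    and t g :: "nat \<Rightarrow> nat \<Rightarrow> nat"
  assumes "n \<ge> 2"
    and "irred_rep (centralizer n (pi_std n)) d \<rho>"
    and "yd_enum n (pi_std n) M t g"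
  shows "(even n \<longrightarrow>
            nichols_dim (M * d) (yd_coeff n (pi_std n) M t g d \<rho>) = \<infinity>)
       \<and> (odd n
          \<and> \<not> (d = 1 \<and> (\<forall>i\<in>{1..n}. \<rho> (Atr i) = mat 1 1 (\<lambda>_. -1))
                     \<and> (\<forall>j\<in>{1..<n}. \<rho> (Btr j) = mat 1 1 (\<lambda>_. 1)))
          \<and> \<not> (d = 1 \<and> (\<forall>i\<in>{1..n}. \<rho> (Atr i) = mat 1 1 (\<lambda>_. -1))
                     \<and> (\<forall>j\<in>{1..<n}. \<rho> (Btr j) = mat 1 1 (\<lambda>_. -1)))
          \<longrightarrow> nichols_dim (M * d) (yd_coeff n (pi_std n) M t g d \<rho>) = \<infinity>)"
proof -
  interpret centralizer_irrep n d \<rho> by unfold_locales (rule assms(2))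
  show ?thesis using nichols_infinite_or_character[OF assms(1,3)] by auto
qed

end
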